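(* Let $d\ge 5$ and let $\{S_n\}$ be a symmetric aperiodic random walk on $\mathbb{Z}^d$ satisfying the moment condition stated in the context. Let $r_n>0$ and $\delta_n>0$ be deterministic sequences such that $\delta_n$ is non-increasing, $r_n$ is non-decreasing, for every $c>0$ there is a constant $C>0$ with $r_{[cn]}/r_n<C$ (for all $n$ with $[cn]\ge 1$), and, with $$\beta_n:=r_n^{2d-4}\,\frac{\log\log n}{\log n},$$ $$\lim_{n\to\infty}\beta_n=0,\qquad \lim_{n\to\infty}\delta_n r_n^{2d-4}=0 .$$ Put $k_n=(1-\delta_n)\lambda\log n$ and define the random set of points $$\mathcal{A}_n=\{z\in\mathbb{Z}^d:\ \xi(z,n)\ge k_n\}.$$ Then $$\lim_{n\to\infty}\ \sup_{z\in\mathcal{A}_n}\ \sup_{x\in B(r_n)}\left|\frac{\xi(z+x,n)}{m_x\lambda\log n}-1\right|=0\quad\text{almost surely},$$ where $\sup_{z\in\mathcal{A}_n}$ is taken to be $0$ whenever $\mathcal{A}_n$ is empty.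
   Context: $S_0=0$, $S_n=\sum_{k=1}^n X_k$, where $X_1,X_2,\dots$ are i.i.d. $\mathbb{Z}^d$-valued with $\mathbf{P}(X_1=x)=p(x)$. Symmetric means $p(x)=p(-x)$ for all $x$. Aperiodic means: with $R^+=\{x\in\mathbb{Z}^d:\mathbf{P}(S_n=x)>0\text{ for some }n\ge0\}$, one has $\{y-z:\ y\in R^+,\,z\in R^+\}=\mathbb{Z}^d$. Moment condition (with $|x|$ the Euclidean norm): $\sum_x|x|^2p(x)<\infty$ if $d=3$; $\sum_x|x|^2\log(|x|+1)p(x)<\infty$ if $d=4$; $\sum_x|x|^{d-2}p(x)<\infty$ if $d\ge5$. $Q$ is the covariance matrix of $X_1$, $\Vert x\Vert^2:=xQ^{-1}x$, and $B(r)=\{x\in\mathbb{Z}^d:\Vert x\Vert\le r\}$. $\gamma:=\mathbf{P}(S_i\ne0,\ i=1,2,\dots)$ (which is $>0$ for $d\ge3$), $\gamma_x:=\mathbf{P}(S_i\ne x,\ i=1,2,\dots)$, $\lambda:=-1/\log(1-\gamma)$. $m_0=1$ and $m_x=(1-\gamma_x)^2/(1-\gamma)$ for $x\ne0$. Local time: $\xi(x,n):=\sum_{k=1}^n I\{S_k=x\}$. $[\cdot]$ denotes the integer part. *)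

theory Defs
  imports "HOL-Probability.Probability"
begin

text \<open>
  The lattice of dimension \<open>d\<close> is the type \<^typ>\<open>int ^ 'd\<close> with \<open>d = CARD('d)\<close>. Steps are
  numbered from 1, as usual for random walks: \<open>X 0\<close> is not used anywhere.
\<close>

definition random_walk :: "'a measure \<Rightarrow> (nat \<Rightarrow> 'a \<Rightarrow> int ^ 'd) \<Rightarrow> bool" where
  "random_walk M X \<longleftrightarrow>
     prob_space M \<and>
     prob_space.indep_vars M (\<lambda>_. count_space UNIV) X {1..} \<and>
     (\<forall>k\<ge>1. distr M (count_space UNIV) (X k) = distr M (count_space UNIV) (X 1))"

definition walk :: "(nat \<Rightarrow> 'a \<Rightarrow> int ^ 'd) \<Rightarrow> nat \<Rightarrow> 'a \<Rightarrow> int ^ 'd" where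
  "walk X n \<omega> = (\<Sum>k=1..n. X k \<omega>)"

definition step_prob :: "'a measure \<Rightarrow> (nat \<Rightarrow> 'a \<Rightarrow> int ^ 'd) \<Rightarrow> int ^ 'd \<Rightarrow> real" where
  "step_prob M X x = measure M {\<omega> \<in> space M. X 1 \<omega> = x}"

definition symmetric_walk :: "'a measure \<Rightarrow> (nat \<Rightarrow> 'a \<Rightarrow> int ^ 'd) \<Rightarrow> bool" where
  "symmetric_walk M X \<longleftrightarrow> (\<forall>x. step_prob M X x = step_prob M X (- x))"

definition reachable :: "'a measure \<Rightarrow> (nat \<Rightarrow> 'a \<Rightarrow> int ^ 'd) \<Rightarrow> (int ^ 'd) set" where
  "reachable M X = {x. \<exists>n. measure M {\<omega> \<in> space M. walk X n \<omega> = x} > 0}"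

definition aperiodic_walk :: "'a measure \<Rightarrow> (nat \<Rightarrow> 'a \<Rightarrow> int ^ 'd) \<Rightarrow> bool" where
  "aperiodic_walk M X \<longleftrightarrow> {y - z | y z. y \<in> reachable M X \<and> z \<in> reachable M X} = UNIV"

definition to_real_vec :: "int ^ 'd \<Rightarrow> real ^ 'd" where
  "to_real_vec x = (\<chi> i. real_of_int (x $ i))"

definition moment_condition :: "'a measure \<Rightarrow> (nat \<Rightarrow> 'a \<Rightarrow> int ^ 'd) \<Rightarrow> bool" where
  "moment_condition M X \<longleftrightarrow>
     (CARD('d) = 3 \<longrightarrow>
        (\<lambda>x. norm (to_real_vec x) ^ 2 * step_prob M X x) summable_on UNIV) \<and>
     (CARD('d) = 4 \<longrightarrow>
        (\<lambda>x. norm (to_real_vec x) ^ 2 * ln (norm (to_real_vec x) + 1) * step_prob M X x)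
          summable_on UNIV) \<and>
     (CARD('d) \<ge> 5 \<longrightarrow>
        (\<lambda>x. norm (to_real_vec x) ^ (CARD('d) - 2) * step_prob M X x) summable_on UNIV)"

definition covariance_matrix :: "'a measure \<Rightarrow> (nat \<Rightarrow> 'a \<Rightarrow> int ^ 'd) \<Rightarrow> real ^ 'd ^ 'd" where
  "covariance_matrix M X =
     (let Y = (\<lambda>i \<omega>. real_of_int (X 1 \<omega> $ i));
          \<mu> = (\<lambda>i. integral\<^sup>L M (Y i))
      in (\<chi> i j. integral\<^sup>L M (\<lambda>\<omega>. (Y i \<omega> - \<mu> i) * (Y j \<omega> - \<mu> j))))"

definition walk_norm :: "'a measure \<Rightarrow> (nat \<Rightarrow> 'a \<Rightarrow> int ^ 'd) \<Rightarrow> int ^ 'd \<Rightarrow> real" where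
  "walk_norm M X x =
     sqrt (to_real_vec x \<bullet> (matrix_inv (covariance_matrix M X) *v to_real_vec x))"

definition walk_ball :: "'a measure \<Rightarrow> (nat \<Rightarrow> 'a \<Rightarrow> int ^ 'd) \<Rightarrow> real \<Rightarrow> (int ^ 'd) set" where
  "walk_ball M X r = {x. walk_norm M X x \<le> r}"

definition avoid_prob :: "'a measure \<Rightarrow> (nat \<Rightarrow> 'a \<Rightarrow> int ^ 'd) \<Rightarrow> int ^ 'd \<Rightarrow> real" where
  "avoid_prob M X x = measure M {\<omega> \<in> space M. \<forall>i\<ge>1. walk X i \<omega> \<noteq> x}"

definition escape_prob :: "'a measure \<Rightarrow> (nat \<Rightarrow> 'a \<Rightarrow> int ^ 'd) \<Rightarrow> real" where
  "escape_prob M X = avoid_prob M X 0"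

definition walk_lambda :: "'a measure \<Rightarrow> (nat \<Rightarrow> 'a \<Rightarrow> int ^ 'd) \<Rightarrow> real" where
  "walk_lambda M X = - 1 / ln (1 - escape_prob M X)"

definition walk_m :: "'a measure \<Rightarrow> (nat \<Rightarrow> 'a \<Rightarrow> int ^ 'd) \<Rightarrow> int ^ 'd \<Rightarrow> real" where
  "walk_m M X x =
     (if x = 0 then 1 else (1 - avoid_prob M X x)\<^sup>2 / (1 - escape_prob M X))"

definition local_time :: "(nat \<Rightarrow> 'a \<Rightarrow> int ^ 'd) \<Rightarrow> int ^ 'd \<Rightarrow> nat \<Rightarrow> 'a \<Rightarrow> nat" where
  "local_time X x n \<omega> = (\<Sum>k=1..n. of_bool (walk X k \<omega> = x))"

definition heavy_points ::
  "'a measure \<Rightarrow> (nat \<Rightarrow> 'a \<Rightarrow> int ^ 'd) \<Rightarrow> (nat \<Rightarrow> real) \<Rightarrow> nat \<Rightarrow> 'a \<Rightarrow> (int ^ 'd) set" where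
  "heavy_points M X \<delta> n \<omega> =
     {z. real (local_time X z n \<omega>) \<ge> (1 - \<delta> n) * walk_lambda M X * ln (real n)}"

text \<open>
  The supremum is taken in \<^typ>\<open>ennreal\<close>. There the supremum of an unbounded family is
  \<open>\<infinity>\<close>, not an unspecified real number, and the supremum over the empty set is \<open>0\<close>,
  which is the convention used when there are no heavy points.
\<close>

definition max_deviation ::
  "'a measure \<Rightarrow> (nat \<Rightarrow> 'a \<Rightarrow> int ^ 'd) \<Rightarrow> (nat \<Rightarrow> real) \<Rightarrow> (nat \<Rightarrow> real) \<Rightarrow> nat \<Rightarrow> 'a \<Rightarrow> ennreal"
  where
  "max_deviation M X r \<delta> n \<omega> =
     (SUP z \<in> heavy_points M X \<delta> n \<omega>. SUP x \<in> walk_ball M X (r n).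
        ennreal \<bar>real (local_time X (z + x) n \<omega>) /
                  (walk_m M X x * walk_lambda M X * ln (real n)) - 1\<bar>)"

lemma max_deviation_no_heavy_points:
  "heavy_points M X \<delta> n \<omega> = {} \<Longrightarrow> max_deviation M X r \<delta> n \<omega> = 0"
  by (simp add: max_deviation_def bot_ennreal)

end

theory Submission
  imports Defs
begin

text \<open>
  Let \<open>G\<close> be the Green function. Then \<open>\<gamma> = 1 / G(0)\<close> and, for
  \<open>x \<noteq> 0\<close>, \<open>1 - \<gamma>\<^sub>x = G(x) / G(0)\<close>, abbreviated
  \<open>f\<close>. The number \<open>m\<^sub>x = f\<^sup>2 / (1 - \<gamma>)\<close> is the mean number of
  visits to \<open>x\<close> during an excursion from \<open>0\<close> conditioned to return. Cut the path at the
  first time it meets the pair \<open>{z, z + x}\<close>, or the point \<open>z\<close>: what follows is a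
  fresh walk, so the event that some point \<open>z\<close> with \<open>k\<close> visits before time
  \<open>n\<close> has an atypical count at \<open>z + x\<close> costs at most a constant times \<open>n\<close>
  times the probability that a walk started at \<open>0\<close> (or at \<open>x\<close>) visits \<open>0\<close>
  about \<open>k\<close> times and \<open>x\<close> an atypical number of times. For \<open>k\<close> near
  \<open>(1 - \<delta>) \<lambda> log n\<close> the \<open>k\<close> returns alone cost
  \<open>(1 - \<gamma>)\<^sup>k = n\<^bsup>-(1-\<delta>)\<^esup>\<close>, and the atypical count costs a
  further factor \<open>exp (- c m\<^sub>x log n)\<close>.

  This large deviation bound comes from a supersolution instead of a decomposition into excursions. The function
  \<open>g = G + \<kappa> f G(\<cdot> - x)\<close> is harmonic off \<open>{0, x}\<close>, and one step of
  averaging multiplies it by explicit factors \<open>\<rho>\<close> at \<open>0\<close> and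
  \<open>\<sigma>\<close> at \<open>x\<close>. Induction on the time horizon turns this into a bound by
  \<open>\<rho>\<^sup>k \<sigma>\<^sup>l\<close> for \<open>k\<close> visits to \<open>0\<close> and
  \<open>l\<close> to \<open>x\<close>. To first order in \<open>\<kappa>\<close> one has
  \<open>\<rho> = (1 - \<gamma>) exp (\<kappa> \<gamma> m\<^sub>x)\<close> and
  \<open>\<sigma> = exp (- \<kappa> \<gamma>)\<close>, so a small \<open>\<kappa>\<close> of the right sign
  beats any relative deviation of \<open>l\<close> from \<open>m\<^sub>x k\<close>; a positive
  \<open>\<kappa>\<close> treats too many visits (\<open>many_visits_bound\<close>), a negative one too few
  (\<open>few_visits_bound\<close>).

  The gain \<open>exp (- c m\<^sub>x log n)\<close> must beat \<open>n\<^sup>\<delta>\<close> and powers of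
  \<open>log n\<close>, for which one needs the lower bound \<open>G(x) \<ge> c |x|\<^bsup>2-d\<^esup>\<close>
  (\<open>green_lower\<close>). It follows from \<open>\<ell>\<^sup>2\<close> considerations alone. With
  \<open>p\<^sub>n\<close> the law of \<open>S\<^sub>n\<close>, the even return probabilities
  \<open>a\<^sub>n = p\<^bsub>2n\<^esub>(0)\<close> are decreasing and convex, and
  \<open>a\<^sub>n - p\<^bsub>2n\<^esub>(2y) \<le> C |y|\<^sup>2 (a\<^sub>n - a\<^bsub>n+1\<^esub>)\<close>,
  where convexity bounds the last difference by about \<open>a\<^sub>n / n\<close>. Summing over a box of side
  of order \<open>\<surd>n\<close> gives a self-improving inequality for \<open>a\<^sub>n\<close>, hence
  \<open>a\<^sub>n = O(n\<^bsup>-d/2\<^esup>)\<close> and transience; Chebyshev's inequality gives the matching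
  lower bound; and then \<open>p\<^bsub>2n\<^esub>(2y)\<close> is of the order of \<open>a\<^sub>n\<close> as soon
  as \<open>n\<close> is a large multiple of \<open>|y|\<^sup>2\<close>.

  With \<open>m\<^sub>x \<ge> c r\<^sub>n\<^bsup>4-2d\<^esup>\<close> on the ball, the hypothesis
  \<open>\<beta>\<^sub>n \<longlongrightarrow> 0\<close> says
  \<open>m\<^sub>x log n \<gg> log log n\<close>, and the hypothesis on \<open>\<delta>\<^sub>n\<close> says
  \<open>\<delta>\<^sub>n \<ll> m\<^sub>x\<close>. Along \<open>n = 2\<^sup>i\<close> the exceptional
  probabilities are therefore summable, and Borel-Cantelli applies. Between consecutive powers of \<open>2\<close>
  local times are monotone, \<open>log n\<close> changes by a factor that tends to \<open>1\<close>, and the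
  growth condition on \<open>r\<close> lets one radius serve the whole block.
\<close>

section \<open>Convolution powers of a symmetric step distribution\<close>

definition conv :: "'g::ab_group_add pmf \<Rightarrow> 'g pmf \<Rightarrow> 'g pmf" where
  "conv \<mu> \<nu> = bind_pmf \<mu> (\<lambda>x. map_pmf (\<lambda>y. x + y) \<nu>)"

primrec walk_pmf :: "'g::ab_group_add pmf \<Rightarrow> nat \<Rightarrow> 'g pmf" where
  "walk_pmf p 0 = return_pmf 0"
| "walk_pmf p (Suc n) = conv p (walk_pmf p n)"

lemma pmf_map_translate: "pmf (map_pmf (\<lambda>y. x + y) \<nu>) (z::'g::ab_group_add) = pmf \<nu> (z - x)"
proof -
  have "inj (\<lambda>y. x + y)" by simp
  from pmf_map_inj'[OF this, of \<nu> "z - x"] show ?thesis by simp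
qed

lemma pmf_conv: "pmf (conv \<mu> \<nu>) z = (\<integral>x. pmf \<nu> (z - x) \<partial>measure_pmf \<mu>)"
  by (simp add: conv_def pmf_bind pmf_map_translate)

lemma conv_return_0 [simp]: "conv (return_pmf 0) \<nu> = \<nu>"
  by (simp add: conv_def bind_return_pmf map_pmf_idI)

lemma conv_assoc: "conv (conv \<mu> \<nu>) \<rho> = conv \<mu> (conv \<nu> \<rho>)"
  by (simp add: conv_def map_pmf_def bind_assoc_pmf bind_return_pmf add.assoc)

lemma conv_commute: "conv \<mu> \<nu> = conv \<nu> \<mu>"
  unfolding conv_def map_pmf_def
  by (subst bind_commute_pmf) (simp add: add.commute)

lemma walk_pmf_add: "walk_pmf p (m + n) = conv (walk_pmf p m) (walk_pmf p n)"
  by (induction m) (simp_all add: conv_assoc)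

declare pmf_le_1 [simp]

lemma integrable_bounded_pmf:
  fixes f :: "'b \<Rightarrow> real"
  assumes "\<And>x. \<bar>f x\<bar> \<le> B"
  shows "integrable (measure_pmf p) f"
  by (rule measure_pmf.integrable_const_bound[where B = B]) (use assms in auto)

lemma pmf_walk_pmf_add_ge:
  "pmf (walk_pmf p (m + n)) (x + y) \<ge> pmf (walk_pmf p m) x * pmf (walk_pmf p n) y"
proof -
  have "pmf (walk_pmf p m) x * pmf (walk_pmf p n) y
        = (\<integral>w. indicator {x} w * pmf (walk_pmf p n) (x + y - w) \<partial>measure_pmf (walk_pmf p m))"
  proof -
    have "(\<integral>w. indicator {x} w * pmf (walk_pmf p n) (x + y - w) \<partial>measure_pmf (walk_pmf p m))
        = (\<integral>w. indicator {x} w * pmf (walk_pmf p n) y \<partial>measure_pmf (walk_pmf p m))"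
      by (intro Bochner_Integration.integral_cong) (auto simp: indicator_def)
    then show ?thesis by (simp add: measure_pmf_single)
  qed
  also have "\<dots> \<le> (\<integral>w. pmf (walk_pmf p n) (x + y - w) \<partial>measure_pmf (walk_pmf p m))"
    by (intro integral_mono integrable_bounded_pmf[where B = 1])
       (auto simp: indicator_def)
  finally show ?thesis
    by (simp add: walk_pmf_add pmf_conv)
qed

locale symmetric_step =
  fixes p :: "'g::{ab_group_add, countable} pmf"
  assumes symm: "pmf p (- x) = pmf p x"
begin

abbreviation W :: "nat \<Rightarrow> 'g pmf" where "W \<equiv> walk_pmf p"

lemma map_uminus_p: "map_pmf uminus p = p"
proof (rule pmf_eqI)
  fix x
  have "pmf (map_pmf uminus p) (- (- x)) = pmf p (- x)"
    by (rule pmf_map_inj') simp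
  then show "pmf (map_pmf uminus p) x = pmf p x" by (simp add: symm)
qed

lemma map_uminus_W: "map_pmf uminus (W n) = W n"
proof (induction n)
  case (Suc n)
  have "map_pmf uminus (conv p (W n)) = conv (map_pmf uminus p) (map_pmf uminus (W n))"
    by (simp add: conv_def map_pmf_def bind_assoc_pmf bind_return_pmf)
  then show ?case by (simp add: Suc map_uminus_p)
qed simp

lemma W_symm: "pmf (W n) (- x) = pmf (W n) x"
proof -
  have "pmf (map_pmf uminus (W n)) (- x) = pmf (W n) x"
    by (rule pmf_map_inj') simp
  then show ?thesis by (simp add: map_uminus_W)
qed

lemma W_symm': "pmf (W n) (x - y) = pmf (W n) (y - x)"
  using W_symm[of n "x - y"] by simp

text \<open>
  By symmetry the law of \<open>S\<^sub>n\<close> is also the kernel of the averaging operator of a step, so that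
  \<open>y \<mapsto> P(S\<^sub>n = y)\<close> may be advanced in time as a function of the starting point.
\<close>

lemma W_Suc: "pmf (W (Suc n)) y = (\<integral>w. pmf (W n) (y + w) \<partial>measure_pmf p)"
proof -
  have "pmf (W (Suc n)) y = (\<integral>w. pmf (W n) (y - w) \<partial>measure_pmf p)"
    by (simp add: pmf_conv)
  also have "\<dots> = (\<integral>w. pmf (W n) (y - w) \<partial>measure_pmf (map_pmf uminus p))"
    by (simp add: map_uminus_p)
  also have "\<dots> = (\<integral>w. pmf (W n) (y + w) \<partial>measure_pmf p)"
    by simp
  finally show ?thesis .
qed

lemma W_add: "pmf (W (m + n)) x = (\<integral>y. pmf (W m) y * pmf (W n) (y - x) \<partial>count_space UNIV)"
proof -
  have "pmf (W (m + n)) x = (\<integral>y. pmf (W n) (x - y) \<partial>measure_pmf (W m))"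
    by (simp add: walk_pmf_add pmf_conv)
  also have "\<dots> = (\<integral>y. pmf (W m) y * pmf (W n) (x - y) \<partial>count_space UNIV)"
    by (simp add: measure_pmf_eq_density integral_density)
  finally show ?thesis by (simp add: W_symm'[of n x])
qed

lemma integrable_W_mult:
  "integrable (count_space UNIV) (\<lambda>y. pmf (W m) (y - a) * pmf (W n) (y - b))"
proof (rule Bochner_Integration.integrable_bound)
  have "bij_betw (\<lambda>y. y - a) UNIV UNIV"
    by (rule bij_betwI[where g = "\<lambda>y. y + a"]) auto
  then show "integrable (count_space UNIV) (\<lambda>y. pmf (W m) (y - a))"
    by (subst integrable_bij_count_space) (auto intro: integrable_pmf)
  show "AE y in count_space UNIV. norm (pmf (W m) (y - a) * pmf (W n) (y - b)) \<le> norm (pmf (W m) (y - a))"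
    by (auto simp: mult_left_le)
qed auto

text \<open>
  Symmetry makes a convolution of laws an inner product for the counting measure. The bounds on
  return probabilities below are inequalities between such inner products.
\<close>

lemma integral_W_mult:
  "(\<integral>y. pmf (W m) (y - a) * pmf (W n) (y - b) \<partial>count_space UNIV) = pmf (W (m + n)) (b - a)"
proof -
  have "bij_betw (\<lambda>y. y - a) UNIV UNIV"
    by (rule bij_betwI[where g = "\<lambda>y. y + a"]) auto
  then have "(\<integral>y. pmf (W m) (y - a) * pmf (W n) (y - a - (b - a)) \<partial>count_space UNIV)
    = (\<integral>y. pmf (W m) y * pmf (W n) (y - (b - a)) \<partial>count_space UNIV)"
    by (rule integral_bij_count_space)
  then show ?thesis by (simp add: W_add)
qed

end

section \<open>Return probabilities at even times\<close>

context symmetric_step begin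

lemma integrable_W_diff_sq:
  "integrable (count_space UNIV) (\<lambda>y. (pmf (W m) (y - a) - pmf (W n) (y - b))\<^sup>2)"
  and integral_W_diff_sq:
  "(\<integral>y. (pmf (W m) (y - a) - pmf (W n) (y - b))\<^sup>2 \<partial>count_space UNIV)
     = pmf (W (2 * m)) 0 - 2 * pmf (W (m + n)) (b - a) + pmf (W (2 * n)) 0"
proof -
  let ?u = "\<lambda>y. pmf (W m) (y - a) * pmf (W m) (y - a)"
  let ?v = "\<lambda>y. 2 * (pmf (W m) (y - a) * pmf (W n) (y - b))"
  let ?w = "\<lambda>y. pmf (W n) (y - b) * pmf (W n) (y - b)"
  have *: "(\<lambda>y. (pmf (W m) (y - a) - pmf (W n) (y - b))\<^sup>2) = (\<lambda>y. (?u y - ?v y) + ?w y)"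
    by (simp add: power2_eq_square algebra_simps)
  have i: "integrable (count_space UNIV) ?u" "integrable (count_space UNIV) ?v"
    "integrable (count_space UNIV) ?w"
    by (intro integrable_mult_right integrable_W_mult)+
  have uv: "integrable (count_space UNIV) (\<lambda>y. ?u y - ?v y)"
    by (rule Bochner_Integration.integrable_diff[OF i(1,2)])
  show "integrable (count_space UNIV) (\<lambda>y. (pmf (W m) (y - a) - pmf (W n) (y - b))\<^sup>2)"
    unfolding * by (rule Bochner_Integration.integrable_add[OF uv i(3)])
  have v: "(\<integral>y. ?v y \<partial>count_space UNIV) = 2 * pmf (W (m + n)) (b - a)"
    by (subst integral_mult_right_zero) (simp only: integral_W_mult)
  have "(\<integral>y. (?u y - ?v y) + ?w y \<partial>count_space UNIV)
      = (\<integral>y. ?u y \<partial>count_space UNIV) - (\<integral>y. ?v y \<partial>count_space UNIV) + (\<integral>y. ?w y \<partial>count_space UNIV)"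
    by (subst Bochner_Integration.integral_add[OF uv i(3)],
        subst Bochner_Integration.integral_diff[OF i(1,2)]) (rule refl)
  then show "(\<integral>y. (pmf (W m) (y - a) - pmf (W n) (y - b))\<^sup>2 \<partial>count_space UNIV)
     = pmf (W (2 * m)) 0 - 2 * pmf (W (m + n)) (b - a) + pmf (W (2 * n)) 0"
    unfolding * v integral_W_mult mult_2[of m] mult_2[of n] by simp
qed

definition ret :: "nat \<Rightarrow> real" where
  "ret n = pmf (W (2 * n)) 0"

definition gap :: "nat \<Rightarrow> 'g \<Rightarrow> real" where
  "gap n x = ret n - pmf (W (2 * n)) x"

lemma gap_eq_norm:
  "2 * gap n x = (\<integral>y. (pmf (W n) y - pmf (W n) (y - x))\<^sup>2 \<partial>count_space UNIV)"
  using integral_W_diff_sq[of n 0 n x] by (simp add: gap_def ret_def mult_2[of n, symmetric])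

lemma gap_nonneg: "gap n x \<ge> 0"
proof -
  have "2 * gap n x \<ge> 0" unfolding gap_eq_norm by simp
  then show ?thesis by simp
qed

lemma gap_minus [simp]: "gap n (- x) = gap n x"
  by (simp add: gap_def W_symm)

lemma gap_0 [simp]: "gap n 0 = 0"
  by (simp add: gap_def ret_def)

lemma gap_translate:
  "2 * gap n z = (\<integral>y. (pmf (W n) (y - x) - pmf (W n) (y - (x + z)))\<^sup>2 \<partial>count_space UNIV)"
proof -
  have "bij_betw (\<lambda>y. y - x) UNIV UNIV"
    by (rule bij_betwI[where g = "\<lambda>y. y + x"]) auto
  then have "(\<integral>y. (pmf (W n) (y - x) - pmf (W n) ((y - x) - z))\<^sup>2 \<partial>count_space UNIV) =
        (\<integral>y. (pmf (W n) y - pmf (W n) (y - z))\<^sup>2 \<partial>count_space UNIV)"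
    by (rule integral_bij_count_space)
  then show ?thesis by (simp add: gap_eq_norm algebra_simps)
qed

text \<open>
  The gap is half the squared distance of the law of \<open>S\<^sub>n\<close> from its translate by \<open>x\<close>, so its
  root is subadditive in \<open>x\<close>. In the weighted form used here the optimal \<open>t\<close> is chosen later.
\<close>

lemma gap_triangle:
  assumes "t > 0"
  shows "gap n (x + z) \<le> (1 + 1 / t) * gap n x + (1 + t) * gap n z"
proof -
  have quad: "(u + v)\<^sup>2 \<le> (1 + 1 / t) * u\<^sup>2 + (1 + t) * v\<^sup>2" for u v :: real
  proof -
    have "(1 + 1 / t) * u\<^sup>2 + (1 + t) * v\<^sup>2 - (u + v)\<^sup>2 = (u - t * v)\<^sup>2 / t"
      using assms by (simp add: field_simps power2_eq_square)
    moreover have "(u - t * v)\<^sup>2 / t \<ge> 0" using assms by simp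
    ultimately show ?thesis by linarith
  qed
  have i1: "integrable (count_space UNIV) (\<lambda>y. (pmf (W n) y - pmf (W n) (y - x))\<^sup>2)"
    using integrable_W_diff_sq[of n 0 n x] by simp
  have i2: "integrable (count_space UNIV) (\<lambda>y. (pmf (W n) (y - x) - pmf (W n) (y - (x + z)))\<^sup>2)"
    by (rule integrable_W_diff_sq)
  have i3: "integrable (count_space UNIV) (\<lambda>y. (pmf (W n) y - pmf (W n) (y - (x + z)))\<^sup>2)"
    using integrable_W_diff_sq[of n 0 n "x + z"] by simp
  have "2 * gap n (x + z) = (\<integral>y. (pmf (W n) y - pmf (W n) (y - (x + z)))\<^sup>2 \<partial>count_space UNIV)"
    by (rule gap_eq_norm)
  also have "\<dots> \<le> (\<integral>y. (1 + 1 / t) * (pmf (W n) y - pmf (W n) (y - x))\<^sup>2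
                  + (1 + t) * (pmf (W n) (y - x) - pmf (W n) (y - (x + z)))\<^sup>2 \<partial>count_space UNIV)"
  proof (intro integral_mono i3 Bochner_Integration.integrable_add integrable_mult_right i1 i2)
    fix y
    show "(pmf (W n) y - pmf (W n) (y - (x + z)))\<^sup>2 \<le> (1 + 1 / t) * (pmf (W n) y - pmf (W n) (y - x))\<^sup>2
                  + (1 + t) * (pmf (W n) (y - x) - pmf (W n) (y - (x + z)))\<^sup>2"
      using quad[of "pmf (W n) y - pmf (W n) (y - x)" "pmf (W n) (y - x) - pmf (W n) (y - (x + z))"]
      by simp
  qed
  also have "\<dots> = (1 + 1 / t) * (2 * gap n x) + (1 + t) * (2 * gap n z)"
    unfolding gap_eq_norm[of n x] gap_translate[of n z x]
    by (subst Bochner_Integration.integral_add)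
       (auto intro!: integrable_mult_right i1 i2)
  finally show ?thesis by (simp add: algebra_simps)
qed

text \<open>
  The loss is quadratic in the number of summands, as it must be for a squared norm: adding
  one summand to \<open>l\<close> of them, the weight \<open>t = 1 / l\<close> turns \<open>l\<^sup>2\<close> into \<open>(l + 1)\<^sup>2\<close>.
\<close>

lemma gap_sum_list:
  assumes "\<And>e. e \<in> set es \<Longrightarrow> gap n e \<le> K"
  shows "gap n (sum_list es) \<le> (real (length es))\<^sup>2 * K"
  using assms
proof (induction es)
  case (Cons e es)
  have K: "gap n e \<le> K" and K': "gap n (sum_list es) \<le> (real (length es))\<^sup>2 * K"
    using Cons by auto
  show ?case
  proof (cases "es = []")
    case True then show ?thesis using K by simp
  next
    case False
    define l where "l = real (length es)"
    have l: "l > 0" using False by (simp add: l_def)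
    have "gap n (e + sum_list es) \<le> (1 + 1 / (1 / l)) * gap n e + (1 + 1 / l) * gap n (sum_list es)"
      by (rule gap_triangle) (use l in auto)
    also have "\<dots> \<le> (1 + 1 / (1 / l)) * K + (1 + 1 / l) * (l\<^sup>2 * K)"
      using l K K' by (intro add_mono mult_left_mono) (auto simp: l_def)
    also have "\<dots> = (l + 1)\<^sup>2 * K"
      using l by (simp add: field_simps power2_eq_square)
    finally show ?thesis by (simp add: l_def add.commute)
  qed
qed simp

lemma W_even_le: "pmf (W (2 * n)) x \<le> ret n"
  using gap_nonneg[of n x] by (simp add: gap_def)

lemma W_even_add_le: "pmf (W (k + 2 * n)) x \<le> ret n"
proof -
  have "pmf (W (k + 2 * n)) x = (\<integral>y. pmf (W (2 * n)) (x - y) \<partial>measure_pmf (W k))"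
    by (simp add: walk_pmf_add pmf_conv)
  also have "\<dots> \<le> (\<integral>y. ret n \<partial>measure_pmf (W k))"
    by (intro integral_mono integrable_bounded_pmf[where B = 1] W_even_le)
       (auto simp: ret_def)
  finally show ?thesis by simp
qed

lemma W_le_ret: "pmf (W n) x \<le> ret (n div 2)"
proof -
  have "n mod 2 + 2 * (n div 2) = n" by simp
  then show ?thesis using W_even_add_le[of "n mod 2" "n div 2" x] by simp
qed

lemma ret_nonneg: "ret n \<ge> 0" by (simp add: ret_def)

lemma ret_0 [simp]: "ret 0 = 1" by (simp add: ret_def)

lemma ret_Suc_le: "ret (Suc n) \<le> ret n"
  using W_even_add_le[of 2 n 0] by (simp add: ret_def)

lemma ret_antimono: "m \<le> n \<Longrightarrow> ret n \<le> ret m"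
  by (rule lift_Suc_antimono_le[of ret, OF ret_Suc_le])

text \<open>
  The second difference is the squared norm of \<open>p\<^sub>n - p\<^bsub>n+2\<^esub>\<close>.
\<close>

lemma ret_convex: "ret (Suc n) - ret (Suc (Suc n)) \<le> ret n - ret (Suc n)"
proof -
  have "0 \<le> (\<integral>y. (pmf (W n) (y - 0) - pmf (W (n + 2)) (y - 0))\<^sup>2 \<partial>count_space UNIV)"
    by (intro Bochner_Integration.integral_nonneg) simp
  also have "\<dots> = pmf (W (2 * n)) 0 - 2 * pmf (W (n + (n + 2))) (0 - 0) + pmf (W (2 * (n + 2))) 0"
    by (rule integral_W_diff_sq)
  also have "n + (n + 2) = 2 * Suc n" by simp
  also have "n + 2 = Suc (Suc n)" by simp
  finally show ?thesis by (simp add: ret_def del: mult_Suc_right)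
qed

lemma ret_diff_antimono: "m \<le> n \<Longrightarrow> ret n - ret (Suc n) \<le> ret m - ret (Suc m)"
  by (rule lift_Suc_antimono_le[of "\<lambda>n. ret n - ret (Suc n)", OF ret_convex])

text \<open>
  By convexity each of the \<open>m\<close> differences between \<open>m\<close> and \<open>2 m\<close> is at least the one at \<open>n\<close>, and
  they telescope.
\<close>

lemma ret_diff_le:
  assumes "2 * m \<le> n"
  shows "real m * (ret n - ret (Suc n)) \<le> ret m"
proof -
  have "real m * (ret n - ret (Suc n)) = (\<Sum>j=m..<2*m. ret n - ret (Suc n))"
    by simp
  also have "\<dots> \<le> (\<Sum>j=m..<2*m. ret j - ret (Suc j))"
    by (intro sum_mono ret_diff_antimono) (use assms in auto)
  also have "\<dots> = ret m - ret (2 * m)"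
    using sum_Suc_diff'[of m "2*m" "\<lambda>j. - ret j"] by simp
  also have "\<dots> \<le> ret m" using ret_nonneg by simp
  finally show ?thesis .
qed

text \<open>
  Averaging the gap over two steps of the walk gives exactly the decrease of the return
  probability; one term of that average is kept.
\<close>

lemma gap_step_le: "pmf (W 2) x * gap n x \<le> ret n - ret (Suc n)"
proof -
  have bd: "\<bar>gap n w\<bar> \<le> 1" for w
    using gap_nonneg[of n w] pmf_nonneg[of "W (2 * n)" w] pmf_le_1[of "W (2*n)" 0]
    unfolding gap_def ret_def by linarith
  have "pmf (W 2) x * gap n x = (\<integral>w. indicator {x} w * gap n x \<partial>measure_pmf (W 2))"
    by (simp add: measure_pmf_single)
  also have "\<dots> \<le> (\<integral>w. gap n w \<partial>measure_pmf (W 2))"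
    by (intro integral_mono integrable_bounded_pmf[where B = 1])
       (use bd gap_nonneg in \<open>auto simp: indicator_def\<close>)
  also have "\<dots> = (\<integral>w. ret n - pmf (W (2 * n)) (0 - w) \<partial>measure_pmf (W 2))"
    by (simp add: gap_def W_symm)
  also have "\<dots> = ret n - (\<integral>w. pmf (W (2 * n)) (0 - w) \<partial>measure_pmf (W 2))"
    by (subst Bochner_Integration.integral_diff)
       (auto intro!: integrable_bounded_pmf[where B = 1])
  also have "(\<integral>w. pmf (W (2 * n)) (0 - w) \<partial>measure_pmf (W 2)) = ret (Suc n)"
    unfolding pmf_conv[symmetric] walk_pmf_add[symmetric] by (simp add: ret_def)
  finally show ?thesis .
qed

text \<open>
  The points whose gap is, uniformly in time, at most a multiple of the decrease of the return
  probability. They form a group, which may be a proper subgroup when the walk has period two; that is why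
  doubled points appear from here on.
\<close>

definition gap_controlled :: "'g \<Rightarrow> bool" where
  "gap_controlled x \<longleftrightarrow> (\<exists>K. \<forall>n. gap n x \<le> K * (ret n - ret (Suc n)))"

lemma gap_controlled_add:
  assumes "gap_controlled x" "gap_controlled y"
  shows "gap_controlled (x + y)"
proof -
  from assms obtain K L where K: "\<And>n. gap n x \<le> K * (ret n - ret (Suc n))"
    and L: "\<And>n. gap n y \<le> L * (ret n - ret (Suc n))"
    by (auto simp: gap_controlled_def)
  show ?thesis unfolding gap_controlled_def
  proof (intro exI[of _ "2 * K + 2 * L"] allI)
    fix n
    show "gap n (x + y) \<le> (2 * K + 2 * L) * (ret n - ret (Suc n))"
      using gap_triangle[of 1 n x y] K[of n] L[of n] by (simp add: algebra_simps)
  qed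
qed

lemma gap_controlled_double_W:
  "x \<in> set_pmf (W n) \<Longrightarrow> gap_controlled (x + x)"
proof (induction n arbitrary: x)
  case 0
  then show ?case by (auto simp: gap_controlled_def intro!: exI[of _ 0])
next
  case (Suc n)
  then obtain w y where w: "w \<in> set_pmf p" and y: "y \<in> set_pmf (W n)" and x: "x = w + y"
    by (auto simp: conv_def)
  have "pmf (W 2) (w + w) \<ge> pmf (W 1) w * pmf (W 1) w"
    using pmf_walk_pmf_add_ge[of p 1 w 1 w] by (simp add: numeral_2_eq_2)
  moreover have "W 1 = p"
    by (simp add: conv_def map_pmf_def bind_return_pmf bind_return_pmf')
  ultimately have pos: "pmf (W 2) (w + w) > 0"
    using w by (smt (verit) mult_pos_pos pmf_positive)
  have "gap n (w + w) \<le> (1 / pmf (W 2) (w + w)) * (ret n - ret (Suc n))" for n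
    using gap_step_le[of "w + w" n] pos by (simp add: field_simps)
  then have "gap_controlled (w + w)" unfolding gap_controlled_def by blast
  from gap_controlled_add[OF this Suc.IH[OF y]]
  show ?case by (simp add: x algebra_simps)
qed

end

locale irreducible_step = symmetric_step p for p :: "'g::{ab_group_add, countable} pmf" +
  assumes reach: "\<exists>n. pmf (walk_pmf p n) x > 0"
begin

lemma gap_double_le:
  obtains K where "K > 0" "\<And>n. gap n (x + x) \<le> K * (ret n - ret (Suc n))"
proof -
  obtain m where "pmf (W m) x > 0" using reach by blast
  then have "x \<in> set_pmf (W m)" by (simp add: set_pmf_iff)
  from gap_controlled_double_W[OF this] obtain K
    where K: "\<And>n. gap n (x + x) \<le> K * (ret n - ret (Suc n))"
    by (auto simp: gap_controlled_def)
  have "gap n (x + x) \<le> max K 1 * (ret n - ret (Suc n))" for n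
    using K[of n] ret_Suc_le[of n] mult_right_mono[of K "max K 1" "ret n - ret (Suc n)"] by simp
  then show ?thesis using that[of "max K 1"] by simp
qed

end

section \<open>Transient walks and their Green function\<close>

text \<open>
  Uniformity in the starting point makes the Green function bounded.
\<close>

locale transient_step = irreducible_step p for p :: "'g::{ab_group_add, countable} pmf" +
  assumes green_finite: "\<exists>C. \<forall>N x. (\<Sum>n<N. pmf (walk_pmf p n) x) \<le> C"
begin

lemma summable_W: "summable (\<lambda>n. pmf (W n) x)"
proof -
  obtain C where C: "\<And>N x. (\<Sum>n<N. pmf (W n) x) \<le> C" using green_finite by blast
  show ?thesis by (rule summableI_nonneg_bounded[where x = C]) (auto intro: C)
qed

definition green :: "'g \<Rightarrow> real" where
  "green x = (\<Sum>n. pmf (W n) x)"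

lemma green_bounded:
  obtains C where "\<And>x. green x \<le> C"
proof -
  obtain C where C: "\<And>N x. (\<Sum>n<N. pmf (W n) x) \<le> C" using green_finite by blast
  have "green x \<le> C" for x
    unfolding green_def by (rule suminf_le_const[OF summable_W C])
  then show ?thesis by (rule that)
qed

lemma green_nonneg: "green x \<ge> 0"
  unfolding green_def by (intro suminf_nonneg summable_W) auto

lemma green_pos: "green x > 0"
proof -
  obtain n where "pmf (W n) x > 0" using reach by blast
  then show ?thesis unfolding green_def
    by (subst suminf_pos_iff[OF summable_W]) auto
qed

lemma green_minus [simp]: "green (- x) = green x"
  by (simp add: green_def W_symm)

text \<open>
  A symmetric walk can undo its first step.
\<close>

lemma green_0_gt_1: "green 0 > 1"
proof -
  obtain w where w: "w \<in> set_pmf p" using set_pmf_not_empty[of p] by blast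
  have W1: "W 1 = p" by (simp add: conv_def map_pmf_def bind_return_pmf bind_return_pmf')
  have "pmf (W (1 + 1)) (w + - w) \<ge> pmf (W 1) w * pmf (W 1) (- w)"
    by (rule pmf_walk_pmf_add_ge)
  moreover have "pmf (W 1) w * pmf (W 1) (- w) > 0"
    unfolding W1 symm using w by (simp add: pmf_positive_iff)
  ultimately have pos: "pmf (W 2) 0 > 0" by (simp add: numeral_2_eq_2)
  have "sum (\<lambda>n. pmf (W n) 0) {0, 2} \<le> green 0"
    unfolding green_def by (intro sum_le_suminf summable_W) auto
  then show ?thesis using pos by (simp add: numeral_2_eq_2)
qed

end

section \<open>A lower bound for the Green function on the lattice\<close>

text \<open>
  The \<open>\<ell>\<^sup>1\<close> norm counts the unit steps that a path needs to reach a lattice point.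
\<close>

definition l1 :: "int ^ 'd \<Rightarrow> nat" where
  "l1 y = (\<Sum>i\<in>UNIV. nat \<bar>y $ i\<bar>)"

definition lattice_box :: "nat \<Rightarrow> (int ^ 'd) set" where
  "lattice_box L = {y. \<forall>i. \<bar>y $ i\<bar> \<le> int L}"

lemma lattice_box_eq: "(lattice_box L :: (int ^ 'd) set) = vec_lambda ` (PiE UNIV (\<lambda>_. {- int L..int L}))"
proof (intro set_eqI iffI)
  fix y :: "int ^ 'd" assume "y \<in> lattice_box L"
  then have "vec_nth y \<in> PiE UNIV (\<lambda>_. {- int L..int L})" by (auto simp: lattice_box_def abs_le_iff minus_le_iff)
  then show "y \<in> vec_lambda ` (PiE UNIV (\<lambda>_. {- int L..int L}))"
    by (intro image_eqI[where x = "vec_nth y"]) auto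
next
  fix y :: "int ^ 'd" assume "y \<in> vec_lambda ` (PiE UNIV (\<lambda>_. {- int L..int L}))"
  then show "y \<in> lattice_box L" by (auto simp: lattice_box_def PiE_iff abs_le_iff minus_le_iff)
qed

lemma finite_box [simp]: "finite (lattice_box L :: (int ^ 'd) set)"
  unfolding lattice_box_eq by (intro finite_imageI finite_PiE) auto

lemma card_box: "card (lattice_box L :: (int ^ 'd) set) = (2 * L + 1) ^ CARD('d)"
proof -
  have "inj_on vec_lambda (PiE (UNIV :: 'd set) (\<lambda>_. {- int L..int L}))"
    by (auto intro!: inj_onI simp: vec_lambda_inject)
  then have "card (lattice_box L :: (int ^ 'd) set) = card (PiE (UNIV :: 'd set) (\<lambda>_. {- int L..int L}))"
    unfolding lattice_box_eq by (rule card_image)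
  also have "\<dots> = (2 * L + 1) ^ CARD('d)"
    by (simp add: card_PiE nat_add_distrib nat_mult_distrib)
  finally show ?thesis .
qed

lemma l1_box: "y \<in> lattice_box L \<Longrightarrow> l1 (y :: int ^ 'd) \<le> CARD('d) * L"
proof -
  assume "y \<in> lattice_box L"
  then have "l1 y \<le> (\<Sum>i\<in>(UNIV::'d set). L)"
    unfolding l1_def lattice_box_def by (intro sum_mono) (auto simp: nat_le_iff)
  then show ?thesis by simp
qed

lemma l1_pos: "y \<noteq> 0 \<Longrightarrow> l1 (y :: int ^ 'd) \<ge> 1"
proof -
  assume "y \<noteq> 0"
  then obtain i where "y $ i \<noteq> 0" by (auto simp: vec_eq_iff)
  then have "1 \<le> nat \<bar>y $ i\<bar>" by linarith
  also have "\<dots> \<le> l1 y" unfolding l1_def by (rule member_le_sum) auto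
  finally show ?thesis .
qed

lemma double_unit_decomposition:
  fixes y :: "int ^ 'd"
  shows "\<exists>es. sum_list es = y + y \<and> length es = l1 y \<and>
     (\<forall>e\<in>set es. \<exists>i. e = axis i 1 + axis i 1 \<or> e = - (axis i 1 + axis i 1))"
proof -
  define y' where "y' A = (\<Sum>i\<in>A. axis i (y $ i + y $ i))" for A
  have "\<exists>es. sum_list es = y' A \<and> length es = (\<Sum>i\<in>A. nat \<bar>y $ i\<bar>) \<and>
     (\<forall>e\<in>set es. \<exists>i. e = axis i 1 + axis i 1 \<or> e = - (axis i 1 + axis i 1))"
    if "finite A" for A
    using that
  proof induction
    case empty
    then show ?case by (intro exI[of _ "[]"]) (auto simp: y'_def)
  next
    case (insert i A)
    then obtain es where es: "sum_list es = y' A" "length es = (\<Sum>i\<in>A. nat \<bar>y $ i\<bar>)"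
      "\<forall>e\<in>set es. \<exists>i. e = axis i 1 + axis i 1 \<or> e = - (axis i 1 + axis i 1)" by blast
    define u :: "int ^ 'd" where "u = (if y $ i \<ge> 0 then axis i 1 + axis i 1 else - (axis i 1 + axis i 1))"
    have "of_nat (nat \<bar>y $ i\<bar>) * u = axis i (y $ i + y $ i)"
      by (auto simp: vec_eq_iff u_def axis_def of_nat_index simp del: of_nat_nat)
    then show ?case
      using insert.hyps es
      by (intro exI[of _ "replicate (nat \<bar>y $ i\<bar>) u @ es"])
         (auto simp: y'_def sum_list_replicate u_def)
  qed
  moreover have "y' UNIV = y + y"
    by (auto simp: vec_eq_iff y'_def axis_def if_distrib cong: if_cong)
  ultimately show ?thesis unfolding l1_def by (metis finite)
qed

locale lattice_step = irreducible_step p for p :: "(int ^ 'd) pmf" +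
  assumes second_moment: "(\<integral>\<^sup>+w. ennreal ((real_of_int (w $ i))\<^sup>2) \<partial>measure_pmf p) < \<infinity>"
    and dim: "CARD('d) \<ge> 3"
begin

lemma gap_le_l1:
  obtains K where "K \<ge> 1"
    "\<And>n y. gap n (y + y) \<le> K * (real (l1 y))\<^sup>2 * (ret n - ret (Suc n))"
proof -
  have "\<exists>K. K > 0 \<and> (\<forall>n. gap n (axis i 1 + axis i 1) \<le> K * (ret n - ret (Suc n)))" for i :: 'd
    using gap_double_le[of "axis i 1"] by metis
  then obtain k where k: "\<And>i. k i > 0"
    "\<And>i n. gap n (axis i 1 + axis i 1) \<le> k i * (ret n - ret (Suc n))" by metis
  define K where "K = 1 + (\<Sum>i\<in>UNIV. k i)"
  have kK: "k i \<le> K" for i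
    using member_le_sum[of i UNIV k] k(1) by (auto simp: K_def less_imp_le intro: order_trans)
  show ?thesis
  proof (rule that)
    show "K \<ge> 1" using k(1) by (auto simp: K_def less_imp_le intro!: sum_nonneg)
    fix n and y :: "int ^ 'd"
    obtain es where es: "sum_list es = y + y" "length es = l1 y"
      "\<And>e. e \<in> set es \<Longrightarrow> \<exists>i. e = axis i 1 + axis i 1 \<or> e = - (axis i 1 + axis i 1)"
      using double_unit_decomposition[of y] by blast
    have "gap n e \<le> K * (ret n - ret (Suc n))" if e: "e \<in> set es" for e
    proof -
      obtain i where "e = axis i 1 + axis i 1 \<or> e = - (axis i 1 + axis i 1)" using es(3)[OF e] by blast
      then have "gap n e = gap n (axis i 1 + axis i 1)" using gap_minus by metis
      also have "\<dots> \<le> k i * (ret n - ret (Suc n))" by (rule k)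
      also have "\<dots> \<le> K * (ret n - ret (Suc n))"
        by (intro mult_right_mono kK) (use ret_Suc_le in simp)
      finally show ?thesis .
    qed
    then have "gap n (sum_list es) \<le> (real (length es))\<^sup>2 * (K * (ret n - ret (Suc n)))"
      by (rule gap_sum_list)
    then show "gap n (y + y) \<le> K * (real (l1 y))\<^sup>2 * (ret n - ret (Suc n))"
      by (simp add: es mult_ac)
  qed
qed

text \<open>
  The points \<open>2 y\<close> with \<open>y\<close> in a box carry mass at most one after \<open>4 m\<close> steps, and each of them has
  nearly the mass of the origin.
\<close>

lemma ret_box_bound:
  assumes K: "K \<ge> 1" "\<And>n y. gap n (y + y) \<le> K * (real (l1 y))\<^sup>2 * (ret n - ret (Suc n))"
    and m: "m > 0"
  shows "ret (2 * m) \<le> 1 / real (2 * L + 1) ^ CARD('d)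
           + K * (real (CARD('d) * L))\<^sup>2 * (ret m / real m)"
proof -
  let ?N = "real (2 * L + 1) ^ CARD('d)"
  let ?E = "K * (real (CARD('d) * L))\<^sup>2 * (ret m / real m)"
  have N: "?N > 0" by simp
  have diff: "ret (2 * m) - ret (Suc (2 * m)) \<le> ret m / real m"
    using ret_diff_le[of m "2 * m"] m by (simp add: field_simps)
  have ge: "ret (2 * m) - ?E \<le> pmf (W (2 * (2 * m))) (y + y)" if "y \<in> lattice_box L" for y
  proof -
    have "gap (2 * m) (y + y) \<le> K * (real (l1 y))\<^sup>2 * (ret (2 * m) - ret (Suc (2 * m)))"
      by (rule K)
    also have "\<dots> \<le> ?E"
      using l1_box[OF that] K(1) ret_Suc_le[of "2 * m"] diff
      by (intro mult_mono power_mono) (auto simp: of_nat_mono simp del: of_nat_mult)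
    finally show ?thesis by (simp add: gap_def)
  qed
  have "?N * (ret (2 * m) - ?E) = (\<Sum>y\<in>(lattice_box L::(int^'d) set). ret (2 * m) - ?E)"
    by (simp add: card_box)
  also have "\<dots> \<le> (\<Sum>y\<in>lattice_box L. pmf (W (2 * (2 * m))) (y + y))"
    by (intro sum_mono ge)
  also have "\<dots> = sum (pmf (W (2 * (2 * m)))) ((\<lambda>y. y + y) ` lattice_box L)"
  proof (subst sum.reindex)
    show "inj_on (\<lambda>y::int^'d. y + y) (lattice_box L)" by (auto simp: inj_on_def vec_eq_iff)
  qed (simp add: o_def)
  also have "\<dots> = measure (W (2 * (2 * m))) ((\<lambda>y. y + y) ` lattice_box L)"
    by (subst measure_measure_pmf_finite) auto
  also have "\<dots> \<le> 1" by simp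
  finally have "ret (2 * m) - ?E \<le> 1 / ?N" using N by (simp add: field_simps)
  then show ?thesis by simp
qed

text \<open>
  The box of side \<open>2 ^ (j - s)\<close> makes the error term a small multiple of the return probability at
  time \<open>4 ^ j\<close>; with \<open>b\<^sub>j = 2\<^bsup>jd\<^esup> a\<^bsub>4^j\<^esub>\<close> this reads \<open>b\<^bsub>j+1\<^esub> \<le> B / 2 + b\<^sub>j / 2\<close>, so that \<open>b\<close> stays bounded.
\<close>

lemma ret_upper:
  obtains B where "B > 0" "\<And>j. ret (4 ^ j) \<le> B / 2 ^ (j * CARD('d))"
proof -
  let ?d = "CARD('d)"
  obtain K where K: "K \<ge> 1"
    "\<And>n y. gap n (y + y) \<le> K * (real (l1 y))\<^sup>2 * (ret n - ret (Suc n))"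
    by (rule gap_le_l1) blast
  obtain s where s: "K * (real ?d)\<^sup>2 * 2 * 2 ^ ?d < 4 ^ s"
    using real_arch_pow[of 4 "K * (real ?d)\<^sup>2 * 2 * 2 ^ ?d"] by auto
  define b where "b j = 2 ^ (j * ?d) * ret (4 ^ j)" for j
  define B :: real where "B = 2 * 2 ^ ?d * 2 ^ (s * ?d)"
  have B: "B > 0" by (simp add: B_def)
  have step: "b (Suc j) \<le> B / 2 + b j / 2" if j: "j \<ge> s" for j
  proof -
    define L :: nat where "L = 2 ^ (j - s)"
    have L0: "L > 0" by (simp add: L_def)
    have L2: "(real L)\<^sup>2 / 4 ^ j = 1 / 4 ^ s"
    proof -
      have "(real L)\<^sup>2 = 4 ^ (j - s)"
        by (simp add: L_def power_mult[symmetric] mult.commute[of _ 2] power_mult)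
      moreover have "(4::real) ^ j = 4 ^ s * 4 ^ (j - s)"
        using j by (simp flip: power_add)
      ultimately show ?thesis by simp
    qed
    have "ret (4 ^ Suc j) \<le> ret (2 * 4 ^ j)" by (rule ret_antimono) simp
    also have "\<dots> \<le> 1 / real (2 * L + 1) ^ ?d + K * (real (?d * L))\<^sup>2 * (ret (4 ^ j) / real (4 ^ j))"
      by (rule ret_box_bound[OF K]) auto
    also have "K * (real (?d * L))\<^sup>2 * (ret (4 ^ j) / real (4 ^ j)) =
       K * (real ?d)\<^sup>2 * ret (4 ^ j) * ((real L)\<^sup>2 / 4 ^ j)"
      by (simp add: power_mult_distrib)
    also have "\<dots> = (K * (real ?d)\<^sup>2 / 4 ^ s) * ret (4 ^ j)"
      by (simp add: L2)
    also have "\<dots> \<le> (1 / (2 * 2 ^ ?d)) * ret (4 ^ j)"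
      using s by (intro mult_right_mono ret_nonneg) (simp add: field_simps)
    also have "1 / real (2 * L + 1) ^ ?d \<le> 1 / (real L) ^ ?d"
      by (intro divide_left_mono power_mono mult_pos_pos zero_less_power) (use L0 in auto)
    also have "(real L) ^ ?d = 2 ^ ((j - s) * ?d)"
      by (simp add: L_def power_mult)
    finally have "ret (4 ^ Suc j) \<le> 1 / 2 ^ ((j - s) * ?d) + 1 / (2 * 2 ^ ?d) * ret (4 ^ j)"
      by simp
    then have "b (Suc j) \<le> 2 ^ (Suc j * ?d) * (1 / 2 ^ ((j - s) * ?d) + 1 / (2 * 2 ^ ?d) * ret (4 ^ j))"
      unfolding b_def by (intro mult_left_mono) auto
    also have "\<dots> = 2 ^ (Suc j * ?d) / 2 ^ ((j - s) * ?d) + b j / 2"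
      by (simp add: b_def field_simps power_add)
    also have "(2::real) ^ (Suc j * ?d) = 2 ^ ?d * 2 ^ (s * ?d) * 2 ^ ((j - s) * ?d)"
      using j by (simp flip: power_add add: algebra_simps)
    finally show ?thesis by (simp add: B_def)
  qed
  have base: "b j \<le> B" if "j \<le> s" for j
  proof -
    have "ret (4 ^ j) \<le> 1" using ret_antimono[of 0 "4 ^ j"] by simp
    then have "b j \<le> 2 ^ (j * ?d) * 1" unfolding b_def by (intro mult_left_mono) auto
    also have "\<dots> \<le> 2 ^ (s * ?d)" using that by simp
    also have "\<dots> \<le> B"
    proof -
      have "(1::real) \<le> 2 * 2 ^ ?d" using one_le_power[of "2::real" "?d"] by linarith
      from mult_right_mono[OF this, of "2 ^ (s * ?d)"] show ?thesis unfolding B_def by simp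
    qed
    finally show ?thesis .
  qed
  have bB: "b j \<le> B" for j
  proof (induction j)
    case (Suc j)
    then show ?case using step[of j] base[of "Suc j"] by (cases "j \<ge> s") auto
  qed (simp add: base)
  show ?thesis
    by (rule that[OF B]) (use bB in \<open>simp add: b_def field_simps\<close>)
qed

text \<open>
  Averaging over a step and its opposite removes the cross term, so that the computation can
  be carried out in the extended nonnegative reals.
\<close>

lemma second_moment_W:
  "(\<integral>\<^sup>+y. ennreal ((real_of_int (y $ i))\<^sup>2) \<partial>measure_pmf (W n))
     = of_nat n * (\<integral>\<^sup>+w. ennreal ((real_of_int (w $ i))\<^sup>2) \<partial>measure_pmf p)"
proof (induction n)
  case (Suc n)
  let ?q = "\<lambda>y::int^'d. ennreal ((real_of_int (y $ i))\<^sup>2)"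
  have translate: "(\<integral>\<^sup>+w. ?q (w + y) \<partial>measure_pmf p) = (\<integral>\<^sup>+w. ?q w \<partial>measure_pmf p) + ?q y" for y
  proof -
    have refl: "(\<integral>\<^sup>+w. ?q (w + y) \<partial>measure_pmf p) = (\<integral>\<^sup>+w. ?q (y - w) \<partial>measure_pmf p)"
    proof -
      have "(\<integral>\<^sup>+w. ?q (w + y) \<partial>measure_pmf p) = (\<integral>\<^sup>+w. ?q (w + y) \<partial>measure_pmf (map_pmf uminus p))"
        by (simp add: map_uminus_p)
      then show ?thesis by simp
    qed
    have "2 * (\<integral>\<^sup>+w. ?q (w + y) \<partial>measure_pmf p)
        = (\<integral>\<^sup>+w. ?q (w + y) \<partial>measure_pmf p) + (\<integral>\<^sup>+w. ?q (y - w) \<partial>measure_pmf p)"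
      by (simp only: refl[symmetric] mult_2)
    also have "\<dots> = (\<integral>\<^sup>+w. ?q (w + y) + ?q (y - w) \<partial>measure_pmf p)"
      by (subst nn_integral_add) auto
    also have "\<dots> = (\<integral>\<^sup>+w. 2 * (?q w + ?q y) \<partial>measure_pmf p)"
    proof (intro nn_integral_cong)
      fix w
      have "?q (w + y) + ?q (y - w)
          = ennreal ((real_of_int ((w + y) $ i))\<^sup>2 + (real_of_int ((y - w) $ i))\<^sup>2)"
        by (simp add: ennreal_plus)
      also have "\<dots> = ennreal (2 * ((real_of_int (w $ i))\<^sup>2 + (real_of_int (y $ i))\<^sup>2))"
        by (simp add: power2_eq_square algebra_simps)
      also have "\<dots> = 2 * (?q w + ?q y)"
        by (simp add: ennreal_mult ennreal_plus)
      finally show "?q (w + y) + ?q (y - w) = 2 * (?q w + ?q y)" .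
    qed
    also have "\<dots> = 2 * ((\<integral>\<^sup>+w. ?q w \<partial>measure_pmf p) + ?q y)"
      by (simp add: nn_integral_cmult nn_integral_add)
    finally show ?thesis
      by (subst (asm) ennreal_mult_cancel_left) auto
  qed
  have "W (Suc n) = conv (W n) p" by (simp add: conv_commute)
  then have "(\<integral>\<^sup>+y. ?q y \<partial>measure_pmf (W (Suc n)))
      = (\<integral>\<^sup>+y. \<integral>\<^sup>+w. ?q (w + y) \<partial>measure_pmf p \<partial>measure_pmf (W n))"
    by (simp add: conv_def add.commute del: walk_pmf.simps)
  also have "\<dots> = (\<integral>\<^sup>+w. ?q w \<partial>measure_pmf p) + (\<integral>\<^sup>+y. ?q y \<partial>measure_pmf (W n))"
    by (simp only: translate) (subst nn_integral_add, auto)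
  finally show ?case by (simp only: Suc) (simp add: distrib_right)
qed simp

lemma W_mass_in_box:
  obtains t where "\<And>j. measure (W (4 ^ j)) (lattice_box (2 ^ (j + t))) \<ge> 1 / 2"
proof -
  let ?d = "CARD('d)"
  let ?q = "\<lambda>i (y::int^'d). ennreal ((real_of_int (y $ i))\<^sup>2)"
  define v where "v i = enn2real (\<integral>\<^sup>+w. ?q i w \<partial>measure_pmf p)" for i
  have v: "(\<integral>\<^sup>+w. ?q i w \<partial>measure_pmf p) = ennreal (v i)" for i
    using second_moment[of i] by (simp add: v_def)
  have v0: "v i \<ge> 0" for i by (simp add: v_def)
  obtain t where t: "2 * (\<Sum>i\<in>UNIV. v i) < 4 ^ t"
    using real_arch_pow[of 4 "2 * (\<Sum>i\<in>UNIV. v i)"] by auto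
  show ?thesis
  proof (rule that)
    fix j
    define L :: nat where "L = 2 ^ (j + t)"
    have L2: "(real L)\<^sup>2 = 4 ^ j * 4 ^ t"
      by (simp add: L_def power_add power_mult_distrib power_mult[symmetric] mult.commute[of _ 2] power_mult)
    have tail: "measure (W (4 ^ j)) {y. real_of_int \<bar>y $ i\<bar> > real L} \<le> v i / 4 ^ t" for i
    proof -
      have "ennreal ((real L)\<^sup>2) * emeasure (W (4 ^ j)) {y. real_of_int \<bar>y $ i\<bar> > real L}
          = (\<integral>\<^sup>+y. ennreal ((real L)\<^sup>2) * indicator {y. real_of_int \<bar>y $ i\<bar> > real L} y \<partial>measure_pmf (W (4 ^ j)))"
        by (simp add: nn_integral_cmult)
      also have "\<dots> \<le> (\<integral>\<^sup>+y. ?q i y \<partial>measure_pmf (W (4 ^ j)))"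
      proof (intro nn_integral_mono)
        fix y :: "int ^ 'd"
        have "(real L)\<^sup>2 \<le> (real_of_int (y $ i))\<^sup>2" if "real_of_int \<bar>y $ i\<bar> > real L"
          using that by (intro abs_le_square_iff[THEN iffD1]) simp
        then show "ennreal ((real L)\<^sup>2) * indicator {y. real_of_int \<bar>y $ i\<bar> > real L} y \<le> ?q i y"
          by (auto simp: indicator_def intro!: ennreal_leI simp del: of_int_abs)
      qed
      also have "\<dots> = ennreal (4 ^ j * v i)"
      proof -
        have "of_nat (4 ^ j) = ennreal (4 ^ j)"
          by (simp only: ennreal_of_nat_eq_real_of_nat) simp
        then show ?thesis unfolding second_moment_W v by (simp only: ennreal_mult v0 zero_le_power zero_le_numeral)
      qed
      finally have "ennreal ((real L)\<^sup>2 * measure (W (4 ^ j)) {y. real_of_int \<bar>y $ i\<bar> > real L}) \<le> ennreal (4 ^ j * v i)"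
        by (simp add: ennreal_mult measure_pmf.emeasure_eq_measure)
      then have "(real L)\<^sup>2 * measure (W (4 ^ j)) {y. real_of_int \<bar>y $ i\<bar> > real L} \<le> 4 ^ j * v i"
        using v0 by (subst (asm) ennreal_le_iff) auto
      then show ?thesis unfolding L2 by (simp add: field_simps)
    qed
    have "1 - measure (W (4 ^ j)) (lattice_box L) = measure (W (4 ^ j)) (UNIV - lattice_box L)"
      by (subst measure_pmf.prob_compl[symmetric]) auto
    also have "UNIV - lattice_box L = (\<Union>i\<in>UNIV. {y::int^'d. real_of_int \<bar>y $ i\<bar> > real L})"
    proof -
      have "real L < real_of_int z \<longleftrightarrow> \<not> z \<le> int L" for z by linarith
      then show ?thesis by (auto simp: lattice_box_def simp del: of_int_abs)
    qed
    also have "measure (W (4 ^ j)) \<dots> \<le> (\<Sum>i\<in>UNIV. measure (W (4 ^ j)) {y. real_of_int \<bar>y $ i\<bar> > real L})"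
      by (rule measure_pmf.finite_measure_subadditive_finite) auto
    also have "\<dots> \<le> (\<Sum>i\<in>UNIV. v i / 4 ^ t)" by (intro sum_mono tail)
    also have "\<dots> = (\<Sum>i\<in>UNIV. v i) / 4 ^ t" by (simp add: sum_divide_distrib)
    also have "\<dots> \<le> 1 / 2" using t by (simp add: field_simps)
    finally show "measure (W (4 ^ j)) (lattice_box (2 ^ (j + t))) \<ge> 1 / 2" by (simp add: L_def)
  qed
qed

text \<open>
  Half of the mass lies in a box of side of order \<open>2 ^ j\<close>, and by Cauchy-Schwarz a measure of mass
  one half on \<open>N\<close> points has squared norm at least \<open>1 / (4 N)\<close>.
\<close>

lemma ret_lower:
  obtains c where "c > 0" "\<And>j. ret (4 ^ j) \<ge> c / 2 ^ (j * CARD('d))"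
proof -
  let ?d = "CARD('d)"
  obtain t where t: "\<And>j. measure (W (4 ^ j)) (lattice_box (2 ^ (j + t))) \<ge> 1 / 2"
    by (rule W_mass_in_box) blast
  show ?thesis
  proof (rule that)
    show "1 / (4 * 4 ^ ?d * 2 ^ (t * ?d)) > (0::real)" by simp
    fix j
    define n :: nat where "n = 4 ^ j"
    define S :: "(int ^ 'd) set" where "S = lattice_box (2 ^ (j + t))"
    have fin: "finite S" by (simp add: S_def)
    have "(1 / 2)\<^sup>2 \<le> (measure (W n) S)\<^sup>2" using t[of j] unfolding n_def S_def by (intro power_mono) auto
    also have "measure (W n) S = sum (pmf (W n)) S" by (simp add: measure_measure_pmf_finite fin)
    also have "(sum (pmf (W n)) S)\<^sup>2 \<le> real (card S) * (\<Sum>y\<in>S. (pmf (W n) y)\<^sup>2)"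
      using sum_squared_le_sum_of_squares[of "pmf (W n)" S] fin by (simp add: mult.commute)
    also have "(\<Sum>y\<in>S. (pmf (W n) y)\<^sup>2) = (\<integral>y. pmf (W n) y * indicator S y \<partial>measure_pmf (W n))"
      by (subst integral_measure_pmf[of S]) (auto simp: fin power2_eq_square indicator_def)
    also have "\<dots> \<le> (\<integral>y. pmf (W n) (0 - y) \<partial>measure_pmf (W n))"
      by (intro integral_mono integrable_bounded_pmf[where B = 1]) (auto simp: indicator_def W_symm)
    also have "\<dots> = pmf (W (n + n)) 0" by (simp add: walk_pmf_add pmf_conv)
    finally have "1 / 4 \<le> real (card S) * ret n"
      by (simp add: ret_def mult_left_mono power2_eq_square mult_2)
    also have "real (card S) \<le> 4 ^ ?d * 2 ^ (t * ?d) * 2 ^ (j * ?d)"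
    proof -
      have "real (card S) = (2 * 2 ^ (j + t) + 1) ^ ?d" by (simp add: S_def card_box add.commute)
      also have "\<dots> \<le> (4 * 2 ^ (j + t)) ^ ?d"
        using one_le_power[of "2::real" "j + t", OF one_le_numeral] by (intro power_mono; linarith)
      also have "\<dots> = 4 ^ ?d * 2 ^ (t * ?d) * 2 ^ (j * ?d)"
        by (simp add: power_mult_distrib power_add power_mult)
      finally show ?thesis .
    qed
    finally have "1 / 4 \<le> 4 ^ ?d * 2 ^ (t * ?d) * 2 ^ (j * ?d) * ret n"
      using ret_nonneg by (simp add: mult_right_mono)
    then show "1 / (4 * 4 ^ ?d * 2 ^ (t * ?d)) / 2 ^ (j * ?d) \<le> ret (4 ^ j)"
      by (simp add: n_def field_simps)
  qed
qed

lemma sum_ret_bounded: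
  obtains C where "\<And>N. (\<Sum>n<N. ret n) \<le> C"
proof -
  let ?d = "CARD('d)"
  obtain B where B: "B > 0" "\<And>j. ret (4 ^ j) \<le> B / 2 ^ (j * ?d)"
    by (rule ret_upper) blast
  have block: "(\<Sum>n=4^j..<4^Suc j. ret n) \<le> 3 * B * (1 / 2) ^ j" for j
  proof -
    have "(\<Sum>n=4^j..<4^Suc j. ret n) \<le> (\<Sum>n=(4::nat)^j..<4^Suc j. B / 2 ^ (j * ?d))"
      by (intro sum_mono order.trans[OF ret_antimono B(2)]) auto
    also have "\<dots> = 3 * B * (4 ^ j / 2 ^ (j * ?d))" by simp
    also have "\<dots> \<le> 3 * B * (4 ^ j / 2 ^ (j * 3))"
      using B(1) dim by (intro mult_left_mono divide_left_mono power_increasing) auto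
    also have "(4::real) ^ j / 2 ^ (j * 3) = (1 / 2) ^ j"
      by (simp add: mult.commute[of j] power_mult flip: power_divide)
    finally show ?thesis .
  qed
  have "(\<Sum>n<4^J. ret n) \<le> 1 + (\<Sum>j<J. 3 * B * (1 / 2) ^ j)" for J
  proof (induction J)
    case (Suc J)
    have "(\<Sum>n<4^Suc J. ret n) = (\<Sum>n<4^J. ret n) + (\<Sum>n=4^J..<4^Suc J. ret n)"
      unfolding lessThan_atLeast0 by (subst sum.atLeastLessThan_concat) auto
    then show ?case using Suc block[of J] by simp
  qed simp
  also have "1 + (\<Sum>j<J. 3 * B * (1 / 2) ^ j) \<le> 1 + 6 * B" for J
  proof -
    have "(\<Sum>j<J. (1 / 2 :: real) ^ j) \<le> (\<Sum>j. (1/2) ^ j)"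
      by (rule sum_le_suminf) auto
    also have "\<dots> = 2" by (simp add: suminf_geometric)
    finally show ?thesis using B(1) by (simp flip: sum_distrib_left)
  qed
  finally have *: "(\<Sum>n<4^J. ret n) \<le> 1 + 6 * B" for J .
  show ?thesis
  proof (rule that)
    fix N
    have "N < 4 ^ N" by (rule less_exp[THEN less_le_trans]) (simp add: power_mono)
    then have "(\<Sum>n<N. ret n) \<le> (\<Sum>n<4^N. ret n)"
      by (intro sum_mono2) (auto simp: ret_nonneg)
    then show "(\<Sum>n<N. ret n) \<le> 1 + 6 * B" using *[of N] by simp
  qed
qed

lemma sum_W_bounded:
  obtains C where "\<And>N x. (\<Sum>n<N. pmf (W n) x) \<le> C"
proof -
  obtain C where C: "\<And>N. (\<Sum>n<N. ret n) \<le> C" by (rule sum_ret_bounded) blast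
  have *: "(\<Sum>n<2*N. ret (n div 2)) = 2 * (\<Sum>n<N. ret n)" for N
    by (induction N) auto
  show ?thesis
  proof (rule that)
    fix N x
    have "(\<Sum>n<N. pmf (W n) x) \<le> (\<Sum>n<2*N. pmf (W n) x)"
      by (intro sum_mono2) auto
    also have "\<dots> \<le> (\<Sum>n<2*N. ret (n div 2))" by (intro sum_mono W_le_ret)
    also have "\<dots> \<le> 2 * C" using C[of N] by (simp add: *)
    finally show "(\<Sum>n<N. pmf (W n) x) \<le> 2 * C" .
  qed
qed

end

sublocale lattice_step \<subseteq> transient_step
proof unfold_locales
  obtain C where "\<And>N x. (\<Sum>n<N. pmf (W n) x) \<le> C" by (rule sum_W_bounded) blast
  then show "\<exists>C. \<forall>N x. (\<Sum>n<N. pmf (W n) x) \<le> C" by blast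
qed

lemma dyadic_above: "l \<ge> 1 \<Longrightarrow> \<exists>v. l \<le> 2 ^ v \<and> 2 ^ v < 2 * (l::nat)"
proof (cases "l = 1")
  case False
  assume "l \<ge> 1"
  then obtain n where "2 ^ n < l" "l \<le> 2 ^ (n + 1)" using ex_power_ivl2[of 2 l] False by auto
  then show ?thesis by (intro exI[of _ "n + 1"]) auto
qed (auto intro: exI[of _ 0])

context lattice_step begin

text \<open>
  For times of the order of a large multiple of \<open>|y|\<^sup>2\<close> the gap at \<open>2 y\<close> is at most half of the
  return probability. The times between \<open>2 \<cdot> 4 ^ j\<close> and \<open>4 \<cdot> 4 ^ j\<close>, where \<open>4 ^ j\<close> is of the order of \<open>|y|\<^sup>2\<close>, already give the
  claimed order.
\<close>

lemma green_double_lower: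
  obtains c where "c > 0" "\<And>y. y \<noteq> 0 \<Longrightarrow> green (y + y) \<ge> c / real (l1 y) ^ (CARD('d) - 2)"
proof -
  let ?d = "CARD('d)"
  obtain K where K: "K \<ge> 1"
    "\<And>n y. gap n (y + y) \<le> K * (real (l1 y))\<^sup>2 * (ret n - ret (Suc n))"
    by (rule gap_le_l1) blast
  obtain B where B: "B > 0" "\<And>j. ret (4 ^ j) \<le> B / 2 ^ (j * ?d)"
    by (rule ret_upper) blast
  obtain c where c: "c > 0" "\<And>j. ret (4 ^ j) \<ge> c / 2 ^ (j * ?d)"
    by (rule ret_lower) blast
  define c' where "c' = c / (2 * 2 ^ ?d)"
  have c': "c' > 0" using c by (simp add: c'_def)
  obtain u where u: "K * B / c' < 4 ^ u"
    using real_arch_pow[of 4 "K * B / c'"] by auto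
  \<comment> \<open>the length scale \<open>2 ^ j\<close> chosen below is at most \<open>2 ^ (u + 1)\<close> times the norm of \<open>y\<close>\<close>
  define c2 where "c2 = c' / (2 ^ Suc u) ^ (?d - 2)"
  show ?thesis
  proof (rule that)
    show "c2 > 0" using c' by (simp add: c2_def)
    fix y :: "int ^ 'd" assume "y \<noteq> 0"
    define l where "l = l1 y"
    have l: "l \<ge> 1" using l1_pos[OF \<open>y \<noteq> 0\<close>] by (simp add: l_def)
    obtain v where v: "l \<le> 2 ^ v" "2 ^ v < 2 * l" using dyadic_above[OF l] by blast
    define j where "j = u + v"
    have l2: "K * B * (real l)\<^sup>2 \<le> c' * 4 ^ j"
    proof -
      have "real l \<le> real (2 ^ v)" using v(1) by (rule of_nat_mono)
      then have "(real l)\<^sup>2 \<le> (2 ^ v)\<^sup>2" by (intro power_mono) auto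
      also have "\<dots> = 4 ^ v" by (simp add: power_mult[symmetric] mult.commute[of _ 2] power_mult)
      finally have "(real l)\<^sup>2 \<le> 4 ^ v" .
      moreover have "K * B \<le> c' * 4 ^ u" using u c' by (simp add: field_simps)
      ultimately have "K * B * (real l)\<^sup>2 \<le> (c' * 4 ^ u) * 4 ^ v"
        using c' by (intro mult_mono[of "K * B"]) auto
      then show ?thesis by (simp add: j_def power_add mult_ac)
    qed
    have W_ge: "pmf (W (2 * n)) (y + y) \<ge> c' / 2 ^ (j * ?d)" if n: "2 * 4 ^ j \<le> n" "n < 4 * 4 ^ j" for n
    proof -
      have "real (4 ^ j) * (ret n - ret (Suc n)) \<le> ret (4 ^ j)"
        by (rule ret_diff_le) (use n in simp)
      also have "\<dots> \<le> B / 2 ^ (j * ?d)" by (rule B)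
      finally have diff: "ret n - ret (Suc n) \<le> B / 2 ^ (j * ?d) / 4 ^ j"
        by (simp add: field_simps)
      have "gap n (y + y) \<le> K * (real l)\<^sup>2 * (ret n - ret (Suc n))" unfolding l_def by (rule K)
      also have "\<dots> \<le> K * (real l)\<^sup>2 * (B / 2 ^ (j * ?d) / 4 ^ j)"
        using K(1) by (intro mult_left_mono diff) auto
      also have "\<dots> = (K * B * (real l)\<^sup>2) / 4 ^ j / 2 ^ (j * ?d)"
        by (simp add: mult_ac)
      also have "\<dots> \<le> (c' * 4 ^ j) / 4 ^ j / 2 ^ (j * ?d)"
        by (intro divide_right_mono l2) auto
      finally have g: "gap n (y + y) \<le> c' / 2 ^ (j * ?d)" by simp
      have "2 * c' / 2 ^ (j * ?d) = c / 2 ^ (Suc j * ?d)"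
        by (simp add: c'_def power_add)
      also have "\<dots> \<le> ret (4 ^ Suc j)" by (rule c)
      also have "\<dots> \<le> ret n" by (rule ret_antimono) (use n in simp)
      finally show ?thesis using g by (simp add: gap_def)
    qed
    have "c' * 4 ^ j / 2 ^ (j * ?d) \<le> (\<Sum>n=2*4^j..<4*(4::nat)^j. c' / 2 ^ (j * ?d))"
      using c' by (simp add: field_simps)
    also have "\<dots> \<le> (\<Sum>n=2*4^j..<4*4^j. pmf (W (2 * n)) (y + y))"
      by (intro sum_mono W_ge) auto
    also have "\<dots> = (\<Sum>n\<in>(\<lambda>n. 2 * n) ` {2*4^j..<4*4^j}. pmf (W n) (y + y))"
      by (subst sum.reindex) (auto simp: inj_on_def)
    also have "\<dots> \<le> green (y + y)"
      unfolding green_def by (intro sum_le_suminf summable_W) auto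
    finally have G: "c' * 4 ^ j / 2 ^ (j * ?d) \<le> green (y + y)" .
    have "c2 / real l ^ (?d - 2) = c' / (2 ^ u * (2 * real l)) ^ (?d - 2)"
      by (simp add: c2_def power_mult_distrib)
    also have "\<dots> \<le> c' / (2 ^ j) ^ (?d - 2)"
    proof (intro divide_left_mono power_mono)
      have "real (2 ^ v) \<le> real (2 * l)" using v(2) by (intro of_nat_mono) simp
      then show "2 ^ j \<le> 2 ^ u * (2 * real l)" by (simp add: j_def power_add)
    qed (use c' l in auto)
    also have "\<dots> = c' * 4 ^ j / 2 ^ (j * ?d)"
    proof -
      have "?d = (?d - 2) + 2" using dim by simp
      then have "(2::real) ^ (j * ?d) = (2 ^ j) ^ (?d - 2) * (2 ^ j) ^ 2"
        by (metis power_add power_mult)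
      also have "((2::real) ^ j) ^ 2 = 4 ^ j"
        by (simp add: power_mult[symmetric] mult.commute[of _ 2] power_mult)
      finally show ?thesis by simp
    qed
    finally show "green (y + y) \<ge> c2 / real (l1 y) ^ (?d - 2)" using G by (simp add: l_def)
  qed
qed

lemma green_translate_ge:
  "green (x + b) \<ge> pmf (W m) b * green x"
proof -
  have "pmf (W m) b * green x = (\<Sum>n. pmf (W m) b * pmf (W n) x)"
    unfolding green_def by (rule suminf_mult[symmetric]) (rule summable_W)
  also have "\<dots> \<le> (\<Sum>n. pmf (W (n + m)) (x + b))"
  proof (intro suminf_le summable_mult summable_W)
    show "summable (\<lambda>n. pmf (W (n + m)) (x + b))"
      using summable_W[of "x + b"] by (subst summable_iff_shift)
    show "pmf (W m) b * pmf (W n) x \<le> pmf (W (n + m)) (x + b)" for n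
      using pmf_walk_pmf_add_ge[of p n x m b] by (simp add: mult.commute)
  qed
  also have "\<dots> \<le> green (x + b)"
    unfolding green_def
    by (subst suminf_split_initial_segment[OF summable_W, of _ m]) (auto intro!: sum_nonneg)
  finally show ?thesis .
qed

text \<open>
  Every point is twice a point plus one of finitely many corrections, each of which the walk can
  make in some number of steps.
\<close>

theorem green_lower:
  obtains c where "c > 0" "\<And>x. x \<noteq> 0 \<Longrightarrow> green x \<ge> c / real (l1 x) ^ (CARD('d) - 2)"
proof -
  let ?d = "CARD('d)"
  obtain c where c: "c > 0" "\<And>y. y \<noteq> 0 \<Longrightarrow> green (y + y) \<ge> c / real (l1 y) ^ (?d - 2)"
    by (rule green_double_lower) blast
  have "\<exists>m. pmf (W m) b > 0" for b using reach by blast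
  then obtain m where m: "\<And>b. pmf (W (m b)) b > 0" by metis
  define q where "q = Min ((\<lambda>b. pmf (W (m b)) b) ` (lattice_box 1 :: (int ^ 'd) set))"
  have ne: "(lattice_box 1 :: (int ^ 'd) set) \<noteq> {}" by (auto simp: lattice_box_def intro!: exI[of _ 0])
  have q: "q > 0" unfolding q_def using m ne by (subst Min_gr_iff) auto
  have qle: "q \<le> pmf (W (m b)) b" if "b \<in> lattice_box 1" for b
    unfolding q_def using that by (intro Min_le) auto
  show ?thesis
  proof (rule that)
    show "min (q * c) q > 0" using q c by simp
    fix x :: "int ^ 'd" assume x: "x \<noteq> 0"
    define y :: "int ^ 'd" where "y = (\<chi> i. x $ i div 2)"
    define b :: "int ^ 'd" where "b = (\<chi> i. x $ i mod 2)"
    have xyb: "x = (y + y) + b" by (auto simp: vec_eq_iff y_def b_def)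
    have b: "b \<in> lattice_box 1" by (auto simp: lattice_box_def b_def)
    have "q * green (y + y) \<le> pmf (W (m b)) b * green (y + y)"
      by (intro mult_right_mono qle b) (rule green_nonneg)
    also have "\<dots> \<le> green x" unfolding xyb by (rule green_translate_ge)
    finally have ge: "q * green (y + y) \<le> green x" .
    have l1x: "real (l1 x) ^ (?d - 2) \<ge> 1" using l1_pos[OF x] by (intro one_le_power) simp
    show "green x \<ge> min (q * c) q / real (l1 x) ^ (?d - 2)"
    proof (cases "y = 0")
      case True
      have "min (q * c) q / real (l1 x) ^ (?d - 2) \<le> q / 1"
        using q l1x by (intro frac_le) auto
      also have "\<dots> \<le> q * green (y + y)" using q green_0_gt_1 True by simp
      finally show ?thesis using ge by simp
    next
      case False
      have "l1 y \<le> l1 x"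
        unfolding l1_def y_def by (intro sum_mono) auto
      then have "min (q * c) q / real (l1 x) ^ (?d - 2) \<le> (q * c) / real (l1 y) ^ (?d - 2)"
        using q c l1_pos[OF False] by (intro frac_le power_mono) auto
      also have "\<dots> \<le> q * green (y + y)" using c(2)[OF False] q mult_left_mono[OF c(2)[OF False], of q] by simp
      finally show ?thesis using ge by simp
    qed
  qed
qed

end

section \<open>Hitting probabilities\<close>

primrec visits :: "'g::ab_group_add \<Rightarrow> 'g \<Rightarrow> 'g list \<Rightarrow> nat" where
  "visits a y [] = 0"
| "visits a y (w # ws) = of_bool (y + w = a) + visits a (y + w) ws"

lemma visits_le_length: "visits a y ws \<le> length ws"
proof (induction ws arbitrary: y)
  case (Cons w ws)
  then show ?case using Cons[of "y + w"] by (simp add: le_SucI)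
qed simp

lemma measure_bind_pmf:
  "measure (bind_pmf \<mu> f) A = (\<integral>x. measure (f x) A \<partial>measure_pmf \<mu>)"
proof -
  have i: "integrable (measure_pmf \<mu>) (\<lambda>x. measure (f x) A)"
    by (rule integrable_bounded_pmf[where B = 1]) auto
  have "ennreal (measure (bind_pmf \<mu> f) A) = (\<integral>\<^sup>+x. ennreal (measure (f x) A) \<partial>measure_pmf \<mu>)"
    by (simp flip: measure_pmf.emeasure_eq_measure)
  also have "\<dots> = ennreal (\<integral>x. measure (f x) A \<partial>measure_pmf \<mu>)"
    by (rule nn_integral_eq_integral[OF i]) auto
  finally show ?thesis by (simp add: integral_nonneg)
qed

lemma measure_replicate_pmf_Suc:
  "measure (replicate_pmf (Suc n) p) A
     = (\<integral>w. measure (replicate_pmf n p) {ws. w # ws \<in> A} \<partial>measure_pmf p)"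
proof -
  have "bind_pmf (replicate_pmf n p) (\<lambda>ws. return_pmf (w # ws)) = map_pmf (Cons w) (replicate_pmf n p)" for w
    by (simp add: map_pmf_def)
  then have "measure (replicate_pmf (Suc n) p) A
      = (\<integral>w. measure (map_pmf (Cons w) (replicate_pmf n p)) A \<partial>measure_pmf p)"
    by (simp add: measure_bind_pmf)
  then show ?thesis by (simp add: vimage_def)
qed

context transient_step begin

lemma integrable_green: "integrable (measure_pmf p) (\<lambda>w. green (y + w))"
proof -
  obtain C where "\<And>x. green x \<le> C" by (rule green_bounded) blast
  then show ?thesis by (intro integrable_bounded_pmf[where B = C]) (simp add: green_nonneg)
qed

definition avg :: "('g \<Rightarrow> real) \<Rightarrow> 'g \<Rightarrow> real" where
  "avg u y = (\<integral>w. u (y + w) \<partial>measure_pmf p)"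

lemma avg_green: "avg green y = green y - of_bool (y = 0)"
proof -
  have "avg green y = (\<integral>w. (\<Sum>n. pmf (W n) (y + w)) \<partial>measure_pmf p)"
    by (simp add: avg_def green_def)
  also have "\<dots> = (\<Sum>n. \<integral>w. pmf (W n) (y + w) \<partial>measure_pmf p)"
  proof (rule integral_suminf)
    show "integrable (measure_pmf p) (\<lambda>w. pmf (W n) (y + w))" for n
      by (rule integrable_bounded_pmf[where B = 1]) auto
    show "AE w in measure_pmf p. summable (\<lambda>n. norm (pmf (W n) (y + w)))"
      using summable_W by simp
    have "summable (\<lambda>n. pmf (W (Suc n)) y)"
      by (subst summable_Suc_iff) (rule summable_W)
    then show "summable (\<lambda>n. \<integral>w. norm (pmf (W n) (y + w)) \<partial>measure_pmf p)"
      by (simp add: W_Suc del: walk_pmf.simps)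
  qed
  also have "\<dots> = (\<Sum>n. pmf (W (Suc n)) y)" by (simp add: W_Suc del: walk_pmf.simps)
  also have "\<dots> = green y - pmf (W 0) y"
    unfolding green_def by (rule suminf_split_head) (rule summable_W)
  finally show ?thesis by (simp add: pmf_return)
qed

lemma avg_nonneg: "(\<And>v. u v \<ge> 0) \<Longrightarrow> avg u y \<ge> 0"
  by (simp add: avg_def)

definition hit :: "nat \<Rightarrow> 'g \<Rightarrow> real" where
  "hit N y = measure (replicate_pmf N p) {ws. visits 0 y ws \<ge> 1}"

lemma hit_Suc: "hit (Suc N) y = (\<integral>w. (if y + w = 0 then 1 else hit N (y + w)) \<partial>measure_pmf p)"
  unfolding hit_def measure_replicate_pmf_Suc
  by (intro Bochner_Integration.integral_cong) auto

lemma hit_nonneg: "hit N y \<ge> 0" and hit_le_1: "hit N y \<le> 1"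
  by (auto simp: hit_def)

lemma hit_le_superharmonic:
  assumes u: "\<And>v. 0 \<le> u v" "\<And>v. u v \<le> C" "\<And>v. avg u v \<le> u v" "u 0 \<ge> 1"
  shows "hit N y \<le> avg u y"
proof (induction N arbitrary: y)
  case 0
  then show ?case using avg_nonneg[OF u(1)] by (simp add: hit_def)
next
  case (Suc N)
  show ?case unfolding hit_Suc avg_def
  proof (intro integral_mono)
    show "integrable (measure_pmf p) (\<lambda>w. if y + w = 0 then 1 else hit N (y + w))"
      by (rule integrable_bounded_pmf[where B = 1]) (auto simp: hit_nonneg hit_le_1)
    show "integrable (measure_pmf p) (\<lambda>w. u (y + w))"
      by (rule integrable_bounded_pmf[where B = C]) (use u in auto)
    show "(if y + w = 0 then 1 else hit N (y + w)) \<le> u (y + w)" for w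
      using u(4) order.trans[OF Suc u(3), of "y + w"] by auto
  qed
qed

text \<open>
  The function \<open>avg green / green 0\<close> obeys the same one-step recursion as the hitting probability,
  and the error after \<open>N\<close> steps is at most the tail of the Green series.
\<close>

lemma hit_limit: "(\<lambda>N. hit N y) \<longlonglongrightarrow> (green y - of_bool (y = 0)) / green 0"
proof -
  \<comment> \<open>averaging the tail of the Green series from \<open>N\<close> on gives the tail from \<open>N + 1\<close> on\<close>
  define tail where "tail N v = green v - (\<Sum>n<N. pmf (W n) v)" for N v
  obtain C where C: "\<And>x. green x \<le> C" by (rule green_bounded) blast
  have tail_nonneg: "tail N v \<ge> 0" for N v
    unfolding tail_def green_def using sum_le_suminf[OF summable_W[of v], of "{..<N}"] by simp
  have tail_le: "tail N v \<le> C" for N v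
    unfolding tail_def using C[of v] sum_nonneg[of "{..<N}" "\<lambda>n. pmf (W n) v"] by simp
  have itail: "integrable (measure_pmf p) (\<lambda>w. tail N (v + w))" for N v
    by (rule integrable_bounded_pmf[where B = C]) (use tail_nonneg tail_le in simp)
  have avg_tail: "(\<integral>w. tail N (v + w) \<partial>measure_pmf p) = tail (Suc N) v" for N v
  proof -
    have "(\<integral>w. tail N (v + w) \<partial>measure_pmf p) = avg green v - (\<Sum>n<N. \<integral>w. pmf (W n) (v + w) \<partial>measure_pmf p)"
    proof -
      have iW: "integrable (measure_pmf p) (\<lambda>w. pmf (W n) (v + w))" for n
        by (rule integrable_bounded_pmf[where B = 1]) auto
      have iS: "integrable (measure_pmf p) (\<lambda>w. \<Sum>n<N. pmf (W n) (v + w))"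
        by (intro Bochner_Integration.integrable_sum iW)
      show ?thesis
        unfolding tail_def avg_def
        by (simp only: Bochner_Integration.integral_diff[OF integrable_green iS]
             Bochner_Integration.integral_sum[OF iW])
    qed
    also have "\<dots> = green v - pmf (W 0) v - (\<Sum>n<N. pmf (W (Suc n)) v)"
      by (simp add: avg_green W_Suc pmf_return del: walk_pmf.simps(2))
    also have "\<dots> = tail (Suc N) v" by (simp add: tail_def sum.lessThan_Suc_shift del: sum.lessThan_Suc walk_pmf.simps)
    finally show ?thesis .
  qed
  have lower: "hit N v \<le> avg green v / green 0" for N v
  proof -
    have *: "avg (\<lambda>v. green v / green 0) v = avg green v / green 0" for v by (simp add: avg_def)
    have "hit N v \<le> avg (\<lambda>v. green v / green 0) v"
    proof (rule hit_le_superharmonic)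
      show "green v / green 0 \<le> C / green 0" for v
        using C green_nonneg by (intro divide_right_mono) auto
      show "avg (\<lambda>v. green v / green 0) v \<le> green v / green 0" for v
        unfolding * by (intro divide_right_mono) (auto simp: avg_green green_nonneg)
    qed (use green_nonneg green_pos[of 0] in auto)
    then show ?thesis by (simp add: *)
  qed
  have upper: "avg green v / green 0 - hit N v \<le> tail (Suc N) v / green 0" for N v
  proof (induction N arbitrary: v)
    case 0
    show ?case by (simp add: hit_def tail_def avg_green pmf_return)
  next
    case (Suc N)
    have ih: "integrable (measure_pmf p) (\<lambda>w. if v + w = 0 then 1 else hit N (v + w))"
      by (rule integrable_bounded_pmf[where B = 1]) (auto simp: hit_nonneg hit_le_1)
    have "avg green v / green 0 - hit (Suc N) v =
        (\<integral>w. green (v + w) / green 0 - (if v + w = 0 then 1 else hit N (v + w)) \<partial>measure_pmf p)"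
      unfolding hit_Suc avg_def
      by (subst Bochner_Integration.integral_diff) (use ih integrable_green in auto)
    also have "\<dots> \<le> (\<integral>w. tail (Suc N) (v + w) / green 0 \<partial>measure_pmf p)"
    proof (intro integral_mono Bochner_Integration.integrable_diff ih)
      show "integrable (measure_pmf p) (\<lambda>w. green (v + w) / green 0)"
        using integrable_green by simp
      show "integrable (measure_pmf p) (\<lambda>w. tail (Suc N) (v + w) / green 0)"
        using itail by simp
      fix w
      show "green (v + w) / green 0 - (if v + w = 0 then 1 else hit N (v + w)) \<le> tail (Suc N) (v + w) / green 0"
        using Suc[of "v + w"] tail_nonneg[of "Suc N" "v + w"] green_pos[of 0]
        by (auto simp: avg_green)
    qed
    also have "\<dots> = tail (Suc (Suc N)) v / green 0" by (simp add: avg_tail)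
    finally show ?case .
  qed
  have "(\<lambda>N. tail (Suc N) y / green 0) \<longlonglongrightarrow> (green y - green y) / green 0"
    unfolding tail_def green_def
    by (intro tendsto_intros LIMSEQ_Suc summable_LIMSEQ summable_W)
       (use green_pos[of 0] in \<open>simp add: green_def\<close>)
  then have tail_0: "(\<lambda>N. tail (Suc N) y / green 0) \<longlonglongrightarrow> 0" by simp
  have "(\<lambda>N. avg green y / green 0 - hit N y) \<longlonglongrightarrow> 0"
  proof (rule tendsto_sandwich[OF _ _ tendsto_const tail_0])
    show "\<forall>\<^sub>F N in sequentially. 0 \<le> avg green y / green 0 - hit N y"
      by (intro always_eventually allI) (use lower in simp)
    show "\<forall>\<^sub>F N in sequentially. avg green y / green 0 - hit N y \<le> tail (Suc N) y / green 0"
      by (intro always_eventually allI upper)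
  qed
  then have "(\<lambda>N. avg green y / green 0 - (avg green y / green 0 - hit N y)) \<longlonglongrightarrow> avg green y / green 0 - 0"
    by (intro tendsto_intros)
  then show ?thesis by (simp add: avg_green)
qed

lemma hit_translate_le: "hit N (y - x) \<le> avg green y / green x"
proof -
  obtain C where C: "\<And>x. green x \<le> C" by (rule green_bounded) blast
  have *: "avg (\<lambda>v. green (v + x) / green x) v = avg green (v + x) / green x" for v
    by (simp add: avg_def add.assoc add.commute[of _ x] add.left_commute[of _ x])
  have "hit N (y - x) \<le> avg (\<lambda>v. green (v + x) / green x) (y - x)"
  proof (rule hit_le_superharmonic)
    show "green (v + x) / green x \<le> C / green x" for v
      using C green_nonneg by (intro divide_right_mono) auto
    show "avg (\<lambda>v. green (v + x) / green x) v \<le> green (v + x) / green x" for v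
      unfolding * by (intro divide_right_mono) (auto simp: avg_green green_nonneg)
  qed (use green_nonneg green_pos[of x] in auto)
  then show ?thesis by (simp add: *)
qed

text \<open>
  A walk from \<open>y\<close> to \<open>0\<close> may be forced to pass through \<open>x\<close>: the function \<open>green (\<cdot> + x) / green x\<close> is
  superharmonic and equals one at the origin, so it dominates the probability of hitting it.
\<close>

lemma green_mult_le:
  assumes "y \<noteq> x"
  shows "green (y - x) * green x \<le> green 0 * avg green y"
proof -
  have "(green (y - x) - of_bool (y - x = 0)) / green 0 \<le> avg green y / green x"
    using hit_limit[of "y - x"] by (rule LIMSEQ_le_const2) (use hit_translate_le in blast)
  then show ?thesis using assms green_pos[of x] green_pos[of 0] by (simp add: field_simps)
qed

lemma green_mult_le': "green (y - x) * green x \<le> green 0 * green y"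
proof (cases "y = x")
  case False
  have "green 0 * avg green y \<le> green 0 * green y"
    by (intro mult_left_mono) (auto simp: avg_green green_nonneg)
  then show ?thesis using green_mult_le[OF False] by simp
qed simp

lemma green_le_green_0: "green x \<le> green 0"
proof (cases "x = 0")
  case False
  have "(green x - of_bool (x = 0)) / green 0 \<le> 1"
    using hit_limit[of x] by (rule LIMSEQ_le_const2) (use hit_le_1 in blast)
  then show ?thesis using False green_pos[of 0] by (simp add: field_simps)
qed simp

text \<open>
  The probability of going from \<open>0\<close> to \<open>x\<close> and back is at most that of returning to \<open>0\<close>. This is
  what gives \<open>m\<^sub>x \<le> 1\<close>.
\<close>

lemma green_sq_le:
  assumes "x \<noteq> 0"
  shows "(green x)\<^sup>2 \<le> green 0 * (green 0 - 1)"
  using green_mult_le[of 0 x] assms by (simp add: avg_green power2_eq_square)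

section \<open>Two-point occupation estimates from supersolutions\<close>

text \<open>
  The bound \<open>K * avg g y * (\<rho> ^ k * \<sigma> ^ l)\<close> is reproduced by one step of the walk: if the step lands at
  \<open>0\<close>, the number of visits still needed drops by one, and the factor \<open>\<rho>\<close> that the bound then gains is lost again
  because \<open>avg g 0 \<le> \<rho> * g 0\<close>; likewise for \<open>\<sigma>\<close> at \<open>x\<close>. The constant \<open>K\<close> makes the bound at least
  one at the moment the last required visit takes place.
\<close>

lemma many_visits_le:
  assumes x: "x \<noteq> 0"
    and g: "\<And>v. 0 \<le> g v" "\<And>v. g v \<le> C"
    and \<rho>: "0 < \<rho>" "\<rho> \<le> 1" and \<sigma>: "0 < \<sigma>" "\<sigma> \<le> 1"
    and g0: "avg g 0 \<le> \<rho> * g 0" and gx: "avg g x \<le> \<sigma> * g x"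
    and ge: "\<And>v. v \<noteq> 0 \<Longrightarrow> v \<noteq> x \<Longrightarrow> avg g v \<le> g v"
    and K: "K \<ge> 0" "1 \<le> K * (\<rho> * g 0)" "1 \<le> K * (\<sigma> * g x)"
    and kl: "(k, l) \<noteq> (0, 0)"
  shows "measure (replicate_pmf N p) {ws. visits 0 y ws \<ge> k \<and> visits x y ws \<ge> l}
           \<le> K * avg g y * (\<rho> ^ k * \<sigma> ^ l)"
  using kl
proof (induction N arbitrary: y k l)
  case 0
  then have "{ws. visits 0 y ws \<ge> k \<and> visits x y ws \<ge> l} \<inter> {[]} = {}" by auto
  then have "measure (replicate_pmf 0 p) {ws. visits 0 y ws \<ge> k \<and> visits x y ws \<ge> l} = 0"
    by (auto simp: measure_return)
  then show ?case using avg_nonneg[OF g(1)] K \<rho> \<sigma> by simp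
next
  case (Suc N)
  let ?A = "\<lambda>k l v. {ws. visits 0 v ws \<ge> k \<and> visits x v ws \<ge> l}"
  let ?P = "\<lambda>A. measure (replicate_pmf N p) A"
  have dec: "s * s ^ (j - 1) \<le> s ^ j" if "0 < s" "s \<le> 1" for s :: real and j :: nat
    using that by (cases j) auto
  have step: "?P {ws. w # ws \<in> ?A k l y} \<le> K * (g (y + w) * (\<rho> ^ k * \<sigma> ^ l))" for w
  proof -
    define v where "v = y + w"
    define k' where "k' = k - of_bool (v = 0)"
    define l' where "l' = l - of_bool (v = x)"
    have eq: "{ws. w # ws \<in> ?A k l y} = ?A k' l' v"
      by (auto simp: v_def k'_def l'_def)
    have factor: "avg g v * (\<rho> ^ k' * \<sigma> ^ l') \<le> g v * (\<rho> ^ k * \<sigma> ^ l)"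
    proof -
      consider "v = 0" | "v = x" | "v \<noteq> 0" "v \<noteq> x" by blast
      then show ?thesis
      proof cases
        case 1
        have "avg g v * (\<rho> ^ k' * \<sigma> ^ l') \<le> (\<rho> * g v) * (\<rho> ^ (k - 1) * \<sigma> ^ l)"
          using 1 x g0 \<rho> \<sigma> by (auto simp: k'_def l'_def intro!: mult_right_mono)
        also have "\<dots> = g v * ((\<rho> * \<rho> ^ (k - 1)) * \<sigma> ^ l)" by (simp add: mult_ac)
        also have "\<dots> \<le> g v * (\<rho> ^ k * \<sigma> ^ l)"
          using g(1) \<rho> \<sigma> by (intro mult_left_mono mult_right_mono dec) auto
        finally show ?thesis .
      next
        case 2
        have "avg g v * (\<rho> ^ k' * \<sigma> ^ l') \<le> (\<sigma> * g v) * (\<rho> ^ k * \<sigma> ^ (l - 1))"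
          using 2 x gx \<rho> \<sigma> by (auto simp: k'_def l'_def intro!: mult_right_mono)
        also have "\<dots> = g v * (\<rho> ^ k * (\<sigma> * \<sigma> ^ (l - 1)))" by (simp add: mult_ac)
        also have "\<dots> \<le> g v * (\<rho> ^ k * \<sigma> ^ l)"
          using g(1) \<rho> \<sigma> by (intro mult_left_mono dec) auto
        finally show ?thesis .
      next
        case 3
        then show ?thesis
          using ge[of v] \<rho> \<sigma> by (auto simp: k'_def l'_def intro!: mult_right_mono)
      qed
    qed
    have "?P (?A k' l' v) \<le> K * (g v * (\<rho> ^ k * \<sigma> ^ l))"
    proof (cases "(k', l') = (0, 0)")
      case True
      then consider "v = 0" "k = 1" "l = 0" | "v = x" "k = 0" "l = 1"
        using Suc.prems x by (auto simp: k'_def l'_def of_bool_def split: if_splits)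
      then have "1 \<le> K * (g v * (\<rho> ^ k * \<sigma> ^ l))"
        by cases (use K in \<open>simp_all add: mult_ac\<close>)
      then show ?thesis using measure_pmf.prob_le_1 by (rule order_trans[rotated])
    next
      case False
      have "?P (?A k' l' v) \<le> K * (avg g v * (\<rho> ^ k' * \<sigma> ^ l'))"
        using Suc.IH[OF False, of v] by (simp add: mult.assoc)
      also have "\<dots> \<le> K * (g v * (\<rho> ^ k * \<sigma> ^ l))" by (intro mult_left_mono factor K)
      finally show ?thesis .
    qed
    then show ?thesis unfolding eq by (simp add: v_def)
  qed
  have "measure (replicate_pmf (Suc N) p) (?A k l y) \<le> (\<integral>w. K * (g (y + w) * (\<rho> ^ k * \<sigma> ^ l)) \<partial>measure_pmf p)"
    unfolding measure_replicate_pmf_Suc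
  proof (intro integral_mono step)
    show "integrable (measure_pmf p) (\<lambda>w. ?P {ws. w # ws \<in> ?A k l y})"
      by (rule integrable_bounded_pmf[where B = 1]) auto
    have "integrable (measure_pmf p) (\<lambda>w. g (y + w))"
      by (rule integrable_bounded_pmf[where B = C]) (use g in auto)
    then show "integrable (measure_pmf p) (\<lambda>w. K * (g (y + w) * (\<rho> ^ k * \<sigma> ^ l)))" by simp
  qed
  then show ?case by (simp add: avg_def mult.assoc)
qed

text \<open>
  Here the required number of visits to \<open>0\<close> is to be completed before more than \<open>l\<close> visits to \<open>x\<close> have
  occurred. The last required visit takes place at \<open>0\<close>, so \<open>K\<close> is normalised there only; and \<open>\<sigma> \<ge> 1\<close> now, because each
  visit to \<open>x\<close> uses up part of the allowance.
\<close>

lemma few_visits_le: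
  assumes x: "x \<noteq> 0"
    and g: "\<And>v. 0 \<le> g v" "\<And>v. g v \<le> C"
    and \<rho>: "0 < \<rho>" and \<sigma>: "\<sigma> \<ge> 1"
    and g0: "avg g 0 \<le> \<rho> * g 0" and gx: "avg g x \<le> \<sigma> * g x"
    and ge: "\<And>v. v \<noteq> 0 \<Longrightarrow> v \<noteq> x \<Longrightarrow> avg g v \<le> g v"
    and K: "K \<ge> 0" "1 \<le> K * (\<rho> * g 0)"
    and k: "k \<ge> 1"
  shows "measure (replicate_pmf N p) {ws. \<exists>n. visits 0 y (take n ws) \<ge> k \<and> visits x y (take n ws) \<le> l}
           \<le> K * avg g y * (\<rho> ^ k * \<sigma> ^ l)"
  using k
proof (induction N arbitrary: y k l)
  case 0
  let ?A = "{ws. \<exists>n. visits 0 y (take n ws) \<ge> k \<and> visits x y (take n ws) \<le> l}"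
  have "[] \<notin> ?A" using 0 by auto
  then have "measure (replicate_pmf 0 p) ?A = 0"
    by (auto simp: measure_return)
  then show ?case using avg_nonneg[OF g(1)] K \<rho> \<sigma> by simp
next
  case (Suc N)
  let ?A = "\<lambda>k l v. {ws. \<exists>n. visits 0 v (take n ws) \<ge> k \<and> visits x v (take n ws) \<le> l}"
  let ?P = "\<lambda>A. measure (replicate_pmf N p) A"
  have unfold: "w # ws \<in> ?A k l y \<longleftrightarrow>
      (\<exists>n. of_bool (y + w = 0) + visits 0 (y + w) (take n ws) \<ge> k \<and>
           of_bool (y + w = x) + visits x (y + w) (take n ws) \<le> l)" for w ws
  proof -
    have "(\<exists>n. Q n) \<longleftrightarrow> (\<exists>n. Q (Suc n))" if "\<not> Q 0" for Q :: "nat \<Rightarrow> bool"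
      using that by (metis not0_implies_Suc)
    from this[of "\<lambda>n. visits 0 y (take n (w # ws)) \<ge> k \<and> visits x y (take n (w # ws)) \<le> l"]
    have "w # ws \<in> ?A k l y \<longleftrightarrow> (\<exists>n. visits 0 y (take (Suc n) (w # ws)) \<ge> k \<and> visits x y (take (Suc n) (w # ws)) \<le> l)"
      using Suc.prems by simp
    then show ?thesis by simp
  qed
  have step: "?P {ws. w # ws \<in> ?A k l y} \<le> K * (g (y + w) * (\<rho> ^ k * \<sigma> ^ l))" for w
  proof -
    define v where "v = y + w"
    define k' where "k' = k - of_bool (v = 0)"
    define l' where "l' = l - of_bool (v = x)"
    have sub: "{ws. w # ws \<in> ?A k l y} \<subseteq> ?A k' l' v"
    proof
      fix ws assume "ws \<in> {ws. w # ws \<in> ?A k l y}"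
      then have "w # ws \<in> ?A k l y" by simp
      then obtain n where "of_bool (v = 0) + visits 0 v (take n ws) \<ge> k"
        "of_bool (v = x) + visits x v (take n ws) \<le> l"
        unfolding unfold v_def by blast
      then have "visits 0 v (take n ws) \<ge> k' \<and> visits x v (take n ws) \<le> l'"
        unfolding k'_def l'_def by linarith
      then show "ws \<in> ?A k' l' v" by blast
    qed
    show ?thesis
    proof (cases "v = x \<and> l = 0")
      case True
      then have "{ws. w # ws \<in> ?A k l y} = {}" unfolding unfold by (auto simp: v_def)
      then have "?P {ws. w # ws \<in> ?A k l y} = 0" by (simp only: measure_empty)
      then show ?thesis using K g(1) \<rho> \<sigma> by simp
    next
      case False
      have factor: "avg g v * (\<rho> ^ k' * \<sigma> ^ l') \<le> g v * (\<rho> ^ k * \<sigma> ^ l)"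
      proof -
        consider "v = 0" | "v = x" | "v \<noteq> 0" "v \<noteq> x" by blast
        then show ?thesis
        proof cases
          case 1
          have "avg g v * (\<rho> ^ k' * \<sigma> ^ l') \<le> (\<rho> * g v) * (\<rho> ^ (k - 1) * \<sigma> ^ l)"
            using 1 x g0 \<rho> \<sigma> by (auto simp: k'_def l'_def intro!: mult_right_mono)
          also have "\<dots> = g v * (\<rho> ^ k * \<sigma> ^ l)" using Suc.prems by (cases k) (auto simp: mult_ac)
          finally show ?thesis .
        next
          case 2
          have "avg g v * (\<rho> ^ k' * \<sigma> ^ l') \<le> (\<sigma> * g v) * (\<rho> ^ k * \<sigma> ^ (l - 1))"
            using 2 x gx \<rho> \<sigma> by (auto simp: k'_def l'_def intro!: mult_right_mono)
          also have "\<dots> = g v * (\<rho> ^ k * \<sigma> ^ l)" using 2 False by (cases l) (auto simp: mult_ac)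
          finally show ?thesis .
        next
          case 3
          then show ?thesis
            using ge[of v] \<rho> \<sigma> by (auto simp: k'_def l'_def intro!: mult_right_mono)
        qed
      qed
      have "?P {ws. w # ws \<in> ?A k l y} \<le> K * (g v * (\<rho> ^ k * \<sigma> ^ l))"
      proof (cases "k' \<ge> 1")
        case True
        have "?P {ws. w # ws \<in> ?A k l y} \<le> ?P (?A k' l' v)"
          by (rule measure_pmf.finite_measure_mono[OF sub]) simp
        also have "\<dots> \<le> K * (avg g v * (\<rho> ^ k' * \<sigma> ^ l'))"
          using Suc.IH[OF True, of v l'] by (simp add: mult.assoc)
        also have "\<dots> \<le> K * (g v * (\<rho> ^ k * \<sigma> ^ l))" by (intro mult_left_mono factor K)
        finally show ?thesis .
      next
        case False
        then have v: "v = 0" "k = 1" using Suc.prems by (auto simp: k'_def of_bool_def split: if_splits)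
        have "1 * 1 \<le> (K * (\<rho> * g 0)) * \<sigma> ^ l"
          using K one_le_power[OF \<sigma>, of l] by (intro mult_mono) auto
        then have "1 \<le> K * (g v * (\<rho> ^ k * \<sigma> ^ l))" using v by (simp add: mult_ac)
        then show ?thesis using measure_pmf.prob_le_1 by (rule order_trans[rotated])
      qed
      then show ?thesis by (simp add: v_def)
    qed
  qed
  have "measure (replicate_pmf (Suc N) p) (?A k l y) \<le> (\<integral>w. K * (g (y + w) * (\<rho> ^ k * \<sigma> ^ l)) \<partial>measure_pmf p)"
    unfolding measure_replicate_pmf_Suc
  proof (intro integral_mono step)
    show "integrable (measure_pmf p) (\<lambda>w. ?P {ws. w # ws \<in> ?A k l y})"
      by (rule integrable_bounded_pmf[where B = 1]) auto
    have "integrable (measure_pmf p) (\<lambda>w. g (y + w))"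
      by (rule integrable_bounded_pmf[where B = C]) (use g in auto)
    then show "integrable (measure_pmf p) (\<lambda>w. K * (g (y + w) * (\<rho> ^ k * \<sigma> ^ l)))" by simp
  qed
  then show ?case by (simp add: avg_def mult.assoc)
qed

end

context transient_step begin

text \<open>
  This is \<open>m\<^sub>x\<close> in terms of the Green function, for \<open>x \<noteq> 0\<close>.
\<close>

definition ratio :: "'g \<Rightarrow> real" where
  "ratio x = (green x / green 0)\<^sup>2 / (1 - 1 / green 0)"

text \<open>
  A Green potential with charges at \<open>0\<close> and \<open>x\<close>. The factor \<open>green x / green 0\<close> makes the charge at \<open>x\<close>
  comparable with the value of the potential there, so that the loss at \<open>x\<close> under averaging is
  independent of \<open>x\<close>.
\<close>

definition tilt :: "real \<Rightarrow> 'g \<Rightarrow> 'g \<Rightarrow> real" where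
  "tilt \<kappa> x y = green y + \<kappa> * (green x / green 0) * green (y - x)"

lemma escape_bounds: "0 < 1 / green 0" "1 / green 0 < 1"
  using green_0_gt_1 by auto

lemma ratio_pos: "ratio x > 0"
  unfolding ratio_def using green_pos[of x] green_pos[of 0] escape_bounds
  by (intro divide_pos_pos zero_less_power) auto

lemma green_ratio_sq_le: "x \<noteq> 0 \<Longrightarrow> (green x / green 0)\<^sup>2 \<le> 1 - 1 / green 0"
  using green_sq_le[of x] green_0_gt_1 by (simp add: power_divide field_simps power2_eq_square)

lemma ratio_le_1: "x \<noteq> 0 \<Longrightarrow> ratio x \<le> 1"
  using green_ratio_sq_le[of x] escape_bounds by (simp add: ratio_def)

lemma avg_tilt:
  "avg (tilt \<kappa> x) y = tilt \<kappa> x y - of_bool (y = 0) - \<kappa> * (green x / green 0) * of_bool (y = x)"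
proof -
  have shift: "(\<integral>w. green (y + w - x) \<partial>measure_pmf p) = avg green (y - x)"
    unfolding avg_def by (intro Bochner_Integration.integral_cong refl arg_cong[where f = green]) simp
  have i: "integrable (measure_pmf p) (\<lambda>w. \<kappa> * (green x / green 0) * green (y + w - x))"
    using integrable_green[of "y - x"] by (simp add: algebra_simps)
  have "avg (tilt \<kappa> x) y = avg green y + \<kappa> * (green x / green 0) * avg green (y - x)"
    unfolding shift[symmetric] unfolding tilt_def avg_def
    by (subst Bochner_Integration.integral_add[OF integrable_green i]) simp
  then show ?thesis by (simp add: avg_green tilt_def algebra_simps)
qed

text \<open>
  For a negative charge this is the inequality \<open>green_mult_le'\<close>.
\<close>

lemma tilt_nonneg:
  assumes "- 1 \<le> \<kappa>"
  shows "0 \<le> tilt \<kappa> x y"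
proof -
  have "green x / green 0 * green (y - x) \<le> green y"
    using green_mult_le'[of y x] green_pos[of 0] by (simp add: field_simps)
  moreover have "0 \<le> green x / green 0 * green (y - x)" by (simp add: green_nonneg)
  ultimately have "(- \<kappa>) * (green x / green 0 * green (y - x)) \<le> green y"
    using mult_right_mono[of "- \<kappa>" 1 "green x / green 0 * green (y - x)"] assms by simp
  then show ?thesis by (simp add: tilt_def)
qed

lemma tilt_bounded:
  assumes "- 1 \<le> \<kappa>" "\<kappa> \<le> 1"
  shows "tilt \<kappa> x y \<le> 2 * green 0"
proof -
  have "green x / green 0 * green (y - x) \<le> green y"
    using green_mult_le'[of y x] green_pos[of 0] by (simp add: field_simps)
  moreover have "0 \<le> green x / green 0 * green (y - x)" by (simp add: green_nonneg)
  ultimately have "\<kappa> * (green x / green 0 * green (y - x)) \<le> green y"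
    using mult_right_mono[of \<kappa> 1 "green x / green 0 * green (y - x)"] assms by simp
  then have "tilt \<kappa> x y \<le> 2 * green y" by (simp add: tilt_def)
  then show ?thesis using green_le_green_0[of y] by simp
qed

lemma tilt_0: "tilt \<kappa> x 0 = green 0 * (1 + \<kappa> * (green x / green 0)\<^sup>2)"
  using green_pos[of 0] by (simp add: tilt_def field_simps power2_eq_square)

lemma tilt_x: "tilt \<kappa> x x = green x * (1 + \<kappa>)"
  using green_pos[of 0] by (simp add: tilt_def field_simps)

lemma tilt_factor_le:
  assumes "1 + \<kappa> * f > 0"
  shows "1 - 1 / (green 0 * (1 + \<kappa> * f)) \<le> (1 - 1 / green 0) * exp (\<kappa> / green 0 * (f / (1 - 1 / green 0)))"
proof -
  have "1 - \<kappa> * f \<le> 1 / (1 + \<kappa> * f)"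
  proof -
    have "(1 - \<kappa> * f) * (1 + \<kappa> * f) = 1 - (\<kappa> * f)\<^sup>2"
      by (simp add: algebra_simps power2_eq_square)
    then show ?thesis using assms by (simp add: pos_le_divide_eq)
  qed
  then have "(1 - \<kappa> * f) / green 0 \<le> (1 / (1 + \<kappa> * f)) / green 0"
    by (rule divide_right_mono) (rule green_nonneg)
  then have "1 - 1 / (green 0 * (1 + \<kappa> * f)) \<le> 1 - 1 / green 0 + \<kappa> / green 0 * f"
    by (simp add: diff_divide_distrib mult.commute)
  also have "\<dots> = (1 - 1 / green 0) * (1 + \<kappa> / green 0 * (f / (1 - 1 / green 0)))"
  proof -
    have "q + c = q * (1 + c / q)" if "q \<noteq> 0" for q c :: real using that by (simp add: field_simps)
    from this[of "1 - 1 / green 0" "\<kappa> / green 0 * f"] show ?thesis using escape_bounds by simp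
  qed
  also have "\<dots> \<le> (1 - 1 / green 0) * exp (\<kappa> / green 0 * (f / (1 - 1 / green 0)))"
    using escape_bounds by (intro mult_left_mono exp_ge_add_one_self) auto
  finally show ?thesis .
qed

text \<open>
  A positive charge \<open>\<kappa>\<close> is used. The prefactor \<open>1 / green x\<close> is the price for the value of the
  potential at \<open>x\<close>, where the last visit may take place; it is only polynomial in \<open>|x|\<close>.
\<close>

theorem many_visits_bound:
  assumes x: "x \<noteq> 0" and \<kappa>: "0 < \<kappa>" "\<kappa> \<le> 1" and kl: "(k, l) \<noteq> (0, 0)"
  shows "measure (replicate_pmf N p) {ws. visits 0 y ws \<ge> k \<and> visits x y ws \<ge> l}
    \<le> 2 * (green 0)\<^sup>2 / (green 0 - 1) / green x *
       ((1 - 1 / green 0) ^ k * exp (\<kappa> / green 0 * (ratio x * real k - real l / (1 + \<kappa>))))"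
proof -
  define G where "G = green 0"
  define a where "a = green x"
  define f where "f = (a / G)\<^sup>2"
  define \<rho> where "\<rho> = 1 - 1 / (G * (1 + \<kappa> * f))"
  define \<sigma> where "\<sigma> = 1 - \<kappa> / G / (1 + \<kappa>)"
  \<comment> \<open>\<open>1 / K\<close> is at most both \<open>G - 1 \<le> \<rho> * tilt \<kappa> x 0\<close> and \<open>a \<le> \<sigma> * tilt \<kappa> x x\<close>, because \<open>a \<le> G\<close>\<close>
  define K where "K = G / ((G - 1) * a)"
  have G: "G > 1" unfolding G_def by (rule green_0_gt_1)
  have a: "a > 0" "a \<le> G" unfolding a_def G_def by (auto simp: green_pos green_le_green_0)
  have f: "f > 0" using a G by (simp add: f_def)
  have t0: "tilt \<kappa> x 0 = G * (1 + \<kappa> * f)" by (simp add: tilt_0 G_def f_def a_def)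
  have tx: "tilt \<kappa> x x = a * (1 + \<kappa>)" by (simp add: tilt_x a_def)
  have pos1: "1 + \<kappa> * f > 0" using f \<kappa> by (simp add: add_pos_pos)
  have \<rho>g: "\<rho> * tilt \<kappa> x 0 = tilt \<kappa> x 0 - 1"
    unfolding t0 \<rho>_def using G pos1 by (simp add: left_diff_distrib)
  have \<sigma>g: "\<sigma> * tilt \<kappa> x x = tilt \<kappa> x x - \<kappa> * (a / G)"
  proof -
    have "1 + \<kappa> \<noteq> 0" using \<kappa> by simp
    then show ?thesis unfolding tx \<sigma>_def by (simp add: left_diff_distrib)
  qed
  have "G * (1 + \<kappa> * f) > 1" using G f \<kappa> by (simp add: less_1_mult')
  then have \<rho>: "0 < \<rho>" "\<rho> \<le> 1" using G pos1 by (auto simp: \<rho>_def field_simps)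
  have "\<kappa> < G * (1 + \<kappa>)"
  proof -
    have "\<kappa> < 1 * (1 + \<kappa>)" by simp
    also have "\<dots> \<le> G * (1 + \<kappa>)" using G \<kappa> by (intro mult_right_mono) auto
    finally show ?thesis .
  qed
  then have \<sigma>: "0 < \<sigma>" "\<sigma> \<le> 1" using G \<kappa> by (auto simp: \<sigma>_def field_simps)
  have K: "K > 0" using G a by (simp add: K_def)
  have K0: "1 \<le> K * (\<rho> * tilt \<kappa> x 0)"
  proof -
    have "K * (G - 1) = G / a" using G by (simp add: K_def)
    then have "1 \<le> K * (G - 1)" using a by simp
    also have "\<dots> \<le> K * (G * (1 + \<kappa> * f) - 1)"
      using K G f \<kappa> by (intro mult_left_mono) (auto simp: algebra_simps)
    finally show ?thesis unfolding \<rho>g by (simp add: t0)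
  qed
  have Kx: "1 \<le> K * (\<sigma> * tilt \<kappa> x x)"
  proof -
    have "\<kappa> * (a / G) \<le> \<kappa> * a" using G \<kappa> a by (simp add: field_simps)
    then have "a \<le> a * (1 + \<kappa>) - \<kappa> * (a / G)" by (simp add: algebra_simps)
    then have "K * a \<le> K * (a * (1 + \<kappa>) - \<kappa> * (a / G))"
      using K by (intro mult_left_mono) auto
    moreover have "1 \<le> K * a" using G a by (simp add: K_def field_simps)
    ultimately show ?thesis unfolding \<sigma>g by (simp add: tx)
  qed
  have \<rho>_le: "\<rho> \<le> (1 - 1 / G) * exp (\<kappa> / G * ratio x)"
    using tilt_factor_le[of \<kappa> f] pos1 by (simp add: \<rho>_def ratio_def G_def f_def a_def)
  have \<sigma>_le: "\<sigma> \<le> exp (- (\<kappa> / G / (1 + \<kappa>)))"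
    using exp_ge_add_one_self[of "- (\<kappa> / G / (1 + \<kappa>))"] by (simp add: \<sigma>_def)
  have "measure (replicate_pmf N p) {ws. visits 0 y ws \<ge> k \<and> visits x y ws \<ge> l}
     \<le> K * avg (tilt \<kappa> x) y * (\<rho> ^ k * \<sigma> ^ l)"
  proof (rule many_visits_le[where C = "2 * G"])
    show "x \<noteq> 0" by fact
    show "0 \<le> tilt \<kappa> x v" for v using \<kappa> by (intro tilt_nonneg) simp
    show "tilt \<kappa> x v \<le> 2 * G" for v unfolding G_def using \<kappa> by (intro tilt_bounded) auto
    show "avg (tilt \<kappa> x) 0 \<le> \<rho> * tilt \<kappa> x 0" using x by (simp add: avg_tilt \<rho>g)
    show "avg (tilt \<kappa> x) x \<le> \<sigma> * tilt \<kappa> x x" using x by (simp add: avg_tilt \<sigma>g a_def G_def)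
    show "avg (tilt \<kappa> x) v \<le> tilt \<kappa> x v" if "v \<noteq> 0" "v \<noteq> x" for v using that by (simp add: avg_tilt)
  qed (use \<rho> \<sigma> K K0 Kx kl in auto)
  also have "\<dots> \<le> K * (2 * G) * (\<rho> ^ k * \<sigma> ^ l)"
  proof (intro mult_right_mono mult_left_mono)
    have "avg (tilt \<kappa> x) y \<le> tilt \<kappa> x y"
      using \<kappa> by (simp add: avg_tilt green_nonneg)
    also have "\<dots> \<le> 2 * G" unfolding G_def using \<kappa> by (intro tilt_bounded) auto
    finally show "avg (tilt \<kappa> x) y \<le> 2 * G" .
  qed (use K \<rho> \<sigma> in auto)
  also have "\<dots> \<le> K * (2 * G) * (((1 - 1 / G) * exp (\<kappa> / G * ratio x)) ^ k * exp (- (\<kappa> / G / (1 + \<kappa>))) ^ l)"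
    using \<rho> \<sigma> \<rho>_le \<sigma>_le K G
    by (intro mult_left_mono mult_mono power_mono) auto
  also have "K * (2 * G) = 2 * G\<^sup>2 / (G - 1) / a"
    by (simp add: K_def power2_eq_square)
  also have "((1 - 1 / G) * exp (\<kappa> / G * ratio x)) ^ k * exp (- (\<kappa> / G / (1 + \<kappa>))) ^ l
     = (1 - 1 / G) ^ k * exp (\<kappa> / G * (ratio x * real k - real l / (1 + \<kappa>)))"
  proof -
    have "exp (\<kappa> / G * ratio x) ^ k * exp (- (\<kappa> / G / (1 + \<kappa>))) ^ l
       = exp (\<kappa> / G * (ratio x * real k - real l / (1 + \<kappa>)))"
      unfolding exp_of_nat_mult[symmetric] exp_add[symmetric] by (simp add: algebra_simps)
    then show ?thesis by (simp add: power_mult_distrib)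
  qed
  finally show ?thesis by (simp add: G_def a_def)
qed

text \<open>
  A negative charge is used. Since the walk starts at \<open>0\<close> and the last required visit is to \<open>0\<close>, there is no
  prefactor. For \<open>\<kappa> = 0\<close> this is the geometric tail of the number of returns.
\<close>

theorem few_visits_bound:
  assumes x: "x \<noteq> 0" and \<kappa>: "0 \<le> \<kappa>" "\<kappa> < 1" and k: "k \<ge> 1"
  shows "measure (replicate_pmf N p) {ws. \<exists>n. visits 0 0 (take n ws) \<ge> k \<and> visits x 0 (take n ws) \<le> l}
    \<le> (1 - 1 / green 0) ^ k * exp (- (\<kappa> / green 0 * (ratio x * real k - real l / (1 - \<kappa>))))"
proof -
  define G where "G = green 0"
  define a where "a = green x"
  define f where "f = (a / G)\<^sup>2"
  define \<rho> where "\<rho> = 1 - 1 / (G * (1 - \<kappa> * f))"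
  define \<sigma> where "\<sigma> = 1 + \<kappa> / G / (1 - \<kappa>)"
  have G: "G > 1" unfolding G_def by (rule green_0_gt_1)
  have a: "a > 0" "a \<le> G" unfolding a_def G_def by (auto simp: green_pos green_le_green_0)
  have f: "f > 0" using a G by (simp add: f_def)
  have f1: "f \<le> 1 - 1 / G" using green_ratio_sq_le[OF x] by (simp add: f_def a_def G_def)
  have Gf: "G * f \<le> G - 1"
    using mult_left_mono[OF f1, of G] G by (simp add: algebra_simps)
  have t0: "tilt (- \<kappa>) x 0 = G * (1 - \<kappa> * f)" by (simp add: tilt_0 G_def f_def a_def)
  have tx: "tilt (- \<kappa>) x x = a * (1 - \<kappa>)" by (simp add: tilt_x a_def)
  have "\<kappa> * f < 1"
  proof -
    have "\<kappa> * f \<le> 1 * f" using \<kappa> f by (intro mult_right_mono) auto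
    also have "\<dots> < 1" using f1 G by (simp add: less_le_trans[of _ 1] le_less_trans)
    finally show ?thesis .
  qed
  then have pos1: "1 - \<kappa> * f > 0" by simp
  have big: "G * (1 - \<kappa> * f) > 1"
  proof -
    have "\<kappa> * (G * f) \<le> \<kappa> * (G - 1)" using Gf \<kappa> by (intro mult_left_mono) auto
    also have "\<dots> < 1 * (G - 1)" using G \<kappa> by (intro mult_strict_right_mono) auto
    finally show ?thesis by (simp add: algebra_simps)
  qed
  have \<rho>g: "\<rho> * tilt (- \<kappa>) x 0 = tilt (- \<kappa>) x 0 - 1"
    unfolding t0 \<rho>_def using G pos1 by (simp add: left_diff_distrib)
  have \<sigma>g: "\<sigma> * tilt (- \<kappa>) x x = tilt (- \<kappa>) x x + \<kappa> * (a / G)"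
    unfolding tx \<sigma>_def using G \<kappa> by (simp add: field_simps)
  have \<rho>: "0 < \<rho>" using big by (simp add: \<rho>_def)
  have \<sigma>: "\<sigma> \<ge> 1" using G \<kappa> by (simp add: \<sigma>_def)
  define K where "K = 1 / (\<rho> * tilt (- \<kappa>) x 0)"
  have Kpos: "\<rho> * tilt (- \<kappa>) x 0 > 0" unfolding \<rho>g using big by (simp add: t0)
  then have K: "K * (\<rho> * tilt (- \<kappa>) x 0) = 1" "K > 0" by (auto simp: K_def)
  have \<rho>_le: "\<rho> \<le> (1 - 1 / G) * exp (- (\<kappa> / G * ratio x))"
    using tilt_factor_le[of "- \<kappa>" f] pos1 by (simp add: \<rho>_def ratio_def G_def f_def a_def)
  have \<sigma>_le: "\<sigma> \<le> exp (\<kappa> / G / (1 - \<kappa>))"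
    using exp_ge_add_one_self[of "\<kappa> / G / (1 - \<kappa>)"] by (simp add: \<sigma>_def)
  have "measure (replicate_pmf N p) {ws. \<exists>n. visits 0 0 (take n ws) \<ge> k \<and> visits x 0 (take n ws) \<le> l}
     \<le> K * avg (tilt (- \<kappa>) x) 0 * (\<rho> ^ k * \<sigma> ^ l)"
  proof (rule few_visits_le[where C = "2 * G"])
    show "x \<noteq> 0" by fact
    show "0 \<le> tilt (- \<kappa>) x v" for v using \<kappa> by (intro tilt_nonneg) simp
    show "tilt (- \<kappa>) x v \<le> 2 * G" for v unfolding G_def using \<kappa> by (intro tilt_bounded) auto
    show "avg (tilt (- \<kappa>) x) 0 \<le> \<rho> * tilt (- \<kappa>) x 0" using x by (simp add: avg_tilt \<rho>g)
    show "avg (tilt (- \<kappa>) x) x \<le> \<sigma> * tilt (- \<kappa>) x x" using x by (simp add: avg_tilt \<sigma>g a_def G_def)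
    show "avg (tilt (- \<kappa>) x) v \<le> tilt (- \<kappa>) x v" if "v \<noteq> 0" "v \<noteq> x" for v using that by (simp add: avg_tilt)
  qed (use \<rho> \<sigma> K k in auto)
  also have "K * avg (tilt (- \<kappa>) x) 0 = 1"
    using x K(1) by (simp add: avg_tilt \<rho>g)
  also have "1 * (\<rho> ^ k * \<sigma> ^ l) \<le> ((1 - 1 / G) * exp (- (\<kappa> / G * ratio x))) ^ k * exp (\<kappa> / G / (1 - \<kappa>)) ^ l"
    unfolding mult_1_left using \<rho> \<sigma> \<rho>_le \<sigma>_le G
    by (intro mult_mono power_mono) auto
  also have "\<dots> = (1 - 1 / G) ^ k * exp (- (\<kappa> / G * (ratio x * real k - real l / (1 - \<kappa>))))"
  proof -
    have "exp (- (\<kappa> / G * ratio x)) ^ k * exp (\<kappa> / G / (1 - \<kappa>)) ^ l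
       = exp (- (\<kappa> / G * (ratio x * real k - real l / (1 - \<kappa>))))"
      unfolding exp_of_nat_mult[symmetric] exp_add[symmetric] by (simp add: algebra_simps)
    then show ?thesis by (simp add: power_mult_distrib)
  qed
  finally show ?thesis by (simp add: G_def)
qed

end

section \<open>From the probability space to words of steps\<close>

locale iid_walk =
  fixes M :: "'a measure" and X :: "nat \<Rightarrow> 'a \<Rightarrow> int ^ 'd"
  assumes rw: "random_walk M X"

sublocale iid_walk \<subseteq> prob_space M
  using rw unfolding random_walk_def by blast

context iid_walk begin

lemma distr_eq_measure_pmf:
  fixes Y :: "'a \<Rightarrow> 'b :: countable"
  assumes "Y \<in> measurable M (count_space UNIV)"
    and "\<And>y. measure M {\<omega>\<in>space M. Y \<omega> = y} = pmf q y"
  shows "distr M (count_space UNIV) Y = measure_pmf q"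
proof (rule measure_eqI_countable)
  fix y
  have "Y -` {y} \<inter> space M = {\<omega>\<in>space M. Y \<omega> = y}" by auto
  then show "emeasure (distr M (count_space UNIV) Y) {y} = emeasure (measure_pmf q) {y}"
    using assms by (simp add: emeasure_distr emeasure_eq_measure emeasure_pmf_single)
qed auto

definition step :: "(int ^ 'd) pmf" where
  "step = embed_pmf (step_prob M X)"

lemma indep_X: "indep_vars (\<lambda>_. count_space UNIV) X {1..}"
  using rw unfolding random_walk_def by blast

lemma measurable_X: "k \<ge> 1 \<Longrightarrow> X k \<in> measurable M (count_space UNIV)"
  using indep_X by (auto simp: indep_vars_def)

lemma measure_distr_X:
  "k \<ge> 1 \<Longrightarrow> measure (distr M (count_space UNIV) (X k)) {x} = measure M {\<omega>\<in>space M. X k \<omega> = x}"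
proof -
  assume k: "k \<ge> 1"
  have "X k -` {x} \<inter> space M = {\<omega>\<in>space M. X k \<omega> = x}" by auto
  then show ?thesis using measure_distr[OF measurable_X[OF k], of "{x}"] by simp
qed

lemma measure_X: "k \<ge> 1 \<Longrightarrow> measure M {\<omega>\<in>space M. X k \<omega> = x} = step_prob M X x"
proof -
  assume k: "k \<ge> 1"
  have "measure M {\<omega>\<in>space M. X k \<omega> = x} = measure (distr M (count_space UNIV) (X k)) {x}"
    by (rule measure_distr_X[OF k, symmetric])
  also have "distr M (count_space UNIV) (X k) = distr M (count_space UNIV) (X 1)"
    using rw k unfolding random_walk_def by blast
  also have "measure (distr M (count_space UNIV) (X 1)) {x} = step_prob M X x"
    unfolding step_prob_def by (rule measure_distr_X) simp
  finally show ?thesis .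
qed

lemma pmf_step: "pmf step x = step_prob M X x"
  unfolding step_def
proof (rule pmf_embed_pmf)
  show "0 \<le> step_prob M X x" for x by (simp add: step_prob_def)
  interpret D: prob_space "distr M (count_space UNIV) (X 1)"
    by (rule prob_space_distr) (simp add: measurable_X)
  have "emeasure (distr M (count_space UNIV) (X 1)) {x} = ennreal (step_prob M X x)" for x
  proof -
    have "step_prob M X x = measure (distr M (count_space UNIV) (X 1)) {x}"
      unfolding step_prob_def by (rule measure_distr_X[symmetric]) simp
    then show ?thesis by (simp only: D.emeasure_eq_measure)
  qed
  then have "(\<integral>\<^sup>+x. ennreal (step_prob M X x) \<partial>count_space UNIV)
     = emeasure (distr M (count_space UNIV) (X 1)) UNIV"
    by (subst emeasure_countable_singleton) auto
  also have "\<dots> = 1" using D.emeasure_space_1 by simp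
  finally show "(\<integral>\<^sup>+x. ennreal (step_prob M X x) \<partial>count_space UNIV) = 1" .
qed

text \<open>
  The steps numbered \<open>j + 1, ..., j + N\<close>. Their joint law does not depend on \<open>j\<close>, so every event
  about the walk after time \<open>j\<close> is an event about a word.
\<close>

definition word :: "nat \<Rightarrow> nat \<Rightarrow> 'a \<Rightarrow> (int ^ 'd) list" where
  "word j N \<omega> = map (\<lambda>i. X i \<omega>) [Suc j..<Suc j + N]"

lemma length_word [simp]: "length (word j N \<omega>) = N"
  by (simp add: word_def)

lemma word_eq_iff: "length ws = N \<Longrightarrow> word j N \<omega> = ws \<longleftrightarrow> (\<forall>i<N. X (Suc j + i) \<omega> = ws ! i)"
  by (auto simp: word_def list_eq_iff_nth_eq simp del: upt_Suc)

lemma pmf_replicate_pmf: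
  "pmf (replicate_pmf N q) ws = (if length ws = N then \<Prod>i<N. pmf q (ws ! i) else 0)"
proof (induction N arbitrary: ws)
  case 0
  then show ?case by (auto simp: pmf_return)
next
  case (Suc N)
  show ?case
  proof (cases ws)
    case Nil
    then have "ws \<notin> set_pmf (replicate_pmf (Suc N) q)" unfolding set_replicate_pmf by simp
    then show ?thesis using Nil by (simp add: set_pmf_iff del: replicate_pmf.simps)
  next
    case (Cons a as)
    have inner: "pmf (bind_pmf (replicate_pmf N q) (\<lambda>xs. return_pmf (x # xs))) (a # as)
        = indicator {a} x * pmf (replicate_pmf N q) as" for x
    proof (cases "x = a")
      case True
      have "pmf (map_pmf (Cons a) (replicate_pmf N q)) (a # as) = pmf (replicate_pmf N q) as"
        by (rule pmf_map_inj') simp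
      then show ?thesis using True by (simp add: map_pmf_def)
    next
      case False
      then have "pmf (bind_pmf (replicate_pmf N q) (\<lambda>xs. return_pmf (x # xs))) (a # as) = 0"
        by (auto simp: pmf_eq_0_set_pmf)
      then show ?thesis using False by simp
    qed
    have "pmf (replicate_pmf (Suc N) q) ws
        = (\<integral>x. indicator {a} x * pmf (replicate_pmf N q) as \<partial>measure_pmf q)"
      unfolding replicate_pmf.simps pmf_bind[of q] Cons inner by (rule refl)
    also have "\<dots> = pmf q a * pmf (replicate_pmf N q) as"
      by (simp add: measure_pmf_single)
    finally show ?thesis
      unfolding Suc using Cons by (simp add: prod.lessThan_Suc_shift del: prod.lessThan_Suc)
  qed
qed

lemma word_event: "{\<omega>\<in>space M. word j N \<omega> = ws} \<in> sets M"
  and measure_word_eq: "measure M {\<omega>\<in>space M. word j N \<omega> = ws} = pmf (replicate_pmf N step) ws"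
proof -
  have "{\<omega>\<in>space M. word j N \<omega> = ws} \<in> sets M \<and>
    measure M {\<omega>\<in>space M. word j N \<omega> = ws} = pmf (replicate_pmf N step) ws"
  proof (cases "length ws = N \<and> N > 0")
    case True
    then have len: "length ws = N" and N: "N > 0" by auto
    let ?J = "{Suc j..<Suc j + N}"
    have eq: "{\<omega>\<in>space M. word j N \<omega> = ws} = (\<Inter>i\<in>?J. X i -` {ws ! (i - Suc j)} \<inter> space M)"
    proof (intro set_eqI iffI)
      fix \<omega> assume \<omega>: "\<omega> \<in> {\<omega>\<in>space M. word j N \<omega> = ws}"
      show "\<omega> \<in> (\<Inter>i\<in>?J. X i -` {ws ! (i - Suc j)} \<inter> space M)"
      proof
        fix i assume i: "i \<in> ?J"
        then have "i - Suc j < N" "Suc j + (i - Suc j) = i" by auto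
        then show "\<omega> \<in> X i -` {ws ! (i - Suc j)} \<inter> space M"
          using \<omega> word_eq_iff[OF len, of j \<omega>] by force
      qed
    next
      fix \<omega> assume \<omega>: "\<omega> \<in> (\<Inter>i\<in>?J. X i -` {ws ! (i - Suc j)} \<inter> space M)"
      have "X (Suc j + i) \<omega> = ws ! i" if "i < N" for i
        using \<omega> that by (auto dest!: bspec[where x = "Suc j + i"])
      moreover have "\<omega> \<in> space M" using \<omega> N by auto
      ultimately show "\<omega> \<in> {\<omega>\<in>space M. word j N \<omega> = ws}"
        using word_eq_iff[OF len, of j \<omega>] by auto
    qed
    have ev: "X i -` {x} \<inter> space M \<in> sets M" if "i \<in> ?J" for i x
      by (rule measurable_sets[OF measurable_X]) (use that in auto)
    have "measure M {\<omega>\<in>space M. word j N \<omega> = ws} = (\<Prod>i\<in>?J. measure M (X i -` {ws ! (i - Suc j)} \<inter> space M))"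
      unfolding eq by (rule indep_varsD[OF indep_X]) (use N in auto)
    also have "\<dots> = (\<Prod>i\<in>?J. pmf step (ws ! (i - Suc j)))"
    proof (intro prod.cong refl)
      fix i assume "i \<in> ?J"
      then have "measure M {\<omega>\<in>space M. X i \<omega> = ws ! (i - Suc j)} = pmf step (ws ! (i - Suc j))"
        by (subst measure_X) (auto simp: pmf_step)
      moreover have "X i -` {ws ! (i - Suc j)} \<inter> space M = {\<omega>\<in>space M. X i \<omega> = ws ! (i - Suc j)}" by auto
      ultimately show "measure M (X i -` {ws ! (i - Suc j)} \<inter> space M) = pmf step (ws ! (i - Suc j))" by simp
    qed
    also have "\<dots> = (\<Prod>i<N. pmf step (ws ! i))"
      by (rule prod.reindex_bij_witness[of _ "\<lambda>i. Suc j + i" "\<lambda>i. i - Suc j"]) auto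
    finally have "measure M {\<omega>\<in>space M. word j N \<omega> = ws} = pmf (replicate_pmf N step) ws"
      using len by (simp add: pmf_replicate_pmf)
    moreover have "{\<omega>\<in>space M. word j N \<omega> = ws} \<in> sets M"
      unfolding eq using N ev by (intro sets.finite_INT) auto
    ultimately show ?thesis by simp
  next
    case False
    show ?thesis
    proof (cases "length ws = N")
      case True
      then have "{\<omega>\<in>space M. word j N \<omega> = ws} = space M" using False by (auto simp: word_def)
      then show ?thesis using True False by (simp add: prob_space)
    next
      case neq: False
      then have "{\<omega>\<in>space M. word j N \<omega> = ws} = {}" by auto
      then show ?thesis using neq by (simp only: pmf_replicate_pmf) simp
    qed
  qed
  then show "{\<omega>\<in>space M. word j N \<omega> = ws} \<in> sets M"
    "measure M {\<omega>\<in>space M. word j N \<omega> = ws} = pmf (replicate_pmf N step) ws" by auto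
qed

lemma measurable_word: "word j N \<in> measurable M (count_space UNIV)"
proof -
  have "word j N -` {ws} \<inter> space M \<in> sets M" for ws
  proof -
    have "word j N -` {ws} \<inter> space M = {\<omega>\<in>space M. word j N \<omega> = ws}" by auto
    then show ?thesis using word_event by simp
  qed
  then show ?thesis by (auto simp: measurable_count_space_eq2_countable)
qed

lemma distr_word: "distr M (count_space UNIV) (word j N) = measure_pmf (replicate_pmf N step)"
  by (rule distr_eq_measure_pmf[OF measurable_word measure_word_eq])

lemma word_sets [measurable]: "{\<omega>\<in>space M. word j N \<omega> \<in> A} \<in> sets M"
proof -
  have "word j N -` A \<inter> space M \<in> sets M" by (rule measurable_sets[OF measurable_word]) simp
  also have "word j N -` A \<inter> space M = {\<omega>\<in>space M. word j N \<omega> \<in> A}" by auto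
  finally show ?thesis .
qed

lemma measure_word: "measure M {\<omega>\<in>space M. word j N \<omega> \<in> A} = measure (replicate_pmf N step) A"
proof -
  have "measure (replicate_pmf N step) A = measure (distr M (count_space UNIV) (word j N)) A"
    by (simp add: distr_word)
  also have "\<dots> = measure M (word j N -` A \<inter> space M)"
    by (rule measure_distr[OF measurable_word]) simp
  also have "word j N -` A \<inter> space M = {\<omega>\<in>space M. word j N \<omega> \<in> A}" by auto
  finally show ?thesis by simp
qed

lemma word_Suc: "word j (Suc N) \<omega> = X (Suc j) \<omega> # word (Suc j) N \<omega>"
  unfolding word_def by (simp add: upt_conv_Cons del: upt_Suc)

lemma take_word: "n \<le> N \<Longrightarrow> take n (word j N \<omega>) = word j n \<omega>"
  by (simp add: word_def take_map take_upt del: upt_Suc)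

lemma walk_Suc: "walk X (Suc n) \<omega> = walk X n \<omega> + X (Suc n) \<omega>"
  by (simp add: walk_def)

text \<open>
  Visits counted along the word of steps are visits of the walk after time \<open>j\<close>, recentred so that
  it is at \<open>y\<close> at time \<open>j\<close>.
\<close>

lemma visits_word:
  "visits a y (word j N \<omega>) = (\<Sum>i=Suc j..j + N. of_bool (y + (walk X i \<omega> - walk X j \<omega>) = a))"
proof (induction N arbitrary: j y)
  case 0
  then show ?case by (simp add: word_def)
next
  case (Suc N)
  have "visits a y (word j (Suc N) \<omega>)
     = of_bool (y + X (Suc j) \<omega> = a) + visits a (y + X (Suc j) \<omega>) (word (Suc j) N \<omega>)"
    by (simp add: word_Suc)
  also have "\<dots> = of_bool (y + X (Suc j) \<omega> = a)
      + (\<Sum>i=Suc (Suc j)..Suc j + N. of_bool (y + (walk X i \<omega> - walk X j \<omega>) = a))"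
    unfolding Suc by (simp add: walk_Suc algebra_simps)
  also have "\<dots> = (\<Sum>i=Suc j..j + Suc N. of_bool (y + (walk X i \<omega> - walk X j \<omega>) = a))"
    by (subst sum.atLeast_Suc_atMost[of "Suc j"]) (auto simp: walk_Suc)
  finally show ?case .
qed

lemma local_time_word: "local_time X z n \<omega> = visits z 0 (word 0 n \<omega>)"
  by (simp add: local_time_def visits_word walk_def)

lemma sum_list_replicate_pmf: "map_pmf sum_list (replicate_pmf n q) = walk_pmf q n"
proof (induction n)
  case (Suc n)
  have "map_pmf sum_list (replicate_pmf (Suc n) q) =
      bind_pmf q (\<lambda>x. map_pmf (\<lambda>y. x + y) (map_pmf sum_list (replicate_pmf n q)))"
    by (simp add: map_pmf_def bind_assoc_pmf bind_return_pmf)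
  then show ?case by (simp add: Suc conv_def)
qed simp

lemma walk_eq_sum_list: "walk X n \<omega> = sum_list (word 0 n \<omega>)"
proof (induction n)
  case (Suc n)
  have "word 0 (Suc n) \<omega> = word 0 n \<omega> @ [X (Suc n) \<omega>]" by (simp add: word_def)
  then show ?case using Suc by (simp add: walk_Suc)
qed (simp add: walk_def word_def)

lemma measure_walk: "measure M {\<omega>\<in>space M. walk X n \<omega> = x} = pmf (walk_pmf step n) x"
proof -
  have "pmf (walk_pmf step n) x = measure (replicate_pmf n step) (sum_list -` {x})"
    by (simp add: pmf_map flip: sum_list_replicate_pmf)
  also have "\<dots> = measure M {\<omega>\<in>space M. word 0 n \<omega> \<in> sum_list -` {x}}"
    by (rule measure_word[symmetric])
  finally show ?thesis by (simp add: walk_eq_sum_list)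
qed

lemma symmetric_step_step: "symmetric_walk M X \<Longrightarrow> symmetric_step step"
  by unfold_locales (simp add: symmetric_walk_def pmf_step)

text \<open>
  For a symmetric walk the reachable set is closed under differences, so aperiodicity says
  that every point is reachable.
\<close>

lemma irreducible_step_step:
  assumes "symmetric_walk M X" "aperiodic_walk M X"
  shows "irreducible_step step"
proof -
  interpret symmetric_step step using assms(1) by (rule symmetric_step_step)
  show ?thesis
  proof unfold_locales
    fix x :: "int ^ 'd"
    have "x \<in> {y - z | y z. y \<in> reachable M X \<and> z \<in> reachable M X}"
      using assms(2) by (simp add: aperiodic_walk_def)
    then obtain y z m n where x: "x = y - z" and y: "pmf (W m) y > 0" and z: "pmf (W n) z > 0"
      by (auto simp: reachable_def measure_walk)
    have "pmf (W m) y * pmf (W n) (- z) \<le> pmf (W (m + n)) (y + - z)"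
      by (rule pmf_walk_pmf_add_ge)
    then have "pmf (W (m + n)) x > 0"
      using y z x by (smt (verit) W_symm mult_pos_pos uminus_add_conv_diff diff_conv_add_uminus)
    then show "\<exists>n. pmf (W n) x > 0" by blast
  qed
qed

lemma norm_to_real_vec_ge_1: "x \<noteq> 0 \<Longrightarrow> norm (to_real_vec x) \<ge> 1"
proof -
  assume "x \<noteq> 0"
  then obtain i where "x $ i \<noteq> 0" by (auto simp: vec_eq_iff)
  then have "1 \<le> \<bar>to_real_vec x $ i\<bar>" by (simp add: to_real_vec_def)
  also have "\<dots> \<le> norm (to_real_vec x)" by (rule component_le_norm_cart)
  finally show ?thesis .
qed

text \<open>
  On the lattice a nonzero vector has norm at least one, so a moment of order \<open>d - 2 \<ge> 2\<close> bounds
  the second one.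
\<close>

lemma second_moment_step:
  assumes "CARD('d) \<ge> 5" "moment_condition M X"
  shows "(\<integral>\<^sup>+w. ennreal ((real_of_int (w $ i))\<^sup>2) \<partial>measure_pmf step) < \<infinity>"
proof -
  let ?f = "\<lambda>x. norm (to_real_vec x) ^ (CARD('d) - 2) * step_prob M X x"
  have "?f summable_on UNIV" using assms by (simp add: moment_condition_def)
  then have "Infinite_Sum.abs_summable_on ?f UNIV"
    by (rule summable_on_iff_abs_summable_on_real[THEN iffD1])
  then have int: "integrable (count_space UNIV) ?f"
    unfolding abs_summable_equivalent abs_summable_on_def .
  have "(\<integral>\<^sup>+w. ennreal ((real_of_int (w $ i))\<^sup>2) \<partial>measure_pmf step)
     = (\<integral>\<^sup>+w. ennreal (step_prob M X w) * ennreal ((real_of_int (w $ i))\<^sup>2) \<partial>count_space UNIV)"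
    by (simp add: nn_integral_measure_pmf pmf_step)
  also have "\<dots> \<le> (\<integral>\<^sup>+w. ennreal (norm (?f w)) \<partial>count_space UNIV)"
  proof (intro nn_integral_mono)
    fix w :: "int ^ 'd"
    have "(real_of_int (w $ i))\<^sup>2 \<le> norm (to_real_vec w) ^ (CARD('d) - 2)"
    proof (cases "w = 0")
      case False
      have "\<bar>real_of_int (w $ i)\<bar> \<le> norm (to_real_vec w)"
        using component_le_norm_cart[of "to_real_vec w" i] by (simp add: to_real_vec_def)
      then have "(real_of_int (w $ i))\<^sup>2 \<le> (norm (to_real_vec w))\<^sup>2"
        by (simp add: abs_le_square_iff[symmetric])
      also have "\<dots> \<le> norm (to_real_vec w) ^ (CARD('d) - 2)"
        by (rule power_increasing) (use assms(1) norm_to_real_vec_ge_1[OF False] in auto)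
      finally show ?thesis .
    qed simp
    moreover have p: "step_prob M X w \<ge> 0" by (simp add: step_prob_def)
    ultimately have "step_prob M X w * (real_of_int (w $ i))\<^sup>2 \<le> norm (?f w)"
      by (simp add: mult.commute[of _ "step_prob M X w"] mult_left_mono)
    then show "ennreal (step_prob M X w) * ennreal ((real_of_int (w $ i))\<^sup>2) \<le> ennreal (norm (?f w))"
      using p by (simp add: ennreal_leI flip: ennreal_mult)
  qed
  also have "\<dots> < \<infinity>" using int by (auto simp: integrable_iff_bounded)
  finally show ?thesis .
qed

end

locale lattice_walk = iid_walk M X for M :: "'a measure" and X :: "nat \<Rightarrow> 'a \<Rightarrow> int ^ 'd" +
  assumes dim5: "CARD('d) \<ge> 5"
    and sym_walk: "symmetric_walk M X"
    and aper: "aperiodic_walk M X"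
    and moments: "moment_condition M X"

sublocale lattice_walk \<subseteq> lattice_step step
proof -
  interpret irreducible_step step by (rule irreducible_step_step[OF sym_walk aper])
  show "lattice_step step"
    by unfold_locales (use dim5 second_moment_step[OF dim5 moments] in auto)
qed

context lattice_walk begin

text \<open>
  Hitting \<open>x\<close> from \<open>0\<close> is hitting \<open>0\<close> from \<open>- x\<close>, and the Green function is even.
\<close>

lemma avoid_prob_eq: "avoid_prob M X x = 1 - (green x - of_bool (x = 0)) / green 0"
proof -
  let ?A = "\<lambda>N. {\<omega>\<in>space M. word 0 N \<omega> \<in> {ws. \<not> visits x 0 ws \<ge> 1}}"
  have A: "?A N = {\<omega>\<in>space M. \<forall>i\<in>{1..N}. walk X i \<omega> \<noteq> x}" for N
    unfolding mem_Collect_eq local_time_word[symmetric] local_time_def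
    by (intro Collect_cong conj_cong refl) (auto simp: not_le sum_eq_0_iff simp del: sum_of_bool_eq)
  have flip: "visits x 0 ws = visits 0 (- x) ws" for ws
  proof -
    have "visits x y ws = visits 0 (y - x) ws" for y
      by (induction ws arbitrary: y) (auto simp: algebra_simps)
    then show ?thesis by simp
  qed
  have "measure M (?A N) = 1 - hit N (- x)" for N
  proof -
    have "measure M (?A N) = measure (replicate_pmf N step) (UNIV - {ws. visits x 0 ws \<ge> 1})"
      unfolding measure_word by (intro arg_cong[where f = "measure _"]) auto
    also have "\<dots> = 1 - measure (replicate_pmf N step) {ws. visits x 0 ws \<ge> 1}"
      by (subst measure_pmf.prob_compl[symmetric]) auto
    also have "measure (replicate_pmf N step) {ws. visits x 0 ws \<ge> 1} = hit N (- x)"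
      by (simp add: hit_def flip)
    finally show ?thesis .
  qed
  moreover have "(\<lambda>N. measure M (?A N)) \<longlonglongrightarrow> measure M (\<Inter>N. ?A N)"
  proof (rule finite_Lim_measure_decseq)
    show "range ?A \<subseteq> sets M" by (intro image_subsetI word_sets)
    show "decseq ?A" unfolding A decseq_def by auto
  qed
  moreover have "(\<Inter>N. ?A N) = {\<omega>\<in>space M. \<forall>i\<ge>1. walk X i \<omega> \<noteq> x}"
    unfolding A by (auto, metis One_nat_def atLeastAtMost_iff order_refl)
  ultimately have "(\<lambda>N. 1 - hit N (- x)) \<longlonglongrightarrow> avoid_prob M X x"
    by (simp add: avoid_prob_def)
  moreover have "(\<lambda>N. 1 - hit N (- x)) \<longlonglongrightarrow> 1 - (green x - of_bool (x = 0)) / green 0"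
    using tendsto_diff[OF tendsto_const hit_limit[of "- x"], of 1] by simp
  ultimately show ?thesis by (rule LIMSEQ_unique)
qed

lemma escape_prob_eq: "escape_prob M X = 1 / green 0"
  using green_0_gt_1 by (simp add: escape_prob_def avoid_prob_eq diff_divide_distrib)

lemma walk_m_eq: "x \<noteq> 0 \<Longrightarrow> walk_m M X x = ratio x"
  by (simp add: walk_m_def avoid_prob_eq escape_prob_eq ratio_def)

lemma walk_lambda_pos: "walk_lambda M X > 0"
  using escape_bounds by (simp add: walk_lambda_def escape_prob_eq divide_neg_neg)

lemma return_power: "(1 - 1 / green 0) ^ k = exp (- real k / walk_lambda M X)"
proof -
  have q: "1 - 1 / green 0 > 0" using escape_bounds by simp
  have "(1 - 1 / green 0) ^ k = exp (real k * ln (1 - 1 / green 0))"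
    using q by (simp add: exp_of_nat_mult)
  then show ?thesis by (simp add: walk_lambda_def escape_prob_eq)
qed

end

section \<open>The norm of the covariance matrix\<close>

text \<open>
  Evaluate the form at \<open>Q\<^sup>-\<^sup>1 x - t x\<close>, where \<open>t\<close> is the reciprocal of a bound for the norm of \<open>Q\<close>.
\<close>

lemma positive_definite_inverse_form:
  fixes Q :: "real ^ 'n ^ 'n"
  assumes symQ: "\<And>x y. x \<bullet> (Q *v y) = y \<bullet> (Q *v x)"
    and nonneg: "\<And>y. 0 \<le> y \<bullet> (Q *v y)"
    and definite: "\<And>y. y \<bullet> (Q *v y) = 0 \<Longrightarrow> y = 0"
  obtains B where "B > 0" "\<And>x. (norm x)\<^sup>2 \<le> B * (x \<bullet> (matrix_inv Q *v x))"
proof -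
  have "inj ((*v) Q)"
  proof (rule injI)
    fix x y assume "Q *v x = Q *v y"
    then have "Q *v (x - y) = 0" by (simp add: matrix_vector_mult_diff_distrib)
    then show "x = y" using definite[of "x - y"] by simp
  qed
  then have inv: "invertible Q"
    by (simp add: invertible_left_inverse matrix_left_invertible_injective)
  have Qinv: "Q *v (matrix_inv Q *v x) = x" for x
  proof -
    have "Q ** matrix_inv Q = mat 1"
      using inv unfolding invertible_def matrix_inv_def by (rule someI2_ex) simp
    then show ?thesis by (simp add: matrix_vector_mul_assoc)
  qed
  obtain B where B: "B > 0" "\<And>x. norm (Q *v x) \<le> norm x * B"
    using bounded_linear.pos_bounded[OF matrix_vector_mul_bounded_linear[of Q]] by blast
  have "(norm x)\<^sup>2 \<le> B * (x \<bullet> (matrix_inv Q *v x))" for x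
  proof -
    define y where "y = matrix_inv Q *v x"
    define t where "t = 1 / B"
    have Qy: "Q *v y = x" by (simp add: y_def Qinv)
    have "0 \<le> (y - t *\<^sub>R x) \<bullet> (Q *v (y - t *\<^sub>R x))" by (rule nonneg)
    also have "\<dots> = y \<bullet> x - 2 * t * (x \<bullet> x) + t\<^sup>2 * (x \<bullet> (Q *v x))"
      using symQ[of y x]
      by (simp add: matrix_vector_mult_diff_distrib matrix_vector_mult_scaleR Qy inner_diff_left
          inner_diff_right power2_eq_square algebra_simps)
    also have "x \<bullet> (Q *v x) \<le> norm x * norm (Q *v x)" by (rule norm_cauchy_schwarz)
    also have "\<dots> \<le> norm x * (norm x * B)" by (intro mult_left_mono B) auto
    finally have "0 \<le> y \<bullet> x - 2 * t * (x \<bullet> x) + t\<^sup>2 * (norm x * (norm x * B))"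
      by (simp add: mult_left_mono)
    also have "\<dots> = y \<bullet> x - t * (norm x)\<^sup>2"
      using B(1) by (simp add: t_def field_simps power2_eq_square power2_norm_eq_inner[unfolded power2_eq_square])
    finally show ?thesis using B(1) by (simp add: t_def y_def field_simps inner_commute)
  qed
  then show ?thesis using that B(1) by blast
qed

context lattice_walk begin


lemma distr_X1: "distr M (count_space UNIV) (X 1) = measure_pmf step"
  by (rule distr_eq_measure_pmf) (auto simp: measurable_X measure_X pmf_step)

lemma integral_X1: "(\<integral>\<omega>. f (X 1 \<omega>) \<partial>M) = (\<integral>w. f w \<partial>measure_pmf step)" for f :: "int ^ 'd \<Rightarrow> real"
  unfolding distr_X1[symmetric] by (rule integral_distr[symmetric]) (auto intro: measurable_X)

lemma integrable_sq: "integrable (measure_pmf step) (\<lambda>w. (real_of_int (w $ i))\<^sup>2)"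
  using second_moment[of i] by (subst integrable_iff_bounded) simp

lemma integrable_prod: "integrable (measure_pmf step) (\<lambda>w. real_of_int (w $ i) * real_of_int (w $ j))"
proof (rule Bochner_Integration.integrable_bound)
  show "integrable (measure_pmf step) (\<lambda>w. (real_of_int (w $ i))\<^sup>2 + (real_of_int (w $ j))\<^sup>2)"
    by (intro Bochner_Integration.integrable_add integrable_sq)
  have "\<bar>a * b\<bar> \<le> a\<^sup>2 + b\<^sup>2" for a b :: real
  proof -
    have "2 * \<bar>a * b\<bar> \<le> a\<^sup>2 + b\<^sup>2"
      using sum_squares_bound[of "\<bar>a\<bar>" "\<bar>b\<bar>"] by (simp add: abs_mult mult.assoc)
    then show ?thesis using abs_ge_zero[of "a * b"] by linarith
  qed
  then show "AE w in measure_pmf step. norm (real_of_int (w $ i) * real_of_int (w $ j))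
      \<le> norm ((real_of_int (w $ i))\<^sup>2 + (real_of_int (w $ j))\<^sup>2)" by auto
qed simp

lemma mean_zero: "(\<integral>w. real_of_int (w $ i) \<partial>measure_pmf step) = 0"
proof -
  have "(\<integral>w. real_of_int (w $ i) \<partial>measure_pmf step) = (\<integral>w. real_of_int (w $ i) \<partial>measure_pmf (map_pmf uminus step))"
    by (simp add: map_uminus_p)
  also have "\<dots> = - (\<integral>w. real_of_int (w $ i) \<partial>measure_pmf step)" by simp
  finally show ?thesis by simp
qed

lemma covariance_entry:
  "covariance_matrix M X $ i $ j = (\<integral>w. real_of_int (w $ i) * real_of_int (w $ j) \<partial>measure_pmf step)"
proof -
  have "(\<integral>\<omega>. real_of_int (X 1 \<omega> $ i) \<partial>M) = 0" for i
    using integral_X1[of "\<lambda>w. real_of_int (w $ i)"] by (simp add: mean_zero)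
  then show ?thesis
    using integral_X1[of "\<lambda>w. real_of_int (w $ i) * real_of_int (w $ j)"]
    by (simp add: covariance_matrix_def Let_def)
qed

lemma covariance_form:
  "x \<bullet> (covariance_matrix M X *v y)
     = (\<integral>w. (x \<bullet> to_real_vec w) * (y \<bullet> to_real_vec w) \<partial>measure_pmf step)"
proof -
  have "(\<integral>w. (x \<bullet> to_real_vec w) * (y \<bullet> to_real_vec w) \<partial>measure_pmf step)
      = (\<integral>w. (\<Sum>i\<in>UNIV. \<Sum>j\<in>UNIV. x $ i * y $ j * (real_of_int (w $ i) * real_of_int (w $ j))) \<partial>measure_pmf step)"
    by (simp add: inner_vec_def to_real_vec_def sum_product mult_ac)
  also have "\<dots> = (\<Sum>i\<in>UNIV. \<Sum>j\<in>UNIV. x $ i * y $ j * covariance_matrix M X $ i $ j)"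
    unfolding covariance_entry
    by (subst Bochner_Integration.integral_sum,
        intro Bochner_Integration.integrable_sum integrable_mult_right integrable_prod,
        intro sum.cong refl,
        subst Bochner_Integration.integral_sum,
        intro integrable_mult_right integrable_prod) simp
  also have "\<dots> = x \<bullet> (covariance_matrix M X *v y)"
    by (simp add: inner_vec_def matrix_vector_mult_def sum_distrib_left mult_ac)
  finally show ?thesis by simp
qed

text \<open>
  If the form vanishes at \<open>y\<close>, all steps are orthogonal to \<open>y\<close>, hence so are all reachable points, and
  these include the standard basis.
\<close>

lemma covariance_definite:
  assumes "y \<bullet> (covariance_matrix M X *v y) = 0"
  shows "y = 0"
proof -
  let ?f = "\<lambda>w. y \<bullet> to_real_vec w"
  have int: "integrable (measure_pmf step) (\<lambda>w. ?f w * ?f w)"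
  proof -
    have "(\<lambda>w. ?f w * ?f w) = (\<lambda>w. \<Sum>i\<in>UNIV. \<Sum>j\<in>UNIV. y $ i * y $ j * (real_of_int (w $ i) * real_of_int (w $ j)))"
      by (simp add: inner_vec_def to_real_vec_def sum_product mult_ac)
    then show ?thesis by (auto intro!: Bochner_Integration.integrable_sum integrable_mult_right integrable_prod)
  qed
  have "(\<integral>w. ?f w * ?f w \<partial>measure_pmf step) = 0" using assms by (simp add: covariance_form)
  then have "AE w in measure_pmf step. ?f w * ?f w = 0"
    by (subst (asm) integral_nonneg_eq_0_iff_AE[OF int]) auto
  then have supp: "?f w = 0" if "w \<in> set_pmf step" for w
    using that by (auto simp: AE_measure_pmf_iff)
  have add: "?f (v + w) = ?f v + ?f w" for v w
    by (simp add: inner_vec_def to_real_vec_def sum.distrib algebra_simps)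
  have reachable: "?f w = 0" if "w \<in> set_pmf (W n)" for n w
    using that
  proof (induction n arbitrary: w)
    case 0
    then show ?case by (simp add: inner_vec_def to_real_vec_def)
  next
    case (Suc n)
    then obtain a b where "a \<in> set_pmf step" "b \<in> set_pmf (W n)" "w = a + b" by (auto simp: conv_def)
    then show ?case using Suc.IH[of b] supp[of a] by (simp add: add)
  qed
  show "y = 0"
  proof (rule vec_eq_iff[THEN iffD2], rule allI)
    fix i
    obtain n where "pmf (W n) (axis i 1) > 0" using reach by blast
    then have "?f (axis i 1) = 0" by (intro reachable[of _ n]) (simp add: set_pmf_iff)
    moreover have "to_real_vec (axis i 1) = axis i 1"
      by (simp add: to_real_vec_def axis_def vec_eq_iff)
    ultimately show "y $ i = 0 $ i" by (simp add: inner_axis)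
  qed
qed

lemma walk_ball_bounded:
  obtains A where "A > 0" "\<And>R x i. x \<in> walk_ball M X R \<Longrightarrow> \<bar>real_of_int (x $ i)\<bar> \<le> A * R"
proof -
  obtain B where B: "B > 0" "\<And>x. (norm x)\<^sup>2 \<le> B * (x \<bullet> (matrix_inv (covariance_matrix M X) *v x))"
  proof (rule positive_definite_inverse_form)
    show "x \<bullet> (covariance_matrix M X *v y) = y \<bullet> (covariance_matrix M X *v x)" for x y
      by (simp add: covariance_form mult.commute)
    show "0 \<le> y \<bullet> (covariance_matrix M X *v y)" for y
      by (simp add: covariance_form)
  qed (use covariance_definite in auto)
  show ?thesis
  proof (rule that)
    show "sqrt B > 0" using B by simp
    fix R x i assume "x \<in> walk_ball M X R"
    then have "walk_norm M X x \<le> R" by (simp add: walk_ball_def)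
    have "\<bar>real_of_int (x $ i)\<bar> \<le> norm (to_real_vec x)"
      using component_le_norm_cart[of "to_real_vec x" i] by (simp add: to_real_vec_def)
    also have "\<dots> \<le> sqrt (B * (to_real_vec x \<bullet> (matrix_inv (covariance_matrix M X) *v to_real_vec x)))"
      by (rule real_le_rsqrt) (rule B)
    also have "\<dots> = sqrt B * walk_norm M X x" by (simp add: walk_norm_def real_sqrt_mult)
    also have "\<dots> \<le> sqrt B * R" using B \<open>walk_norm M X x \<le> R\<close> by (intro mult_left_mono) auto
    finally show "\<bar>real_of_int (x $ i)\<bar> \<le> sqrt B * R" .
  qed
qed

section \<open>Union bounds over the first visit\<close>

lemma local_time_split_first_visit:
  assumes "\<And>i. 1 \<le> i \<Longrightarrow> i < j \<Longrightarrow> walk X i \<omega> \<noteq> z" and j: "1 \<le> j" "j \<le> n"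
  shows "local_time X z n \<omega> = of_bool (walk X j \<omega> = z) + (\<Sum>i=Suc j..n. of_bool (walk X i \<omega> = z))"
proof -
  have "{1..n} = {1..<j} \<union> {j} \<union> {Suc j..n}" using j by auto
  then have "local_time X z n \<omega> = (\<Sum>i\<in>{1..<j} \<union> {j} \<union> {Suc j..n}. of_bool (walk X i \<omega> = z))"
    by (simp only: local_time_def)
  also have "\<dots> = (\<Sum>i\<in>{1..<j}. of_bool (walk X i \<omega> = z)) + of_bool (walk X j \<omega> = z)
      + (\<Sum>i=Suc j..n. of_bool (walk X i \<omega> = z))"
    by (subst sum.union_disjoint, simp, simp, force)+ simp
  also have "(\<Sum>i\<in>{1..<j}. of_bool (walk X i \<omega> = z)) = (0 :: nat)"
    using assms(1) by (intro sum.neutral) auto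
  finally show ?thesis by simp
qed

lemma visits_word_from:
  "visits a (walk X j \<omega> - z) (word j N \<omega>) = (\<Sum>i=Suc j..j + N. of_bool (walk X i \<omega> = z + a))"
proof -
  have "(walk X j \<omega> - z + (walk X i \<omega> - walk X j \<omega>) = a) = (walk X i \<omega> = z + a)" for i
    by (auto simp: algebra_simps)
  then show ?thesis by (simp only: visits_word)
qed

lemma local_time_pos_visit:
  assumes "local_time X z n \<omega> \<ge> 1"
  obtains i where "1 \<le> i" "i \<le> n" "walk X i \<omega> = z"
proof -
  have "\<exists>i\<in>{1..n}. walk X i \<omega> = z"
  proof (rule ccontr)
    assume "\<not> ?thesis"
    then have "local_time X z n \<omega> = 0" unfolding local_time_def by (intro sum.neutral) auto
    then show False using assms by simp
  qed
  then show ?thesis using that by auto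
qed

lemma sum_of_bool_mono:
  "n \<le> m \<Longrightarrow> (\<Sum>i=a..(n::nat). of_bool (P i)) \<le> (\<Sum>i=a..m. of_bool (P i) :: nat)"
  by (rule sum_mono2) auto

definition many_event :: "nat \<Rightarrow> int ^ 'd \<Rightarrow> nat \<Rightarrow> nat \<Rightarrow> 'a set" where
  "many_event N x k l =
     {\<omega>\<in>space M. \<exists>z. local_time X z N \<omega> \<ge> k \<and> local_time X (z + x) N \<omega> \<ge> l}"

text \<open>
  The time \<open>n\<close> ranges over everything up to \<open>N\<close>, so that one event covers a whole block of times: a heavy
  point may reach its number of visits well before the end of the block.
\<close>

definition few_event :: "nat \<Rightarrow> int ^ 'd \<Rightarrow> nat \<Rightarrow> nat \<Rightarrow> 'a set" where
  "few_event N x k l =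
     {\<omega>\<in>space M. \<exists>z n. n \<le> N \<and> local_time X z n \<omega> \<ge> k \<and> local_time X (z + x) n \<omega> \<le> l}"

lemma many_event_sets: "many_event N x k l \<in> sets M"
proof -
  have "many_event N x k l =
    {\<omega>\<in>space M. word 0 N \<omega> \<in> {ws. \<exists>z. visits z 0 ws \<ge> k \<and> visits (z + x) 0 ws \<ge> l}}"
    by (simp add: many_event_def local_time_word)
  then show ?thesis by (simp only: word_sets)
qed

lemma few_event_sets: "few_event N x k l \<in> sets M"
proof -
  have "few_event N x k l =
    {\<omega>\<in>space M. word 0 N \<omega> \<in> {ws. \<exists>z n. n \<le> N \<and> visits z 0 (take n ws) \<ge> k \<and> visits (z + x) 0 (take n ws) \<le> l}}"
    by (simp add: few_event_def local_time_word take_word cong: conj_cong)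
  then show ?thesis by (simp only: word_sets)
qed

text \<open>
  Let \<open>j\<close> be the first time at which the walk meets the pair \<open>{z, z + x}\<close>. Seen from \<open>z\<close> it is then at
  \<open>0\<close> or at \<open>x\<close>, and all but one of the visits to either point take place after time \<open>j\<close>. Stopping at the first visit
  to the pair, not to \<open>z\<close>, avoids counting visits to \<open>z + x\<close> that precede those to \<open>z\<close>.
\<close>

lemma many_event_bound:
  assumes x: "x \<noteq> 0" and \<kappa>: "0 < \<kappa>" "\<kappa> \<le> 1" and k: "k \<ge> 2" and l: "l \<ge> 1"
  shows "measure M (many_event N x k l)
    \<le> 2 * real N * (2 * (green 0)\<^sup>2 / (green 0 - 1) / green x *
       ((1 - 1 / green 0) ^ (k - 1) * exp (\<kappa> / green 0 * (ratio x * real (k - 1) - real (l - 1) / (1 + \<kappa>)))))"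
    (is "_ \<le> 2 * real N * ?b")
proof -
  let ?A = "\<lambda>y. {ws. visits 0 y ws \<ge> k - 1 \<and> visits x y ws \<ge> l - 1}"
  define E where "E j y = {\<omega>\<in>space M. word j N \<omega> \<in> ?A y}" for j y
  have E_sets: "E j y \<in> sets M" for j y unfolding E_def by (rule word_sets)
  have "many_event N x k l \<subseteq> (\<Union>(j, y)\<in>{1..N} \<times> {0, x}. E j y)"
  proof
    fix \<omega> assume "\<omega> \<in> many_event N x k l"
    then obtain z where \<omega>: "\<omega> \<in> space M" and z: "local_time X z N \<omega> \<ge> k" "local_time X (z + x) N \<omega> \<ge> l"
      by (auto simp: many_event_def)
    define j where "j = (LEAST i. 1 \<le> i \<and> walk X i \<omega> \<in> {z, z + x})"
    have "local_time X z N \<omega> \<ge> 1" using z(1) k by linarith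
    then obtain i where i: "1 \<le> i" "i \<le> N" "walk X i \<omega> = z"
      by (rule local_time_pos_visit)
    have j: "1 \<le> j \<and> walk X j \<omega> \<in> {z, z + x}"
      unfolding j_def by (rule LeastI[of _ i]) (use i in auto)
    have "j \<le> i" unfolding j_def by (rule Least_le) (use i in auto)
    then have jN: "j \<le> N" using i by simp
    have before: "walk X i \<omega> \<noteq> z \<and> walk X i \<omega> \<noteq> z + x" if "1 \<le> i" "i < j" for i
      using not_less_Least[OF that(2)[unfolded j_def]] that(1) by auto
    define y where "y = walk X j \<omega> - z"
    have y: "y \<in> {0, x}" using j by (auto simp: y_def)
    have "local_time X z N \<omega> \<le> 1 + visits 0 y (word j N \<omega>)"
    proof -
      have "local_time X z N \<omega> = of_bool (walk X j \<omega> = z) + (\<Sum>i=Suc j..N. of_bool (walk X i \<omega> = z))"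
        by (rule local_time_split_first_visit) (use before j jN in auto)
      also have "\<dots> \<le> 1 + (\<Sum>i=Suc j..j + N. of_bool (walk X i \<omega> = z))"
        by (intro add_mono sum_of_bool_mono) auto
      finally show ?thesis by (simp only: visits_word_from y_def add_0_right)
    qed
    moreover have "local_time X (z + x) N \<omega> \<le> 1 + visits x y (word j N \<omega>)"
    proof -
      have "local_time X (z + x) N \<omega> = of_bool (walk X j \<omega> = z + x) + (\<Sum>i=Suc j..N. of_bool (walk X i \<omega> = z + x))"
        by (rule local_time_split_first_visit) (use before j jN in auto)
      also have "\<dots> \<le> 1 + (\<Sum>i=Suc j..j + N. of_bool (walk X i \<omega> = z + x))"
        by (intro add_mono sum_of_bool_mono) auto
      finally show ?thesis by (simp only: visits_word_from y_def)
    qed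
    ultimately have "\<omega> \<in> E j y" using z \<omega> by (auto simp: E_def)
    then show "\<omega> \<in> (\<Union>(j, y)\<in>{1..N} \<times> {0, x}. E j y)"
      using j jN y by (intro UN_I[of "(j, y)"]) auto
  qed
  then have "measure M (many_event N x k l) \<le> measure M (\<Union>(j, y)\<in>{1..N} \<times> {0, x}. E j y)"
    by (intro finite_measure_mono) (auto intro!: sets.finite_UN E_sets)
  also have "\<dots> \<le> (\<Sum>(j, y)\<in>{1..N} \<times> {0, x}. measure M (E j y))"
    using finite_measure_subadditive_finite[of "{1..N} \<times> {0, x}" "\<lambda>(j, y). E j y"]
    by (auto simp: case_prod_unfold intro!: E_sets)
  also have "\<dots> \<le> (\<Sum>(j, y)\<in>{1..N} \<times> {0, x}. ?b)"
  proof (intro sum_mono, clarify)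
    fix j y
    have "(k - 1, l - 1) \<noteq> (0, 0)" using k by auto
    then show "measure M (E j y) \<le> ?b"
      unfolding E_def measure_word by (rule many_visits_bound[OF x \<kappa>])
  qed
  also have "\<dots> = 2 * real N * ?b" using x by (simp add: card_cartesian_product)
  finally show ?thesis .
qed

text \<open>
  Here only visits to \<open>z + x\<close> after the first visit to \<open>z\<close> matter, since discarding the earlier ones
  makes the event larger.
\<close>

lemma few_event_bound:
  assumes x: "x \<noteq> 0" and \<kappa>: "0 \<le> \<kappa>" "\<kappa> < 1" and k: "k \<ge> 2"
  shows "measure M (few_event N x k l)
    \<le> real N * ((1 - 1 / green 0) ^ (k - 1) * exp (- (\<kappa> / green 0 * (ratio x * real (k - 1) - real l / (1 - \<kappa>)))))"
    (is "_ \<le> real N * ?b")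
proof -
  let ?A = "{ws. \<exists>n. visits 0 0 (take n ws) \<ge> k - 1 \<and> visits x 0 (take n ws) \<le> l}"
  define E where "E j = {\<omega>\<in>space M. word j N \<omega> \<in> ?A}" for j
  have E_sets: "E j \<in> sets M" for j unfolding E_def by (rule word_sets)
  have "few_event N x k l \<subseteq> (\<Union>j\<in>{1..N}. E j)"
  proof
    fix \<omega> assume "\<omega> \<in> few_event N x k l"
    then obtain z n where \<omega>: "\<omega> \<in> space M" and n: "n \<le> N" and
      z: "local_time X z n \<omega> \<ge> k" "local_time X (z + x) n \<omega> \<le> l"
      by (auto simp: few_event_def)
    define j where "j = (LEAST i. 1 \<le> i \<and> walk X i \<omega> = z)"
    have "local_time X z n \<omega> \<ge> 1" using z(1) k by linarith
    then obtain i where i: "1 \<le> i" "i \<le> n" "walk X i \<omega> = z"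
      by (rule local_time_pos_visit)
    have j: "1 \<le> j \<and> walk X j \<omega> = z"
      unfolding j_def by (rule LeastI[of _ i]) (use i in auto)
    have "j \<le> i" unfolding j_def by (rule Least_le) (use i in auto)
    then have jn: "j \<le> n" using i by simp
    have before: "walk X i \<omega> \<noteq> z" if "1 \<le> i" "i < j" for i
      using not_less_Least[OF that(2)[unfolded j_def]] that(1) by auto
    have word: "take (n - j) (word j N \<omega>) = word j (n - j) \<omega>" using n by (intro take_word) auto
    have vis: "visits a 0 (word j (n - j) \<omega>) = (\<Sum>i=Suc j..n. of_bool (walk X i \<omega> = z + a))" for a
      using visits_word_from[of a j \<omega> z "n - j"] j jn by simp
    have "local_time X z n \<omega> = 1 + visits 0 0 (word j (n - j) \<omega>)"
      unfolding vis using local_time_split_first_visit[of j \<omega> z n] before j jn by auto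
    then have "visits 0 0 (take (n - j) (word j N \<omega>)) \<ge> k - 1" using z(1) by (simp add: word)
    moreover have "visits x 0 (word j (n - j) \<omega>) \<le> local_time X (z + x) n \<omega>"
      unfolding vis local_time_def by (rule sum_mono2) auto
    then have "visits x 0 (take (n - j) (word j N \<omega>)) \<le> l" using z(2) by (simp add: word)
    ultimately have "\<omega> \<in> E j" using \<omega> by (auto simp: E_def)
    then show "\<omega> \<in> (\<Union>j\<in>{1..N}. E j)" using j jn n by auto
  qed
  then have "measure M (few_event N x k l) \<le> measure M (\<Union>j\<in>{1..N}. E j)"
    by (intro finite_measure_mono) (auto intro!: sets.finite_UN E_sets)
  also have "\<dots> \<le> (\<Sum>j\<in>{1..N}. measure M (E j))"
    by (rule finite_measure_subadditive_finite) (auto intro!: E_sets)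
  also have "\<dots> \<le> (\<Sum>j\<in>{1..N}. ?b)"
    unfolding E_def measure_word by (intro sum_mono few_visits_bound x \<kappa>) (use k in auto)
  also have "\<dots> = real N * ?b" by simp
  finally show ?thesis .
qed

lemma max_local_time_bound:
  assumes k: "k \<ge> 2"
  shows "measure M {\<omega>\<in>space M. \<exists>z. local_time X z N \<omega> \<ge> k} \<le> real N * (1 - 1 / green 0) ^ (k - 1)"
proof -
  obtain x :: "int ^ 'd" where x: "x \<noteq> 0" using zero_neq_one by metis
  have "{\<omega>\<in>space M. \<exists>z. local_time X z N \<omega> \<ge> k} \<subseteq> few_event N x k N"
  proof
    fix \<omega> assume "\<omega> \<in> {\<omega>\<in>space M. \<exists>z. local_time X z N \<omega> \<ge> k}"
    moreover have "local_time X z N \<omega> \<le> N" for z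
      using visits_le_length[of z 0 "word 0 N \<omega>"] by (simp add: local_time_word)
    ultimately show "\<omega> \<in> few_event N x k N" by (auto simp: few_event_def)
  qed
  then have "measure M {\<omega>\<in>space M. \<exists>z. local_time X z N \<omega> \<ge> k} \<le> measure M (few_event N x k N)"
    by (intro finite_measure_mono few_event_sets)
  also have "\<dots> \<le> real N * (1 - 1 / green 0) ^ (k - 1)"
    using few_event_bound[OF x _ _ k, of 0 N N] by simp
  finally show ?thesis .
qed

end

section \<open>Dyadic times and the Borel-Cantelli argument\<close>

text \<open>
  The growth condition on \<open>r\<close> enters as a comparison of \<open>r (2 n)\<close> with \<open>r n\<close>: the block
  \<open>[2\<^sup>i, 2\<^bsup>i+1\<^esup>)\<close> is treated with the radius at its right end and the threshold at its left end.
\<close>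

locale heavy_setting = lattice_walk M X
  for M :: "'a measure" and X :: "nat \<Rightarrow> 'a \<Rightarrow> int ^ 'd" +
  fixes r \<delta> :: "nat \<Rightarrow> real"
  assumes r_pos: "\<And>n. n \<ge> 1 \<Longrightarrow> r n > 0"
    and \<delta>_pos: "\<And>n. n \<ge> 1 \<Longrightarrow> \<delta> n > 0"
    and \<delta>_antimono: "antimono_on {1..} \<delta>"
    and r_mono: "mono_on {1..} r"
    and r_doubling: "\<exists>C>0. \<forall>n\<ge>1. r (2 * n) \<le> C * r n"
    and \<beta>_limit: "(\<lambda>n. r n ^ (2 * CARD('d) - 4) * (ln (ln (real n)) / ln (real n))) \<longlonglongrightarrow> 0"
    and \<delta>_limit: "(\<lambda>n. \<delta> n * r n ^ (2 * CARD('d) - 4)) \<longlonglongrightarrow> 0"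
begin

abbreviation "lam \<equiv> walk_lambda M X"
abbreviation "esc \<equiv> 1 / green 0"
abbreviation "rad i \<equiv> r (2 ^ Suc i)"

text \<open>
  On the ball of radius \<open>rad i\<close> one has \<open>m\<^sub>x \<ge> h / spread i\<close>.
\<close>

definition spread :: "nat \<Rightarrow> real" where
  "spread i = rad i ^ (2 * CARD('d) - 4)"

text \<open>
  The scale \<open>\<lambda> log n\<close> of the largest local time, at \<open>n = 2\<^sup>i\<close>.
\<close>

definition peak :: "nat \<Rightarrow> real" where
  "peak i = lam * (real i * ln 2)"

definition punctured_ball :: "nat \<Rightarrow> (int ^ 'd) set" where
  "punctured_ball i = {x \<in> walk_ball M X (rad i). x \<noteq> 0}"

lemma rad_pos: "rad i > 0" by (rule r_pos) simp

lemma spread_pos: "spread i > 0" using rad_pos by (simp add: spread_def)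

lemma filterlim_dyadic: "filterlim (\<lambda>i. 2 ^ i :: nat) sequentially sequentially"
  by (rule filterlim_subseq) (simp add: strict_mono_def)

lemma spread_log_limit: "(\<lambda>i. spread i * (ln (real i) / real i)) \<longlonglongrightarrow> 0"
proof -
  have "(\<lambda>i. r (2 ^ Suc i) ^ (2 * CARD('d) - 4) * (ln (ln (real (2 ^ Suc i))) / ln (real (2 ^ Suc i)))) \<longlonglongrightarrow> 0"
    by (rule LIMSEQ_Suc) (rule filterlim_compose[OF \<beta>_limit filterlim_dyadic])
  moreover have "ln (real (2 ^ Suc i)) = real (Suc i) * ln 2" for i
    using ln_realpow[of 2 "Suc i"] by (simp del: power_Suc)
  ultimately have lim: "(\<lambda>i. 4 * (spread i * (ln (real (Suc i) * ln 2) / (real (Suc i) * ln 2)))) \<longlonglongrightarrow> 4 * 0"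
    unfolding spread_def by (intro tendsto_mult tendsto_const) (simp only:)
  \<comment> \<open>\<open>(i + 1) log 2 \<ge> (i + 1) / 2 \<ge> \<surd>i\<close>, so \<open>log i\<close> is at most twice the logarithm of \<open>(i + 1) log 2\<close>\<close>
  have bnd: "ln (real i) / real i \<le> 4 * (ln (real (Suc i) * ln 2) / (real (Suc i) * ln 2))" if i: "i \<ge> 1" for i
  proof -
    define t where "t = real (Suc i) * ln 2"
    have b: "1 / 2 \<le> ln (2::real)" "ln (2::real) \<le> 1"
      using ln2_ge_two_thirds ln_add_one_self_le_self[of 1] by auto
    have t: "t > 0" by (simp add: t_def)
    have "real (Suc i) / 2 \<le> t" unfolding t_def using b mult_left_mono[of "1/2" "ln 2" "real (Suc i)"] by simp
    then have "(real (Suc i) / 2)\<^sup>2 \<le> t\<^sup>2" by (intro power_mono) auto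
    moreover have "real i \<le> (real (Suc i) / 2)\<^sup>2"
    proof -
      have "0 \<le> (real i - 1)\<^sup>2" by simp
      then show ?thesis by (simp add: power2_eq_square field_simps)
    qed
    ultimately have it: "real i \<le> t\<^sup>2" by simp
    have "ln (real i) \<le> ln (t\<^sup>2)" using it i t by (subst ln_le_cancel_iff) auto
    also have "\<dots> = 2 * ln t" using t by (simp add: ln_realpow)
    finally have l: "ln (real i) \<le> 2 * ln t" .
    have "0 \<le> ln (real i)" using i by simp
    then have "0 \<le> ln t" using l by linarith
    then have "1 \<le> t" using t by simp
    have "t \<le> real (Suc i)" unfolding t_def using b mult_left_mono[of "ln 2" 1 "real (Suc i)"] by simp
    also have "\<dots> \<le> 2 * real i" using i by simp
    finally have ti: "t \<le> 2 * real i" .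
    have "ln (real i) / real i \<le> (2 * ln t) / (t / 2)"
      using l ti \<open>1 \<le> t\<close> i by (intro frac_le) auto
    then show ?thesis by (simp add: t_def)
  qed
  show ?thesis
  proof (rule tendsto_sandwich[OF _ _ tendsto_const])
    show "(\<lambda>i. 4 * (spread i * (ln (real (Suc i) * ln 2) / (real (Suc i) * ln 2)))) \<longlonglongrightarrow> 0"
      using lim by simp
    show "\<forall>\<^sub>F i in sequentially. 0 \<le> spread i * (ln (real i) / real i)"
      using eventually_ge_at_top[of 1] by eventually_elim (use spread_pos in \<open>simp add: less_imp_le\<close>)
    show "\<forall>\<^sub>F i in sequentially. spread i * (ln (real i) / real i)
        \<le> 4 * (spread i * (ln (real (Suc i) * ln 2) / (real (Suc i) * ln 2)))"
      using eventually_ge_at_top[of 1]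
    proof eventually_elim
      case (elim i)
      have "spread i * (ln (real i) / real i) \<le> spread i * (4 * (ln (real (Suc i) * ln 2) / (real (Suc i) * ln 2)))"
        by (intro mult_left_mono bnd elim) (use spread_pos[of i] in simp)
      then show ?case by (simp only: mult_ac)
    qed
  qed
qed

lemma spread_le: "\<forall>\<^sub>F i in sequentially. max 1 (spread i) \<le> real i"
proof -
  have "\<forall>\<^sub>F i in sequentially. spread i * (ln (real i) / real i) < 1"
    by (rule order_tendstoD(2)[OF spread_log_limit]) simp
  then show ?thesis using eventually_ge_at_top[of 3]
  proof eventually_elim
    case (elim i)
    have "1 \<le> ln (real i)" using exp_le elim(2) by (subst ln_ge_iff) auto
    then have "spread i \<le> spread i * ln (real i)" using spread_pos[of i] by simp
    also have "\<dots> \<le> real i" using elim by (simp add: field_simps)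
    finally show ?case using elim by simp
  qed
qed

lemma \<delta>_spread_limit: "(\<lambda>i. \<delta> (2 ^ i) * spread i) \<longlonglongrightarrow> 0"
proof -
  let ?e = "2 * CARD('d) - 4"
  obtain C where C: "C > 0" "\<And>n. n \<ge> 1 \<Longrightarrow> r (2 * n) \<le> C * r n" using r_doubling by blast
  have lim: "(\<lambda>i. C ^ ?e * (\<delta> (2 ^ i) * r (2 ^ i) ^ ?e)) \<longlonglongrightarrow> C ^ ?e * 0"
    by (intro tendsto_mult tendsto_const filterlim_compose[OF \<delta>_limit filterlim_dyadic])
  show ?thesis
  proof (rule tendsto_sandwich[OF _ _ tendsto_const])
    show "(\<lambda>i. C ^ ?e * (\<delta> (2 ^ i) * r (2 ^ i) ^ ?e)) \<longlonglongrightarrow> 0" using lim by simp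
    show "\<forall>\<^sub>F i in sequentially. 0 \<le> \<delta> (2 ^ i) * spread i"
      using \<delta>_pos spread_pos by (intro always_eventually allI mult_nonneg_nonneg) (auto simp: less_imp_le)
    show "\<forall>\<^sub>F i in sequentially. \<delta> (2 ^ i) * spread i \<le> C ^ ?e * (\<delta> (2 ^ i) * r (2 ^ i) ^ ?e)"
    proof (intro always_eventually allI)
      fix i
      have "spread i \<le> (C * r (2 ^ i)) ^ ?e"
        unfolding spread_def using C(2)[of "2 ^ i"] rad_pos[of i] by (intro power_mono) auto
      then have "\<delta> (2 ^ i) * spread i \<le> \<delta> (2 ^ i) * (C * r (2 ^ i)) ^ ?e"
        using \<delta>_pos[of "2 ^ i"] by (intro mult_left_mono) auto
      then show "\<delta> (2 ^ i) * spread i \<le> C ^ ?e * (\<delta> (2 ^ i) * r (2 ^ i) ^ ?e)"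
        by (simp add: power_mult_distrib mult_ac)
    qed
  qed
qed

lemma \<delta>_dyadic_limit: "(\<lambda>i. \<delta> (2 ^ i)) \<longlonglongrightarrow> 0"
proof -
  let ?e = "2 * CARD('d) - 4"
  have lim: "(\<lambda>i. \<delta> (2 ^ i) * spread i / r 1 ^ ?e) \<longlonglongrightarrow> 0 / r 1 ^ ?e"
    using r_pos[of 1] by (intro tendsto_divide \<delta>_spread_limit tendsto_const) auto
  show ?thesis
  proof (rule tendsto_sandwich[OF _ _ tendsto_const])
    show "(\<lambda>i. \<delta> (2 ^ i) * spread i / r 1 ^ ?e) \<longlonglongrightarrow> 0" using lim by simp
    show "\<forall>\<^sub>F i in sequentially. 0 \<le> \<delta> (2 ^ i)"
      using \<delta>_pos by (intro always_eventually allI) (auto simp: less_imp_le)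
    show "\<forall>\<^sub>F i in sequentially. \<delta> (2 ^ i) \<le> \<delta> (2 ^ i) * spread i / r 1 ^ ?e"
    proof (intro always_eventually allI)
      fix i
      have "r 1 \<le> rad i" by (rule mono_onD[OF r_mono]) auto
      then have "r 1 ^ ?e \<le> spread i" unfolding spread_def using r_pos[of 1] by (intro power_mono) auto
      then have "\<delta> (2 ^ i) * r 1 ^ ?e \<le> \<delta> (2 ^ i) * spread i"
        using \<delta>_pos[of "2 ^ i"] by (intro mult_left_mono) auto
      then show "\<delta> (2 ^ i) \<le> \<delta> (2 ^ i) * spread i / r 1 ^ ?e"
        using r_pos[of 1] by (simp add: pos_le_divide_eq)
    qed
  qed
qed

lemma ball_card:
  obtains C where "C > 0" "\<forall>\<^sub>F i in sequentially. finite (punctured_ball i) \<and> real (card (punctured_ball i)) \<le> C * real i"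
proof -
  let ?d = "CARD('d)"
  obtain A where A: "A > 0" "\<And>R x i. x \<in> walk_ball M X R \<Longrightarrow> \<bar>real_of_int (x $ i)\<bar> \<le> A * R"
    by (rule walk_ball_bounded) blast
  have sub: "punctured_ball i \<subseteq> lattice_box (nat \<lfloor>A * rad i\<rfloor>)" for i
  proof
    fix x assume "x \<in> punctured_ball i"
    then have "real_of_int \<bar>x $ j\<bar> \<le> A * rad i" for j using A(2)[of x "rad i" j] by (simp add: punctured_ball_def)
    then have "\<bar>x $ j\<bar> \<le> \<lfloor>A * rad i\<rfloor>" for j by (simp add: le_floor_iff)
    then show "x \<in> lattice_box (nat \<lfloor>A * rad i\<rfloor>)" using A(1) rad_pos[of i] by (simp add: lattice_box_def)
  qed
  have card: "real (card (punctured_ball i)) \<le> (2 * A + 1) ^ ?d * max 1 (spread i)" for i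
  proof -
    let ?m = "max 1 (rad i)"
    have m: "?m \<ge> 1" "?m \<ge> rad i" by auto
    have "real (card (punctured_ball i)) \<le> real (card (lattice_box (nat \<lfloor>A * rad i\<rfloor>) :: (int ^ 'd) set))"
      by (intro of_nat_mono card_mono sub) auto
    also have "\<dots> = (2 * real (nat \<lfloor>A * rad i\<rfloor>) + 1) ^ ?d" by (simp add: card_box add.commute)
    also have "\<dots> \<le> ((2 * A + 1) * ?m) ^ ?d"
    proof (intro power_mono)
      have "real (nat \<lfloor>A * rad i\<rfloor>) \<le> A * rad i" using A(1) rad_pos[of i] by simp
      also have "\<dots> \<le> A * ?m" using A(1) by (intro mult_left_mono) auto
      finally show "2 * real (nat \<lfloor>A * rad i\<rfloor>) + 1 \<le> (2 * A + 1) * ?m"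
        using m(1) unfolding distrib_right mult_1_left by linarith
    qed auto
    also have "\<dots> = (2 * A + 1) ^ ?d * ?m ^ ?d" by (simp add: power_mult_distrib)
    also have "?m ^ ?d \<le> ?m ^ (2 * ?d - 4)" using dim5 by (intro power_increasing) auto
    also have "?m ^ (2 * ?d - 4) = max 1 (spread i)"
    proof (cases "rad i \<le> 1")
      case True
      then have "spread i \<le> 1" unfolding spread_def using rad_pos[of i] by (intro power_le_one) auto
      then show ?thesis using True by simp
    next
      case False
      then have "1 \<le> spread i" unfolding spread_def by (intro one_le_power) simp
      then show ?thesis using False by (simp add: spread_def)
    qed
    finally show ?thesis using A(1) by (simp add: mult_left_mono)
  qed
  show ?thesis
  proof (rule that)
    show "(2 * A + 1) ^ ?d > 0" using A(1) by simp
    show "\<forall>\<^sub>F i in sequentially. finite (punctured_ball i) \<and> real (card (punctured_ball i)) \<le> (2 * A + 1) ^ ?d * real i"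
      using spread_le
    proof eventually_elim
      case (elim i)
      have "finite (punctured_ball i)" by (rule finite_subset[OF sub]) simp
      moreover have "(2 * A + 1) ^ ?d * max 1 (spread i) \<le> (2 * A + 1) ^ ?d * real i"
        using elim A(1) by (intro mult_left_mono) auto
      ultimately show ?case using card[of i] by simp
    qed
  qed
qed

lemma green_on_ball:
  obtains g where "g > 0" "\<And>i x. x \<in> punctured_ball i \<Longrightarrow> green x \<ge> g / rad i ^ (CARD('d) - 2)"
proof -
  let ?d = "CARD('d)"
  obtain A where A: "A > 0" "\<And>R x i. x \<in> walk_ball M X R \<Longrightarrow> \<bar>real_of_int (x $ i)\<bar> \<le> A * R"
    by (rule walk_ball_bounded) blast
  obtain c where c: "c > 0" "\<And>x. x \<noteq> 0 \<Longrightarrow> green x \<ge> c / real (l1 x) ^ (?d - 2)"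
    by (rule green_lower) blast
  show ?thesis
  proof (rule that)
    show "c / (?d * A) ^ (?d - 2) > 0" using c A by simp
    fix i x assume x: "x \<in> punctured_ball i"
    then have x0: "x \<noteq> 0" by (simp add: punctured_ball_def)
    have "real (l1 x) = (\<Sum>j\<in>UNIV. \<bar>real_of_int (x $ j)\<bar>)" by (simp add: l1_def)
    also have "\<dots> \<le> (\<Sum>j\<in>(UNIV :: 'd set). A * rad i)"
      by (intro sum_mono A(2)) (use x in \<open>simp add: punctured_ball_def\<close>)
    finally have l: "real (l1 x) \<le> ?d * A * rad i" by simp
    have "c / (?d * A) ^ (?d - 2) / rad i ^ (?d - 2) = c / (?d * A * rad i) ^ (?d - 2)"
      by (simp add: power_mult_distrib)
    also have "\<dots> \<le> c / real (l1 x) ^ (?d - 2)"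
      using c(1) l l1_pos[OF x0] A(1) rad_pos[of i] by (intro divide_left_mono power_mono mult_pos_pos zero_less_power) auto
    also have "\<dots> \<le> green x" by (rule c(2)[OF x0])
    finally show "green x \<ge> c / (?d * A) ^ (?d - 2) / rad i ^ (?d - 2)" .
  qed
qed

lemma inverse_green_on_ball:
  obtains D where "D > 0" "\<forall>\<^sub>F i in sequentially. \<forall>x\<in>punctured_ball i. 1 / green x \<le> D * real i"
proof -
  obtain g where g: "g > 0" "\<And>i x. x \<in> punctured_ball i \<Longrightarrow> green x \<ge> g / rad i ^ (CARD('d) - 2)"
    by (rule green_on_ball) blast
  show ?thesis
  proof (rule that)
    show "1 / g > 0" using g by simp
    show "\<forall>\<^sub>F i in sequentially. \<forall>x\<in>punctured_ball i. 1 / green x \<le> 1 / g * real i"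
      using spread_le
    proof eventually_elim
      case (elim i)
      have "rad i ^ (CARD('d) - 2) \<le> real i"
      proof (cases "rad i \<le> 1")
        case True
        then have "rad i ^ (CARD('d) - 2) \<le> 1" using rad_pos[of i] by (intro power_le_one) auto
        then show ?thesis using elim by simp
      next
        case False
        then have "rad i ^ (CARD('d) - 2) \<le> spread i" unfolding spread_def by (intro power_increasing) auto
        then show ?thesis using elim by simp
      qed
      moreover have "1 / green x \<le> 1 / g * rad i ^ (CARD('d) - 2)" if "x \<in> punctured_ball i" for x
        using g(2)[OF that] g(1) green_pos[of x] rad_pos[of i] by (simp add: field_simps)
      ultimately show ?case using g(1)
        by (meson divide_nonneg_pos less_imp_le mult_left_mono order_trans zero_le_one)
    qed
  qed
qed

lemma ratio_on_ball:
  obtains h where "h > 0" "\<And>i x. x \<in> punctured_ball i \<Longrightarrow> ratio x \<ge> h / spread i"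
proof -
  obtain g where g: "g > 0" "\<And>i x. x \<in> punctured_ball i \<Longrightarrow> green x \<ge> g / rad i ^ (CARD('d) - 2)"
    by (rule green_on_ball) blast
  have G: "green 0 > 0" "1 - esc > 0" using escape_bounds green_pos by auto
  show ?thesis
  proof (rule that)
    show "(g / green 0)\<^sup>2 / (1 - esc) > 0" using g G by simp
    fix i x assume x: "x \<in> punctured_ball i"
    have e: "spread i = (rad i ^ (CARD('d) - 2))\<^sup>2"
      unfolding spread_def power_mult[symmetric] using dim5 by (intro arg_cong[where f = "power _"]) simp
    have "(g / green 0)\<^sup>2 / (1 - esc) / spread i = (g / rad i ^ (CARD('d) - 2) / green 0)\<^sup>2 / (1 - esc)"
      unfolding e by (simp add: power_divide power_mult_distrib mult_ac)
    also have "\<dots> \<le> (green x / green 0)\<^sup>2 / (1 - esc)"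
      using g(2)[OF x] g(1) G rad_pos[of i] by (intro divide_right_mono power_mono) auto
    finally show "(g / green 0)\<^sup>2 / (1 - esc) / spread i \<le> ratio x" by (simp add: ratio_def)
  qed
qed

text \<open>
  Here both limit hypotheses act: the one on \<open>\<delta>\<close> makes \<open>C \<delta>\<close> at most half of \<open>c m\<^sub>x\<close>, the one on \<open>\<beta>\<close> makes the
  remaining exponent at least \<open>4 log i\<close>.
\<close>

lemma exponential_decay_on_ball:
  assumes "c > 0" "C > 0"
  shows "\<forall>\<^sub>F i in sequentially. \<forall>x\<in>punctured_ball i.
    exp (real i * ln 2 * (C * \<delta> (2 ^ i) - c * ratio x)) \<le> 1 / real i ^ 4"
proof -
  obtain h where h: "h > 0" "\<And>i x. x \<in> punctured_ball i \<Longrightarrow> ratio x \<ge> h / spread i"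
    by (rule ratio_on_ball) blast
  have "\<forall>\<^sub>F i in sequentially. \<delta> (2 ^ i) * spread i < c * h / (2 * C)"
    by (rule order_tendstoD(2)[OF \<delta>_spread_limit]) (use assms h in simp)
  moreover have "\<forall>\<^sub>F i in sequentially. spread i * (ln (real i) / real i) < ln 2 * c * h / 8"
    by (rule order_tendstoD(2)[OF spread_log_limit]) (use assms h in simp)
  ultimately show ?thesis using eventually_ge_at_top[of 1]
  proof eventually_elim
    case (elim i)
    show ?case
    proof
      fix x assume x: "x \<in> punctured_ball i"
      have S: "spread i > 0" by (rule spread_pos)
      have "C * \<delta> (2 ^ i) \<le> c * h / 2 / spread i"
        using elim(1) assms S by (simp add: field_simps)
      moreover have "c * h / spread i \<le> c * ratio x"
        using mult_left_mono[OF h(2)[OF x], of c] assms by simp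
      ultimately have "C * \<delta> (2 ^ i) - c * ratio x \<le> - (c * h / 2 / spread i)"
        by (simp add: field_simps)
      then have "real i * ln 2 * (C * \<delta> (2 ^ i) - c * ratio x) \<le> real i * ln 2 * (- (c * h / 2 / spread i))"
        by (intro mult_left_mono) auto
      also have "\<dots> \<le> - (4 * ln (real i))"
        using elim(2,3) S by (simp add: field_simps)
      finally have "exp (real i * ln 2 * (C * \<delta> (2 ^ i) - c * ratio x)) \<le> exp (- (4 * ln (real i)))"
        by simp
      also have "\<dots> = 1 / real i ^ 4"
        using elim(3) exp_of_nat_mult[of 4 "ln (real i)"] by (simp add: exp_minus field_simps)
      finally show "exp (real i * ln 2 * (C * \<delta> (2 ^ i) - c * ratio x)) \<le> 1 / real i ^ 4" .
    qed
  qed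
qed

definition heavy_count :: "nat \<Rightarrow> nat" where
  "heavy_count i = nat \<lceil>(1 - \<delta> (2 ^ i)) * peak i\<rceil>"

definition upper_count :: "real \<Rightarrow> nat \<Rightarrow> int ^ 'd \<Rightarrow> nat" where
  "upper_count \<epsilon> i x = nat \<lceil>(1 + \<epsilon>) * ratio x * peak i\<rceil>"

definition lower_count :: "real \<Rightarrow> nat \<Rightarrow> int ^ 'd \<Rightarrow> nat" where
  "lower_count \<epsilon> i x = nat \<lfloor>(1 - \<epsilon>) * ratio x * peak i\<rfloor>"

definition excess_event :: "real \<Rightarrow> nat \<Rightarrow> int ^ 'd \<Rightarrow> 'a set" where
  "excess_event \<epsilon> i x = many_event (2 ^ Suc i) x (heavy_count i) (upper_count \<epsilon> i x)"

definition deficit_event :: "real \<Rightarrow> nat \<Rightarrow> int ^ 'd \<Rightarrow> 'a set" where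
  "deficit_event \<epsilon> i x = few_event (2 ^ Suc i) x (heavy_count i) (lower_count \<epsilon> i x)"

lemma deviation_sets: "excess_event \<epsilon> i x \<in> sets M" "deficit_event \<epsilon> i x \<in> sets M"
  by (auto simp: excess_event_def deficit_event_def many_event_sets few_event_sets)

definition top_count :: "real \<Rightarrow> nat \<Rightarrow> nat" where
  "top_count \<epsilon> i = nat \<lceil>(1 + \<epsilon>) * peak i\<rceil>"

lemma peak_at_top: "filterlim peak at_top sequentially"
proof -
  have "filterlim (\<lambda>i. (lam * ln 2) * real i) at_top sequentially"
    using walk_lambda_pos
    by (intro filterlim_tendsto_pos_mult_at_top[OF tendsto_const] filterlim_real_sequentially) auto
  then show ?thesis by (simp add: peak_def[abs_def] mult_ac)
qed

lemma heavy_count_large: "\<forall>\<^sub>F i in sequentially. heavy_count i \<ge> 2 \<and> \<delta> (2 ^ i) \<le> 1 / 2 \<and> peak i > 0"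
proof -
  have "\<forall>\<^sub>F i in sequentially. \<delta> (2 ^ i) < 1 / 2"
    by (rule order_tendstoD(2)[OF \<delta>_dyadic_limit]) simp
  moreover have "\<forall>\<^sub>F i in sequentially. peak i \<ge> 4"
    using peak_at_top by (simp add: filterlim_at_top)
  ultimately show ?thesis
  proof eventually_elim
    case (elim i)
    have "2 \<le> (1 / 2) * peak i" using elim by simp
    also have "\<dots> \<le> (1 - \<delta> (2 ^ i)) * peak i" using elim by (intro mult_right_mono) auto
    also have "\<dots> \<le> real (heavy_count i)" unfolding heavy_count_def by (rule real_nat_ceiling_ge)
    finally show ?case using elim by simp
  qed
qed

lemma heavy_count_bounds:
  assumes "heavy_count i \<ge> 2" "peak i > 0"
  shows "real (heavy_count i - 1) \<le> peak i" "real (heavy_count i - 1) \<ge> (1 - \<delta> (2 ^ i)) * peak i - 1"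
proof -
  have pos: "(1 - \<delta> (2 ^ i)) * peak i > 0"
  proof (rule ccontr)
    assume "\<not> ?thesis"
    then have "heavy_count i = 0" by (simp add: heavy_count_def)
    then show False using assms by simp
  qed
  have k: "real (heavy_count i - 1) = real (heavy_count i) - 1" using assms by simp
  have "real (heavy_count i) = of_int \<lceil>(1 - \<delta> (2 ^ i)) * peak i\<rceil>" using pos by (simp add: heavy_count_def)
  then have b: "real (heavy_count i) < (1 - \<delta> (2 ^ i)) * peak i + 1" "real (heavy_count i) \<ge> (1 - \<delta> (2 ^ i)) * peak i"
    by linarith+
  have "(1 - \<delta> (2 ^ i)) * peak i \<le> peak i"
    using \<delta>_pos[of "2 ^ i"] assms by (simp add: algebra_simps)
  then show "real (heavy_count i - 1) \<le> peak i" "real (heavy_count i - 1) \<ge> (1 - \<delta> (2 ^ i)) * peak i - 1"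
    using b k by linarith+
qed

lemma heavy_count_cost:
  assumes "heavy_count i \<ge> 2" "peak i > 0"
  shows "- real (heavy_count i - 1) / lam \<le> 1 / lam - (1 - \<delta> (2 ^ i)) * (real i * ln 2)"
proof -
  have "- real (heavy_count i - 1) / lam \<le> - ((1 - \<delta> (2 ^ i)) * peak i - 1) / lam"
    using heavy_count_bounds(2)[OF assms] walk_lambda_pos by (intro divide_right_mono) auto
  also have "\<dots> = 1 / lam - (1 - \<delta> (2 ^ i)) * (real i * ln 2)"
    using walk_lambda_pos by (simp add: peak_def field_simps)
  finally show ?thesis .
qed

lemma two_power_exp: "2 ^ i = exp (real i * ln 2)"
  by (simp add: exp_of_nat_mult)

text \<open>
  With \<open>\<kappa> = \<epsilon> / 2\<close> the exponent of the deviation is negative: \<open>1 - (1 + \<epsilon>) / (1 + \<kappa>) < 0\<close>. The exponents of the factor \<open>2\<^sup>i\<close> of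
  the union bound and of the cost of the returns cancel up to \<open>i log 2\<close> times \<open>\<delta>\<close>.
\<close>

lemma excess_event_small:
  assumes \<epsilon>: "0 < \<epsilon>" "\<epsilon> < 1"
  obtains D where "D > 0" "\<forall>\<^sub>F i in sequentially. \<forall>x\<in>punctured_ball i.
    measure M (excess_event \<epsilon> i x) \<le> D / real i ^ 3"
proof -
  define \<kappa> where "\<kappa> = \<epsilon> / 2"
  have \<kappa>: "0 < \<kappa>" "\<kappa> < 1" "\<kappa> < \<epsilon>" using \<epsilon> by (auto simp: \<kappa>_def)
  define c where "c = \<kappa> * esc * lam * ((\<epsilon> - \<kappa>) / (1 + \<kappa>))"
  have lam: "lam > 0" by (rule walk_lambda_pos)
  have esc: "esc > 0" using escape_bounds by simp
  have c: "c > 0" unfolding c_def using \<kappa> esc lam by (intro mult_pos_pos divide_pos_pos) auto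
  define C0 where "C0 = 2 * (green 0)\<^sup>2 / (green 0 - 1)"
  have C0: "C0 > 0" using green_0_gt_1 by (simp add: C0_def)
  obtain D where D: "D > 0" "\<forall>\<^sub>F i in sequentially. \<forall>x\<in>punctured_ball i. 1 / green x \<le> D * real i"
    by (rule inverse_green_on_ball) blast
  define E where "E = exp (1 / lam + \<kappa> * esc / (1 + \<kappa>))"
  show ?thesis
  proof (rule that)
    show "4 * C0 * D * E > 0" using C0 D by (simp add: E_def)
    show "\<forall>\<^sub>F i in sequentially. \<forall>x\<in>punctured_ball i.
      measure M (excess_event \<epsilon> i x) \<le> 4 * C0 * D * E / real i ^ 3"
      using exponential_decay_on_ball[OF c zero_less_one] heavy_count_large D(2) eventually_ge_at_top[of 1]
    proof eventually_elim
      case (elim i)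
      show ?case
      proof
        fix x assume x: "x \<in> punctured_ball i"
        then have x0: "x \<noteq> 0" by (simp add: punctured_ball_def)
        define k where "k = heavy_count i"
        define l where "l = upper_count \<epsilon> i x"
        define T where "T = peak i"
        define m where "m = ratio x"
        have k2: "k \<ge> 2" and T: "T > 0" using elim(2) by (auto simp: k_def T_def)
        have k: "real (k - 1) \<le> T" "real (k - 1) \<ge> (1 - \<delta> (2 ^ i)) * T - 1"
          unfolding k_def T_def by (rule heavy_count_bounds; use elim(2) in simp)+
        have m: "m > 0" unfolding m_def by (rule ratio_pos)
        have l: "real l \<ge> (1 + \<epsilon>) * m * T"
          unfolding l_def upper_count_def T_def m_def by (rule real_nat_ceiling_ge)
        have "(1 + \<epsilon>) * m * T > 0" using \<epsilon> m T by simp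
        then have l1: "l \<ge> 1" using l by (cases l) auto
        have l': "real (l - 1) \<ge> (1 + \<epsilon>) * m * T - 1" using l l1 by simp
        have Tl: "T / lam = real i * ln 2" using lam by (simp add: T_def peak_def)
        have "measure M (many_event (2 ^ Suc i) x k l)
          \<le> 2 * real (2 ^ Suc i) * (C0 / green x *
             ((1 - esc) ^ (k - 1) * exp (\<kappa> / green 0 * (ratio x * real (k - 1) - real (l - 1) / (1 + \<kappa>)))))"
          unfolding C0_def by (rule many_event_bound[OF x0]) (use \<kappa> k2 l1 in auto)
        also have "\<dots> = 4 * C0 * (1 / green x) * (exp (real i * ln 2) * exp (- real (k - 1) / lam) *
             exp (\<kappa> * esc * (m * real (k - 1) - real (l - 1) / (1 + \<kappa>))))"
          unfolding return_power two_power_exp[symmetric] m_def by simp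
        also have "\<dots> \<le> 4 * C0 * (D * real i) * (E * exp (real i * ln 2 * (1 * \<delta> (2 ^ i) - c * ratio x)))"
        proof (rule mult_mono)
          show "4 * C0 * (1 / green x) \<le> 4 * C0 * (D * real i)"
            by (rule mult_left_mono) (use elim(3) x C0 in auto)
          have e1: "- real (k - 1) / lam \<le> 1 / lam - (1 - \<delta> (2 ^ i)) * (real i * ln 2)"
            unfolding k_def by (rule heavy_count_cost) (use elim(2) in auto)
          have "m * real (k - 1) - real (l - 1) / (1 + \<kappa>) \<le> m * T - ((1 + \<epsilon>) * m * T - 1) / (1 + \<kappa>)"
            using k(1) m l' \<kappa> by (intro diff_mono mult_left_mono divide_right_mono) auto
          also have "\<dots> = 1 / (1 + \<kappa>) - (\<epsilon> - \<kappa>) / (1 + \<kappa>) * m * T"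
          proof -
            have "1 + \<kappa> \<noteq> 0" using \<kappa> by simp
            then show ?thesis by (simp add: field_simps)
          qed
          finally have "\<kappa> * esc * (m * real (k - 1) - real (l - 1) / (1 + \<kappa>))
            \<le> \<kappa> * esc * (1 / (1 + \<kappa>) - (\<epsilon> - \<kappa>) / (1 + \<kappa>) * m * T)"
            using \<kappa> esc by (intro mult_left_mono) auto
          also have "\<dots> = \<kappa> * esc / (1 + \<kappa>) - c * m * (real i * ln 2)"
          proof -
            have "a * (1 / b - q * m * T) = a / b - a * lam * q * m * (T / lam)" for a b q :: real
              using lam by (simp add: field_simps)
            then show ?thesis unfolding Tl[symmetric] c_def .
          qed
          finally have e2: "\<kappa> * esc * (m * real (k - 1) - real (l - 1) / (1 + \<kappa>))
            \<le> \<kappa> * esc / (1 + \<kappa>) - c * m * (real i * ln 2)" .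
          have "real i * ln 2 + (- real (k - 1) / lam) + \<kappa> * esc * (m * real (k - 1) - real (l - 1) / (1 + \<kappa>))
             \<le> (1 / lam + \<kappa> * esc / (1 + \<kappa>)) + real i * ln 2 * (1 * \<delta> (2 ^ i) - c * ratio x)"
            using e1 e2 by (simp add: m_def algebra_simps)
          then show "exp (real i * ln 2) * exp (- real (k - 1) / lam) *
             exp (\<kappa> * esc * (m * real (k - 1) - real (l - 1) / (1 + \<kappa>)))
            \<le> E * exp (real i * ln 2 * (1 * \<delta> (2 ^ i) - c * ratio x))"
            unfolding E_def exp_add[symmetric] by (subst exp_le_cancel_iff)
        qed (use C0 D in auto)
        also have "\<dots> \<le> 4 * C0 * (D * real i) * (E * (1 / real i ^ 4))"
          using elim(1) x C0 D by (intro mult_left_mono) (auto simp: E_def)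
        also have "\<dots> = 4 * C0 * D * E / real i ^ 3"
          using elim(4) by (simp add: field_simps power_numeral_reduce)
        finally show "measure M (excess_event \<epsilon> i x) \<le> 4 * C0 * D * E / real i ^ 3"
          by (simp add: excess_event_def k_def l_def)
      qed
    qed
  qed
qed

text \<open>
  As for too many visits, with \<open>1 - (1 - \<epsilon>) / (1 - \<kappa>) > 0\<close>. The gain is computed from a number of
  returns that is smaller by the factor \<open>1 - \<delta>\<close>, which adds a further multiple of \<open>\<delta>\<close> to the exponent.
\<close>

lemma deficit_event_small:
  assumes \<epsilon>: "0 < \<epsilon>" "\<epsilon> < 1"
  obtains D where "D > 0" "\<forall>\<^sub>F i in sequentially. \<forall>x\<in>punctured_ball i.
    measure M (deficit_event \<epsilon> i x) \<le> D / real i ^ 3"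
proof -
  define \<kappa> where "\<kappa> = \<epsilon> / 2"
  have \<kappa>: "0 < \<kappa>" "\<kappa> < 1" "\<kappa> < \<epsilon>" using \<epsilon> by (auto simp: \<kappa>_def)
  define c where "c = \<kappa> * esc * lam * ((\<epsilon> - \<kappa>) / (1 - \<kappa>))"
  have lam: "lam > 0" by (rule walk_lambda_pos)
  have esc: "esc > 0" using escape_bounds by simp
  have c: "c > 0" unfolding c_def using \<kappa> esc lam by (intro mult_pos_pos divide_pos_pos) auto
  define C where "C = 1 + \<kappa> * esc * lam"
  have C: "C > 0" unfolding C_def using \<kappa> esc lam by (intro add_pos_pos mult_pos_pos) auto
  define E where "E = exp (1 / lam + \<kappa> * esc)"
  show ?thesis
  proof (rule that)
    show "2 * E > 0" by (simp add: E_def)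
    show "\<forall>\<^sub>F i in sequentially. \<forall>x\<in>punctured_ball i.
      measure M (deficit_event \<epsilon> i x) \<le> 2 * E / real i ^ 3"
      using exponential_decay_on_ball[OF c C] heavy_count_large eventually_ge_at_top[of 1]
    proof eventually_elim
      case (elim i)
      show ?case
      proof
        fix x assume x: "x \<in> punctured_ball i"
        then have x0: "x \<noteq> 0" by (simp add: punctured_ball_def)
        define k where "k = heavy_count i"
        define l where "l = lower_count \<epsilon> i x"
        define T where "T = peak i"
        define m where "m = ratio x"
        have k2: "k \<ge> 2" and T: "T > 0" using elim(2) by (auto simp: k_def T_def)
        have k: "real (k - 1) \<le> T" "real (k - 1) \<ge> (1 - \<delta> (2 ^ i)) * T - 1"
          unfolding k_def T_def by (rule heavy_count_bounds; use elim(2) in simp)+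
        have m: "m > 0" "m \<le> 1" unfolding m_def using ratio_pos ratio_le_1[OF x0] by auto
        have \<delta>0: "\<delta> (2 ^ i) > 0" by (rule \<delta>_pos) simp
        have nn: "(1 - \<epsilon>) * m * T \<ge> 0" using \<epsilon> m T by simp
        then have l: "real l \<le> (1 - \<epsilon>) * m * T"
          unfolding l_def lower_count_def T_def m_def by (rule of_nat_floor)
        have Tl: "T / lam = real i * ln 2" using lam by (simp add: T_def peak_def)
        have "measure M (few_event (2 ^ Suc i) x k l)
          \<le> real (2 ^ Suc i) * ((1 - esc) ^ (k - 1) * exp (- (\<kappa> / green 0 * (ratio x * real (k - 1) - real l / (1 - \<kappa>)))))"
          by (rule few_event_bound[OF x0]) (use \<kappa> k2 in auto)
        also have "\<dots> = 2 * (exp (real i * ln 2) * exp (- real (k - 1) / lam) *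
             exp (\<kappa> * esc * (real l / (1 - \<kappa>) - m * real (k - 1))))"
          unfolding return_power two_power_exp[symmetric] m_def by (simp add: algebra_simps)
        also have "\<dots> \<le> 2 * (E * exp (real i * ln 2 * (C * \<delta> (2 ^ i) - c * ratio x)))"
        proof (intro mult_left_mono)
          have e1: "- real (k - 1) / lam \<le> 1 / lam - (1 - \<delta> (2 ^ i)) * (real i * ln 2)"
            unfolding k_def by (rule heavy_count_cost) (use elim(2) in auto)
          have "real l / (1 - \<kappa>) - m * real (k - 1) \<le> (1 - \<epsilon>) * m * T / (1 - \<kappa>) - m * ((1 - \<delta> (2 ^ i)) * T - 1)"
            using k(2) m l \<kappa> by (intro diff_mono mult_left_mono divide_right_mono) auto
          also have "\<dots> = m * (1 + \<delta> (2 ^ i) * T) - (\<epsilon> - \<kappa>) / (1 - \<kappa>) * m * T"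
          proof -
            have "1 - \<kappa> \<noteq> 0" using \<kappa> by simp
            then show ?thesis by (simp add: field_simps)
          qed
          also have "m * (1 + \<delta> (2 ^ i) * T) \<le> 1 * (1 + \<delta> (2 ^ i) * T)"
            using m T \<delta>0 by (intro mult_right_mono) auto
          finally have "\<kappa> * esc * (real l / (1 - \<kappa>) - m * real (k - 1))
            \<le> \<kappa> * esc * (1 * (1 + \<delta> (2 ^ i) * T) - (\<epsilon> - \<kappa>) / (1 - \<kappa>) * m * T)"
            using \<kappa> esc by (intro mult_left_mono) auto
          also have "\<dots> = \<kappa> * esc + \<kappa> * esc * lam * \<delta> (2 ^ i) * (real i * ln 2) - c * m * (real i * ln 2)"
          proof -
            have "a * (1 * (1 + d * T) - q * m * T) = a + a * lam * d * (T / lam) - a * lam * q * m * (T / lam)"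
              for a d q :: real using lam by (simp add: field_simps)
            then show ?thesis unfolding Tl[symmetric] c_def .
          qed
          finally have e2: "\<kappa> * esc * (real l / (1 - \<kappa>) - m * real (k - 1))
            \<le> \<kappa> * esc + \<kappa> * esc * lam * \<delta> (2 ^ i) * (real i * ln 2) - c * m * (real i * ln 2)" .
          have "real i * ln 2 + (- real (k - 1) / lam) + \<kappa> * esc * (real l / (1 - \<kappa>) - m * real (k - 1))
             \<le> (1 / lam + \<kappa> * esc) + real i * ln 2 * (C * \<delta> (2 ^ i) - c * ratio x)"
            using e1 e2 by (simp add: m_def C_def algebra_simps)
          then show "exp (real i * ln 2) * exp (- real (k - 1) / lam) *
             exp (\<kappa> * esc * (real l / (1 - \<kappa>) - m * real (k - 1)))
            \<le> E * exp (real i * ln 2 * (C * \<delta> (2 ^ i) - c * ratio x))"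
            unfolding E_def exp_add[symmetric] by (subst exp_le_cancel_iff)
        qed auto
        also have "\<dots> \<le> 2 * (E * (1 / real i ^ 4))"
          using elim(1) x by (intro mult_left_mono) (auto simp: E_def)
        also have "\<dots> \<le> 2 * (E * (1 / real i ^ 3))"
          using elim(3) by (intro mult_left_mono divide_left_mono power_increasing) (auto simp: E_def)
        also have "\<dots> = 2 * E / real i ^ 3" by simp
        finally show "measure M (deficit_event \<epsilon> i x) \<le> 2 * E / real i ^ 3"
          by (simp add: deficit_event_def k_def l_def)
      qed
    qed
  qed
qed

definition top_event :: "real \<Rightarrow> nat \<Rightarrow> 'a set" where
  "top_event \<epsilon> i = {\<omega>\<in>space M. \<exists>z. local_time X z (2 ^ Suc i) \<omega> \<ge> top_count \<epsilon> i}"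

lemma top_event_sets: "top_event \<epsilon> i \<in> sets M"
proof -
  have "top_event \<epsilon> i = {\<omega>\<in>space M. word 0 (2 ^ Suc i) \<omega> \<in> {ws. \<exists>z. visits z 0 ws \<ge> top_count \<epsilon> i}}"
    by (simp add: top_event_def local_time_word)
  then show ?thesis by (simp only: word_sets)
qed

text \<open>
  For \<open>x = 0\<close> the upper estimate is the bound on the largest local time: \<open>2\<^bsup>i+1\<^esup>\<close> starting times against
  \<open>(1 + \<epsilon>) \<lambda> log 2\<^sup>i\<close> returns.
\<close>

lemma top_event_small:
  assumes \<epsilon>: "0 < \<epsilon>"
  shows "\<forall>\<^sub>F i in sequentially. measure M (top_event \<epsilon> i) \<le> 2 * exp (1 / lam) * exp (- \<epsilon> * ln 2) ^ i"
proof -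
  have lam: "lam > 0" by (rule walk_lambda_pos)
  have "\<forall>\<^sub>F i in sequentially. peak i \<ge> 2"
    using peak_at_top by (simp add: filterlim_at_top)
  then show ?thesis
  proof eventually_elim
    case (elim i)
    define k where "k = top_count \<epsilon> i"
    have k: "real k \<ge> (1 + \<epsilon>) * peak i" unfolding k_def top_count_def by (rule real_nat_ceiling_ge)
    have "2 \<le> (1 + \<epsilon>) * peak i" using elim \<epsilon> mult_mono[of 1 "1 + \<epsilon>" 2 "peak i"] by simp
    then have k2: "k \<ge> 2" using k by linarith
    have "measure M (top_event \<epsilon> i) \<le> real (2 ^ Suc i) * (1 - esc) ^ (k - 1)"
      unfolding top_event_def k_def[symmetric] by (rule max_local_time_bound[OF k2])
    also have "\<dots> = 2 * (exp (real i * ln 2) * exp (- real (k - 1) / lam))"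
      unfolding return_power two_power_exp[symmetric] by simp
    also have "exp (real i * ln 2) * exp (- real (k - 1) / lam) \<le> exp (1 / lam + real i * (- \<epsilon> * ln 2))"
    proof -
      have "- real (k - 1) / lam \<le> - ((1 + \<epsilon>) * peak i - 1) / lam"
        using k k2 lam by (intro divide_right_mono) auto
      also have "\<dots> = 1 / lam - (1 + \<epsilon>) * (real i * ln 2)"
        using lam by (simp add: peak_def field_simps)
      finally show ?thesis unfolding exp_add[symmetric] by (simp add: algebra_simps)
    qed
    also have "\<dots> = exp (1 / lam) * exp (- \<epsilon> * ln 2) ^ i"
      by (simp only: exp_add exp_of_nat_mult)
    finally show ?case by simp
  qed
qed

definition bad_event :: "real \<Rightarrow> nat \<Rightarrow> 'a set" where
  "bad_event \<epsilon> i = top_event \<epsilon> i \<union> (\<Union>x\<in>punctured_ball i.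
      excess_event \<epsilon> i x \<union>
      deficit_event \<epsilon> i x)"

lemma bad_event_sets: "bad_event \<epsilon> i \<in> sets M"
  unfolding bad_event_def
  by (intro sets.Un top_event_sets sets.countable_UN'' deviation_sets) simp

lemma summable_bad_event:
  assumes \<epsilon>: "0 < \<epsilon>" "\<epsilon> < 1"
  shows "summable (\<lambda>i. measure M (bad_event \<epsilon> i))"
proof -
  obtain D1 where D1: "D1 > 0" "\<forall>\<^sub>F i in sequentially. \<forall>x\<in>punctured_ball i.
    measure M (excess_event \<epsilon> i x) \<le> D1 / real i ^ 3"
    by (rule excess_event_small[OF \<epsilon>]) blast
  obtain D2 where D2: "D2 > 0" "\<forall>\<^sub>F i in sequentially. \<forall>x\<in>punctured_ball i.
    measure M (deficit_event \<epsilon> i x) \<le> D2 / real i ^ 3"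
    by (rule deficit_event_small[OF \<epsilon>]) blast
  obtain C where C: "C > 0" "\<forall>\<^sub>F i in sequentially. finite (punctured_ball i) \<and> real (card (punctured_ball i)) \<le> C * real i"
    by (rule ball_card) blast
  let ?b = "\<lambda>i. 2 * exp (1 / lam) * exp (- \<epsilon> * ln 2) ^ i + C * (D1 + D2) * (1 / real i ^ 2)"
  show ?thesis
  proof (rule summable_comparison_test_ev)
    show "\<forall>\<^sub>F i in sequentially. norm (measure M (bad_event \<epsilon> i)) \<le> ?b i"
      using D1(2) D2(2) C(2) top_event_small[OF \<epsilon>(1)] eventually_ge_at_top[of 1]
    proof eventually_elim
      case (elim i)
      have UL: "measure M (excess_event \<epsilon> i x \<union> deficit_event \<epsilon> i x) \<le> (D1 + D2) / real i ^ 3" if "x \<in> punctured_ball i" for x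
      proof -
        have "measure M (excess_event \<epsilon> i x \<union> deficit_event \<epsilon> i x) \<le> measure M (excess_event \<epsilon> i x) + measure M (deficit_event \<epsilon> i x)"
          by (intro measure_Un_le deviation_sets)
        also have "\<dots> \<le> D1 / real i ^ 3 + D2 / real i ^ 3"
          using elim(1,2) that by (intro add_mono) auto
        finally show ?thesis by (simp add: add_divide_distrib)
      qed
      have "measure M (bad_event \<epsilon> i) \<le> measure M (top_event \<epsilon> i) + measure M (\<Union>x\<in>punctured_ball i. excess_event \<epsilon> i x \<union> deficit_event \<epsilon> i x)"
        unfolding bad_event_def
        by (intro measure_Un_le top_event_sets sets.countable_UN'' sets.Un deviation_sets) simp
      also have "measure M (\<Union>x\<in>punctured_ball i. excess_event \<epsilon> i x \<union> deficit_event \<epsilon> i x) \<le> (\<Sum>x\<in>punctured_ball i. measure M (excess_event \<epsilon> i x \<union> deficit_event \<epsilon> i x))"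
        using elim(3) by (intro finite_measure_subadditive_finite)
          (auto intro!: sets.Un deviation_sets)
      also have "\<dots> \<le> (\<Sum>x\<in>punctured_ball i. (D1 + D2) / real i ^ 3)" by (intro sum_mono UL)
      also have "\<dots> = real (card (punctured_ball i)) * ((D1 + D2) / real i ^ 3)" by simp
      also have "\<dots> \<le> (C * real i) * ((D1 + D2) / real i ^ 3)"
        using elim(3) D1 D2 by (intro mult_right_mono) auto
      also have "\<dots> = C * (D1 + D2) * (1 / real i ^ 2)"
        using elim(5) by (simp add: field_simps power_numeral_reduce)
      finally show ?case using elim(4) by simp
    qed
    have "exp (- \<epsilon> * ln 2) < 1" using \<epsilon> by simp
    then show "summable ?b"
      by (intro summable_add summable_mult summable_geometric)
         (auto intro: inverse_power_summable[of 2, where 'a = real, simplified inverse_eq_divide])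
  qed
qed

lemma eventually_good:
  assumes \<epsilon>: "0 < \<epsilon>" "\<epsilon> < 1"
  shows "AE \<omega> in M. \<forall>\<^sub>F i in sequentially. \<omega> \<in> space M - bad_event \<epsilon> i"
  by (rule borel_cantelli_AE1)
     (auto intro: bad_event_sets summable_bad_event[OF \<epsilon>] simp: emeasure_eq_measure)

text \<open>
  A heavy point at a time \<open>n\<close> of the block has at least \<open>heavy_count i\<close> visits, so outside the bad event its
  neighbours have typical counts relative to \<open>peak i\<close>; passing from \<open>peak i\<close> to \<open>\<lambda> log n\<close> costs a factor between
  \<open>1 - \<epsilon>\<close> and \<open>1\<close>.
\<close>

lemma heavy_ratio_close:
  assumes \<epsilon>: "0 < \<epsilon>" "\<epsilon> < 1"
    and \<omega>: "\<omega> \<in> space M" "\<omega> \<notin> bad_event \<epsilon> i"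
    and i: "i \<ge> 1" "1 / real i \<le> \<epsilon>" and \<delta>i: "\<delta> (2 ^ i) \<le> \<epsilon>"
    and n: "2 ^ i \<le> n" "n < 2 ^ Suc i"
    and z: "z \<in> heavy_points M X \<delta> n \<omega>" and x: "x \<in> walk_ball M X (r n)"
  shows "\<bar>real (local_time X (z + x) n \<omega>) / (walk_m M X x * lam * ln (real n)) - 1\<bar> \<le> 2 * \<epsilon>"
proof -
  have lam: "lam > 0" by (rule walk_lambda_pos)
  define T where "T = lam * ln (real n)"
  have n1: "n \<ge> 1" using n(1) one_le_power[of "2::nat" i] by linarith
  have "real (2 ^ i) \<le> real n" "real n \<le> real (2 ^ Suc i)" using n by (auto simp only: of_nat_le_iff)
  then have "ln (real (2 ^ i)) \<le> ln (real n)" "ln (real n) \<le> ln (real (2 ^ Suc i))"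
    using n1 by (auto simp: ln_le_cancel_iff simp del: of_nat_power power_Suc)
  then have ln_n: "real i * ln 2 \<le> ln (real n)" "ln (real n) \<le> real (Suc i) * ln 2"
    using ln_realpow[of 2 i] ln_realpow[of 2 "Suc i"] by (simp_all del: power_Suc)
  have peak_pos: "peak i > 0" using i lam by (simp add: peak_def)
  have peak_le: "peak i \<le> T" using ln_n(1) lam by (simp add: peak_def T_def)
  have T_pos: "T > 0" using peak_pos peak_le by linarith
  have peak_ge: "(1 - \<epsilon>) * T \<le> peak i"
  proof -
    have "1 \<le> \<epsilon> * real i" using i by (simp add: field_simps)
    then have "(1 - \<epsilon>) * real (Suc i) \<le> real i" using \<epsilon> by (simp add: algebra_simps)
    then have "((1 - \<epsilon>) * real (Suc i)) * (lam * ln 2) \<le> real i * (lam * ln 2)"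
      using lam by (intro mult_right_mono) auto
    moreover have "(1 - \<epsilon>) * T \<le> (1 - \<epsilon>) * (lam * (real (Suc i) * ln 2))"
      unfolding T_def using ln_n(2) lam \<epsilon> by (intro mult_left_mono) auto
    ultimately show ?thesis by (simp add: peak_def mult_ac)
  qed
  have "\<delta> n \<le> \<delta> (2 ^ i)"
    using monotone_onD[OF \<delta>_antimono, of "2 ^ i" n] n by simp
  have heavy: "(1 - \<delta> n) * T \<le> real (local_time X z n \<omega>)"
    using z by (simp add: heavy_points_def T_def mult.assoc)
  have "(1 - \<delta> (2 ^ i)) * peak i \<le> (1 - \<delta> n) * T"
    using \<open>\<delta> n \<le> \<delta> (2 ^ i)\<close> \<delta>i \<epsilon> peak_le peak_pos by (intro mult_mono) auto
  then have count: "local_time X z n \<omega> \<ge> heavy_count i"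
    unfolding heavy_count_def using heavy by (simp add: nat_le_iff ceiling_le_iff)
  have grow: "local_time X y n \<omega> \<le> local_time X y (2 ^ Suc i) \<omega>" for y
    unfolding local_time_def using n by (intro sum_of_bool_mono) simp
  show ?thesis
  proof (cases "x = 0")
    case True
    define L where "L = real (local_time X z n \<omega>)"
    have "\<omega> \<notin> top_event \<epsilon> i" using \<omega>(2) by (simp add: bad_event_def)
    then have "local_time X z (2 ^ Suc i) \<omega> < top_count \<epsilon> i" using \<omega>(1) by (auto simp: top_event_def not_le)
    then have "local_time X z n \<omega> < top_count \<epsilon> i" using grow[of z] by linarith
    then have "L < (1 + \<epsilon>) * peak i"
      unfolding top_count_def L_def by (simp add: zless_nat_eq_int_zless less_ceiling_iff)
    also have "\<dots> \<le> (1 + \<epsilon>) * T" using peak_le \<epsilon> by (intro mult_left_mono) auto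
    finally have up: "L \<le> (1 + \<epsilon>) * T" by simp
    have "(1 - \<epsilon>) * T \<le> (1 - \<delta> n) * T"
      using \<open>\<delta> n \<le> \<delta> (2 ^ i)\<close> \<delta>i T_pos by (intro mult_right_mono) auto
    then have lo: "(1 - \<epsilon>) * T \<le> L" using heavy by (simp add: L_def)
    have "\<bar>L / T - 1\<bar> \<le> \<epsilon>" using up lo T_pos by (simp add: abs_le_iff field_simps)
    then show ?thesis using True \<epsilon> by (simp add: L_def T_def walk_m_def)
  next
    case False
    define L where "L = real (local_time X (z + x) n \<omega>)"
    define m where "m = ratio x"
    have m: "m > 0" unfolding m_def by (rule ratio_pos)
    have "r n \<le> rad i" by (rule mono_onD[OF r_mono]) (use n n1 in auto)
    then have xb: "x \<in> punctured_ball i" using x False by (simp add: punctured_ball_def walk_ball_def)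
    have no_many: "\<omega> \<notin> excess_event \<epsilon> i x"
      and no_few: "\<omega> \<notin> deficit_event \<epsilon> i x"
      using \<omega>(2) xb by (auto simp: bad_event_def)
    have "local_time X z (2 ^ Suc i) \<omega> \<ge> heavy_count i" using count grow[of z] by linarith
    then have "local_time X (z + x) (2 ^ Suc i) \<omega> < upper_count \<epsilon> i x"
      using no_many \<omega>(1) unfolding excess_event_def many_event_def mem_Collect_eq by (meson not_le)
    then have "local_time X (z + x) n \<omega> < upper_count \<epsilon> i x" using grow[of "z + x"] by linarith
    then have "L < (1 + \<epsilon>) * m * peak i"
      unfolding upper_count_def L_def m_def by (simp add: zless_nat_eq_int_zless less_ceiling_iff)
    also have "\<dots> \<le> (1 + \<epsilon>) * m * T" using peak_le \<epsilon> m by (intro mult_left_mono) auto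
    finally have up: "L \<le> (1 + \<epsilon>) * (m * T)" by simp
    have nle: "n \<le> 2 ^ Suc i" using n(2) by (rule less_imp_le)
    have "lower_count \<epsilon> i x < local_time X (z + x) n \<omega>"
      using no_few \<omega>(1) count nle unfolding deficit_event_def few_event_def mem_Collect_eq by (meson not_le)
    then have "(1 - \<epsilon>) * m * peak i \<le> L"
      unfolding lower_count_def L_def m_def by linarith
    moreover have "(1 - \<epsilon>) * m * ((1 - \<epsilon>) * T) \<le> (1 - \<epsilon>) * m * peak i"
      using peak_ge \<epsilon> m by (intro mult_left_mono) auto
    moreover have "(1 - 2 * \<epsilon>) * (m * T) \<le> (1 - \<epsilon>) * m * ((1 - \<epsilon>) * T)"
    proof -
      have "(1 - 2 * \<epsilon>) \<le> (1 - \<epsilon>) * (1 - \<epsilon>)" by (simp add: algebra_simps)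
      then have "(1 - 2 * \<epsilon>) * (m * T) \<le> ((1 - \<epsilon>) * (1 - \<epsilon>)) * (m * T)"
        using m T_pos by (intro mult_right_mono) auto
      then show ?thesis by (simp only: mult_ac)
    qed
    ultimately have lo: "(1 - 2 * \<epsilon>) * (m * T) \<le> L" by linarith
    have mT: "m * T > 0" using m T_pos by simp
    have "(1 + \<epsilon>) * (m * T) \<le> (1 + 2 * \<epsilon>) * (m * T)" using \<epsilon> mT by (intro mult_right_mono) auto
    then have up': "L \<le> (1 + 2 * \<epsilon>) * (m * T)" using up by linarith
    have "1 - 2 * \<epsilon> \<le> L / (m * T)" "L / (m * T) \<le> 1 + 2 * \<epsilon>"
      using lo up' mT by (simp_all add: pos_le_divide_eq pos_divide_le_eq)
    then have "\<bar>L / (m * T) - 1\<bar> \<le> 2 * \<epsilon>" by (simp add: abs_le_iff)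
    then show ?thesis using False by (simp add: L_def T_def m_def walk_m_eq mult.assoc)
  qed
qed

lemma eventually_max_deviation_le:
  assumes \<epsilon>: "0 < \<epsilon>" "\<epsilon> < 1" and good: "\<forall>\<^sub>F i in sequentially. \<omega> \<in> space M - bad_event \<epsilon> i"
  shows "\<forall>\<^sub>F n in sequentially. max_deviation M X r \<delta> n \<omega> \<le> ennreal (2 * \<epsilon>)"
proof -
  have "\<forall>\<^sub>F i in sequentially. \<delta> (2 ^ i) < \<epsilon>"
    by (rule order_tendstoD(2)[OF \<delta>_dyadic_limit \<epsilon>(1)])
  moreover have "\<forall>\<^sub>F i in sequentially. 1 / real i < \<epsilon>"
    by (rule order_tendstoD(2)[OF lim_1_over_n \<epsilon>(1)])
  ultimately have "\<forall>\<^sub>F i in sequentially. \<omega> \<in> space M - bad_event \<epsilon> i \<and> \<delta> (2 ^ i) \<le> \<epsilon> \<and> 1 / real i \<le> \<epsilon> \<and> i \<ge> 1"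
    using good eventually_ge_at_top[of 1] by eventually_elim auto
  then obtain i0 where i0: "\<And>i. i \<ge> i0 \<Longrightarrow> \<omega> \<in> space M - bad_event \<epsilon> i \<and> \<delta> (2 ^ i) \<le> \<epsilon> \<and> 1 / real i \<le> \<epsilon> \<and> i \<ge> 1"
    by (auto simp: eventually_sequentially)
  show ?thesis unfolding eventually_sequentially
  proof (intro exI[of _ "2 ^ i0"] allI impI)
    fix n :: nat assume n: "2 ^ i0 \<le> n"
    then have "n \<ge> 1" using one_le_power[of "2::nat" i0] by linarith
    then obtain i where i: "2 ^ i \<le> n" "n < 2 ^ Suc i" using ex_power_ivl1[of 2 n] by auto
    have "(2::nat) ^ i0 < 2 ^ Suc i" using n i(2) by linarith
    then have "i0 < Suc i" by (rule power_less_imp_less_exp[rotated]) simp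
    then have "i \<ge> i0" by simp
    note f = i0[OF this]
    show "max_deviation M X r \<delta> n \<omega> \<le> ennreal (2 * \<epsilon>)"
      unfolding max_deviation_def
    proof (intro SUP_least ennreal_leI)
      fix z x assume "z \<in> heavy_points M X \<delta> n \<omega>" "x \<in> walk_ball M X (r n)"
      then show "\<bar>real (local_time X (z + x) n \<omega>) / (walk_m M X x * lam * ln (real n)) - 1\<bar> \<le> 2 * \<epsilon>"
        using f by (intro heavy_ratio_close[OF \<epsilon> _ _ _ _ _ i]) auto
    qed
  qed
qed

theorem max_deviation_tendsto_0: "AE \<omega> in M. (\<lambda>n. max_deviation M X r \<delta> n \<omega>) \<longlonglongrightarrow> 0"
proof -
  define e :: "nat \<Rightarrow> real" where "e m = 1 / (real m + 2)" for m
  have e: "0 < e m" "e m < 1" for m by (auto simp: e_def)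
  have "AE \<omega> in M. \<forall>m. \<forall>\<^sub>F i in sequentially. \<omega> \<in> space M - bad_event (e m) i"
    unfolding AE_all_countable using eventually_good[OF e] by blast
  then show ?thesis
  proof (rule AE_mp, intro AE_I2 impI)
    fix \<omega> assume "\<forall>m. \<forall>\<^sub>F i in sequentially. \<omega> \<in> space M - bad_event (e m) i"
    then have dev: "\<forall>\<^sub>F n in sequentially. max_deviation M X r \<delta> n \<omega> \<le> ennreal (2 * e m)" for m
      using eventually_max_deviation_le[OF e] by blast
    show "(\<lambda>n. max_deviation M X r \<delta> n \<omega>) \<longlonglongrightarrow> 0"
    proof (rule order_tendstoI)
      fix a :: ennreal assume a: "0 < a"
      have "\<exists>m. ennreal (2 * e m) < a"
      proof (cases a)
        case (real t)
        then have t: "t > 0" using a by simp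
        obtain m where "2 / t < real m" using reals_Archimedean2 by blast
        then have "2 * e m < t" using t by (simp add: e_def field_simps)
        then show ?thesis using real t e[of m] by (auto intro!: exI[of _ m] simp: ennreal_less_iff)
      next
        case top
        then show ?thesis by (auto intro!: exI[of _ 0])
      qed
      then obtain m where m: "ennreal (2 * e m) < a" by blast
      show "\<forall>\<^sub>F n in sequentially. max_deviation M X r \<delta> n \<omega> < a"
        using dev[of m] by eventually_elim (use m in auto)
    qed simp
  qed
qed

end

theorem theorem1p1:
  fixes M :: "'a measure"
    and X :: "nat \<Rightarrow> 'a \<Rightarrow> int ^ 'd"
    and r \<delta> :: "nat \<Rightarrow> real"
  assumes "CARD('d) \<ge> 5"
    and "random_walk M X"
    and "symmetric_walk M X"
    and "aperiodic_walk M X"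
    and "moment_condition M X"
    and "\<And>n. n \<ge> 1 \<Longrightarrow> r n > 0"
    and "\<And>n. n \<ge> 1 \<Longrightarrow> \<delta> n > 0"
    and "antimono_on {1..} \<delta>"
    and "mono_on {1..} r"
    and "\<And>c::real. c > 0 \<Longrightarrow>
           \<exists>C>0. \<forall>n. \<lfloor>c * real n\<rfloor> \<ge> 1 \<longrightarrow> r (nat \<lfloor>c * real n\<rfloor>) / r n < C"
    and "(\<lambda>n. r n ^ (2 * CARD('d) - 4) * (ln (ln (real n)) / ln (real n))) \<longlonglongrightarrow> 0"
    and "(\<lambda>n. \<delta> n * r n ^ (2 * CARD('d) - 4)) \<longlonglongrightarrow> 0"
  shows "AE \<omega> in M. (\<lambda>n. max_deviation M X r \<delta> n \<omega>) \<longlonglongrightarrow> 0"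
proof -
  have doubling: "\<exists>C>0. \<forall>n\<ge>1. r (2 * n) \<le> C * r n"
  proof -
    obtain C where C: "C > 0" "\<And>n. \<lfloor>2 * real n\<rfloor> \<ge> 1 \<Longrightarrow> r (nat \<lfloor>2 * real n\<rfloor>) / r n < C"
      using assms(10)[of 2] by auto
    have "r (2 * n) \<le> C * r n" if n: "n \<ge> 1" for n
    proof -
      have "\<lfloor>2 * real n\<rfloor> = int (2 * n)" using floor_of_nat[of "2 * n"] by simp
      then show ?thesis using C(2)[of n] assms(6)[OF n] n by (simp add: pos_divide_less_eq nat_mult_distrib)
    qed
    then show ?thesis using C(1) by blast
  qed
  interpret heavy_setting M X r \<delta>
    by unfold_locales (fact assms doubling)+
  show ?thesis by (rule max_deviation_tendsto_0)
qed

end
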